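(* Let $k$ be a field, let $H$ be a Hopf algebra over $k$, and let $A=T(V)/(R)$ be a Koszul algebra (connected, $\mathbb{N}$-graded, locally finite-dimensional, with $V=A_1$ and $R\subseteq V\otimes V$) which is also an $H$-module algebra on which $H$ acts by degree-preserving endomorphisms, i.e. $h\rhd a\in A_i$ for all $h\in H$, $a\in A_i$, $i\in\mathbb{N}$. If $\mu\in H\otimes H$ is a counital $2$-cocycle of $H$, then the Drinfeld twist $A_\mu$ is a Koszul algebra given by $T(V)/(R_\mu)$, where $R_\mu:=\{\mu\rhd r\mid r\in R\}\subseteq V\otimes V$.
   Context: All objects are linear over the field $k$ and $\otimes=\otimes_k$. For a Hopf algebra $H$, $\triangle$ denotes the coproduct and $\epsilon$ the counit; the action of $h\in H$ on an element $a$ of an $H$-module is written $h\rhd a$. An $H$-module algebra is an algebra $A$ that is an $H$-module such that the product $m:A\otimes A\to A$ satisfies $h\rhd m(a\otimes b)=m(\triangle(h)\rhd (a\otimes b))$ and $h\rhd 1_A=\epsilon(h)1_A$. Here and below $H\otimes H$ acts on a tensor product of two $H$-modules by $(h\otimes h')\rhd(a\otimes b)=(h\rhd a)\otimes(h'\rhd b)$; in particular $\mu\in H\otimes H$ acts on $V\otimes V$. A $2$-cocycle of $H$ is an invertible element $\mu\in H\otimes H$ with $(\mu\otimes 1)\cdot(\triangle\otimes\mathrm{id})(\mu)=(1\otimes\mu)\cdot(\mathrm{id}\otimes\triangle)(\mu)$. It is counital if $(\epsilon\otimes\mathrm{id})(\mu)=1=(\mathrm{id}\otimes\epsilon)(\mu)$.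 The Drinfeld twist of an $H$-module algebra $(A,m)$ by a counital $2$-cocycle $\mu$ is the algebra $(A_\mu,m_\mu)$ with $A_\mu=A$ as a vector space (and the same unit) and product $m_\mu(a\otimes b)=m(\mu^{-1}\rhd(a\otimes b))$. A connected $\mathbb{N}$-graded algebra is $A=\bigoplus_{i\in\mathbb{N}}A_i$ with $A_iA_j\subseteq A_{i+j}$ and $A_0=k$; it is locally finite-dimensional if each $A_i$ is finite-dimensional. Put $A_+=\bigoplus_{i>0}A_i$; then $k\cong A/A_+$ is an $A$-module via the quotient (augmentation) map $A\to k$. The algebra $A$ is Koszul if $k$ has a linear graded free resolution as a (left) $A$-module, i.e. a resolution $\cdots\to P_2\to P_1\to P_0\to k\to 0$ by graded free $A$-modules with degree-preserving differentials in which each $P_n$ is generated in degree $n$. A Koszul algebra is quadratic, i.e. $A=T(V)/(R)$ with $V=A_1$, $R\subseteq V\otimes V$ a subspace, $T(V)$ the tensor algebra, and $(R)$ the two-sided ideal generated by $R$. For a connected graded algebra $B$ with $B_1=V$, the equality $B=T(V)/(S)$ means that the canonical algebra homomorphism $T(V)\to B$ extending the inclusion $V=B_1\hookrightarrow B$ is surjective with kernel $(S)$. The algebra $A_\mu$ carries the grading of $A$, so $(A_\mu)_1=V$. *)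

theory Defs
  imports Complex_Main "HOL-Library.Poly_Mapping"
begin

text \<open>
  Tensors. Elements of tensor powers of a \<open>k\<close>-vector space \<open>V\<close>, and of the tensor algebra
  \<open>T(V)\<close>, are represented by formal \<open>k\<close>-linear combinations of words in \<open>V\<close>: the word
  \<open>[v1, ..., vn]\<close> represents \<open>v1 \<otimes> ... \<otimes> vn\<close>. Such combinations form the type
  \<open>'a list \<Rightarrow>\<^sub>0 'k\<close>, and equality in the tensor power is the congruence \<open>tensor_eq\<close> modulo the
  subspace spanned by the multilinearity relations. The space \<open>V\<close> is a subspace of an ambient
  type \<open>'a\<close> (all of it for the Hopf algebra, the degree one part for a graded algebra).
  Length zero words give \<open>k\<close>.
\<close>

type_synonym ('a, 'k) tensor = "'a list \<Rightarrow>\<^sub>0 'k"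

definition fscale :: "'k::field \<Rightarrow> ('b \<Rightarrow>\<^sub>0 'k) \<Rightarrow> ('b \<Rightarrow>\<^sub>0 'k)" where
  "fscale c x = Poly_Mapping.map ((*) c) x"

lemma lookup_fscale [simp]: "Poly_Mapping.lookup (fscale c x) b = c * Poly_Mapping.lookup x b"
  by (auto simp: fscale_def Poly_Mapping.map.rep_eq when_def)

lemma vector_space_fscale: "vector_space (fscale :: 'k::field \<Rightarrow> ('b \<Rightarrow>\<^sub>0 'k) \<Rightarrow> _)"
  by unfold_locales (auto intro!: poly_mapping_eqI simp: lookup_add algebra_simps)

definition linear_ext ::
  "('k::field \<Rightarrow> 'c \<Rightarrow> 'c) \<Rightarrow> ('b \<Rightarrow> 'c::ab_group_add) \<Rightarrow> ('b \<Rightarrow>\<^sub>0 'k) \<Rightarrow> 'c" where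
  "linear_ext s f x = (\<Sum>b\<in>Poly_Mapping.keys x. s (Poly_Mapping.lookup x b) (f b))"

definition bilinear_ext ::
  "('b \<Rightarrow> 'c \<Rightarrow> 'd) \<Rightarrow> ('b \<Rightarrow>\<^sub>0 'k::field) \<Rightarrow> ('c \<Rightarrow>\<^sub>0 'k) \<Rightarrow> ('d \<Rightarrow>\<^sub>0 'k)" where
  "bilinear_ext f x y =
     (\<Sum>b\<in>Poly_Mapping.keys x. \<Sum>c\<in>Poly_Mapping.keys y.
        Poly_Mapping.single (f b c) (Poly_Mapping.lookup x b * Poly_Mapping.lookup y c))"

definition pure_tensor :: "'a list \<Rightarrow> ('a, 'k::field) tensor" where
  "pure_tensor w = Poly_Mapping.single w 1"

definition tensor_algebra :: "'a set \<Rightarrow> ('a, 'k::field) tensor set" where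
  "tensor_algebra V = {x. \<forall>w\<in>Poly_Mapping.keys x. set w \<subseteq> V}"

definition tensor_power :: "'a set \<Rightarrow> nat \<Rightarrow> ('a, 'k::field) tensor set" where
  "tensor_power V n = {x \<in> tensor_algebra V. \<forall>w\<in>Poly_Mapping.keys x. length w = n}"

definition multilinear_relations ::
  "('k::field \<Rightarrow> 'a \<Rightarrow> 'a) \<Rightarrow> 'a::ab_group_add set \<Rightarrow> ('a, 'k) tensor set" where
  "multilinear_relations s V =
     {pure_tensor (u @ [a + b] @ w) - pure_tensor (u @ [a] @ w) - pure_tensor (u @ [b] @ w)
        | u w a b. set u \<subseteq> V \<and> set w \<subseteq> V \<and> a \<in> V \<and> b \<in> V} \<union>
     {pure_tensor (u @ [s c a] @ w) - fscale c (pure_tensor (u @ [a] @ w))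
        | u w c a. set u \<subseteq> V \<and> set w \<subseteq> V \<and> a \<in> V}"

definition tensor_eq ::
  "('k::field \<Rightarrow> 'a \<Rightarrow> 'a) \<Rightarrow> 'a::ab_group_add set \<Rightarrow> ('a, 'k) tensor \<Rightarrow> ('a, 'k) tensor \<Rightarrow> bool" where
  "tensor_eq s V x y \<longleftrightarrow> x - y \<in> module.span fscale (multilinear_relations s V)"

text \<open>The product of \<open>T(V)\<close>. In the Hopf algebra setting it gives \<open>\<mu> \<otimes> 1\<close> and \<open>1 \<otimes> \<mu>\<close>.\<close>

definition tensor_concat ::
  "('a, 'k::field) tensor \<Rightarrow> ('a, 'k) tensor \<Rightarrow> ('a, 'k) tensor" (infixr \<open>\<otimes>\<^sub>t\<close> 75) where
  "x \<otimes>\<^sub>t y = bilinear_ext (@) x y"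

text \<open>
  With \<open>f\<close> the product of \<open>H\<close> this is the product of the algebra \<open>H \<otimes> ... \<otimes> H\<close>;
  with \<open>f\<close> the action of \<open>H\<close> on \<open>A\<close> it is the action of \<open>H \<otimes> H\<close> on \<open>A \<otimes> A\<close>.
\<close>

definition tensor_componentwise ::
  "('a \<Rightarrow> 'b \<Rightarrow> 'c) \<Rightarrow> ('a, 'k::field) tensor \<Rightarrow> ('b, 'k) tensor \<Rightarrow> ('c, 'k) tensor" where
  "tensor_componentwise f x y = bilinear_ext (map2 f) x y"

text \<open>The map \<open>f \<otimes> g\<close> on \<open>V \<otimes> V\<close>.\<close>

definition tensor_map2 ::
  "('a \<Rightarrow> ('b, 'k::field) tensor) \<Rightarrow> ('a \<Rightarrow> ('b, 'k) tensor) \<Rightarrow> ('a, 'k) tensor \<Rightarrow> ('b, 'k) tensor" where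
  "tensor_map2 f g x = linear_ext fscale (\<lambda>w. f (w ! 0) \<otimes>\<^sub>t g (w ! 1)) x"

text \<open>The linear map \<open>V \<otimes> V \<rightarrow> W\<close> induced by a bilinear map \<open>f\<close>.\<close>

definition tensor_lift2 ::
  "('k::field \<Rightarrow> 'b \<Rightarrow> 'b) \<Rightarrow> ('a \<Rightarrow> 'a \<Rightarrow> 'b::ab_group_add) \<Rightarrow> ('a, 'k) tensor \<Rightarrow> 'b" where
  "tensor_lift2 s f x = linear_ext s (\<lambda>w. f (w ! 0) (w ! 1)) x"


locale assoc_algebra = vector_space scale
  for scale :: "'k::field \<Rightarrow> 'a::ab_group_add \<Rightarrow> 'a" +
  fixes mult :: "'a \<Rightarrow> 'a \<Rightarrow> 'a"
    and unit :: 'a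
  assumes mult_add_left: "mult (x + y) z = mult x z + mult y z"
    and mult_add_right: "mult x (y + z) = mult x y + mult x z"
    and mult_scale_left: "mult (scale c x) y = scale c (mult x y)"
    and mult_scale_right: "mult x (scale c y) = scale c (mult x y)"
    and mult_assoc: "mult (mult x y) z = mult x (mult y z)"
    and mult_unit_left: "mult unit x = x"
    and mult_unit_right: "mult x unit = x"

locale hopf_algebra = assoc_algebra scale mult unit
  for scale :: "'k::field \<Rightarrow> 'h::ab_group_add \<Rightarrow> 'h" and mult unit +
  fixes coprod :: "'h \<Rightarrow> ('h, 'k) tensor"
    and counit :: "'h \<Rightarrow> 'k"
    and antipode :: "'h \<Rightarrow> 'h"
  assumes coprod_in: "coprod h \<in> tensor_power UNIV 2"
    and coprod_add: "tensor_eq scale UNIV (coprod (g + h)) (coprod g + coprod h)"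
    and coprod_scale: "tensor_eq scale UNIV (coprod (scale c h)) (fscale c (coprod h))"
    and coprod_mult: "tensor_eq scale UNIV (coprod (mult g h))
                        (tensor_componentwise mult (coprod g) (coprod h))"
    and coprod_unit: "tensor_eq scale UNIV (coprod unit) (pure_tensor [unit, unit])"
    and coassoc: "tensor_eq scale UNIV
                    (tensor_map2 coprod (\<lambda>x. pure_tensor [x]) (coprod h))
                    (tensor_map2 (\<lambda>x. pure_tensor [x]) coprod (coprod h))"
    and counit_linear: "Vector_Spaces.linear scale (*) counit"
    and counit_mult: "counit (mult g h) = counit g * counit h"
    and counit_unit: "counit unit = 1"
    and counit_left: "tensor_lift2 scale (\<lambda>x y. scale (counit x) y) (coprod h) = h"
    and counit_right: "tensor_lift2 scale (\<lambda>x y. scale (counit y) x) (coprod h) = h"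
    and antipode_linear: "Vector_Spaces.linear scale scale antipode"
    and antipode_left: "tensor_lift2 scale (\<lambda>x y. mult (antipode x) y) (coprod h) = scale (counit h) unit"
    and antipode_right: "tensor_lift2 scale (\<lambda>x y. mult x (antipode y)) (coprod h) = scale (counit h) unit"

locale module_algebra =
  H: hopf_algebra scaleH multH unitH coprod counit antipode +
  A: assoc_algebra scale mult unit
  for scaleH :: "'k::field \<Rightarrow> 'h::ab_group_add \<Rightarrow> 'h" and multH unitH coprod counit antipode
    and scale :: "'k \<Rightarrow> 'a::ab_group_add \<Rightarrow> 'a" and mult unit +
  fixes act :: "'h \<Rightarrow> 'a \<Rightarrow> 'a"
  assumes act_add_left: "act (g + h) a = act g a + act h a"
    and act_scale_left: "act (scaleH c h) a = scale c (act h a)"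
    and act_add_right: "act h (a + b) = act h a + act h b"
    and act_scale_right: "act h (scale c a) = scale c (act h a)"
    and act_multH: "act (multH g h) a = act g (act h a)"
    and act_unitH: "act unitH a = a"
    and act_mult: "act h (mult a b) =
          tensor_lift2 scale mult (tensor_componentwise act (coprod h) (pure_tensor [a, b]))"
    and act_unit: "act h unit = scale (counit h) unit"


definition is_inverse2 ::
  "('k::field \<Rightarrow> 'h \<Rightarrow> 'h) \<Rightarrow> ('h \<Rightarrow> 'h \<Rightarrow> 'h) \<Rightarrow> 'h \<Rightarrow>
   ('h::ab_group_add, 'k) tensor \<Rightarrow> ('h, 'k) tensor \<Rightarrow> bool" where
  "is_inverse2 scale mult unit \<mu> \<nu> \<longleftrightarrow>
     \<nu> \<in> tensor_power UNIV 2 \<and>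
     tensor_eq scale UNIV (tensor_componentwise mult \<mu> \<nu>) (pure_tensor [unit, unit]) \<and>
     tensor_eq scale UNIV (tensor_componentwise mult \<nu> \<mu>) (pure_tensor [unit, unit])"

text \<open>A representative of \<open>\<mu>\<^sup>-\<^sup>1\<close>, which is unique up to \<open>tensor_eq\<close> if it exists.\<close>

definition inverse2 ::
  "('k::field \<Rightarrow> 'h \<Rightarrow> 'h) \<Rightarrow> ('h \<Rightarrow> 'h \<Rightarrow> 'h) \<Rightarrow> 'h \<Rightarrow>
   ('h::ab_group_add, 'k) tensor \<Rightarrow> ('h, 'k) tensor" where
  "inverse2 scale mult unit \<mu> = (SOME \<nu>. is_inverse2 scale mult unit \<mu> \<nu>)"

context hopf_algebra
begin

definition two_cocycle :: "('h, 'k) tensor \<Rightarrow> bool" where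
  "two_cocycle \<mu> \<longleftrightarrow>
     \<mu> \<in> tensor_power UNIV 2 \<and>
     (\<exists>\<nu>. is_inverse2 scale mult unit \<mu> \<nu>) \<and>
     tensor_eq scale UNIV
       (tensor_componentwise mult (\<mu> \<otimes>\<^sub>t pure_tensor [unit])
          (tensor_map2 coprod (\<lambda>x. pure_tensor [x]) \<mu>))
       (tensor_componentwise mult (pure_tensor [unit] \<otimes>\<^sub>t \<mu>)
          (tensor_map2 (\<lambda>x. pure_tensor [x]) coprod \<mu>))"

definition counital :: "('h, 'k) tensor \<Rightarrow> bool" where
  "counital \<mu> \<longleftrightarrow>
     tensor_lift2 scale (\<lambda>x y. scale (counit x) y) \<mu> = unit \<and>
     tensor_lift2 scale (\<lambda>x y. scale (counit y) x) \<mu> = unit"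

end

definition twisted_mult ::
  "('k::field \<Rightarrow> 'h::ab_group_add \<Rightarrow> 'h) \<Rightarrow> ('h \<Rightarrow> 'h \<Rightarrow> 'h) \<Rightarrow> 'h \<Rightarrow>
   ('k \<Rightarrow> 'a \<Rightarrow> 'a) \<Rightarrow> ('a \<Rightarrow> 'a \<Rightarrow> 'a) \<Rightarrow> ('h \<Rightarrow> 'a \<Rightarrow> 'a) \<Rightarrow> ('h, 'k) tensor \<Rightarrow>
   'a::ab_group_add \<Rightarrow> 'a \<Rightarrow> 'a" where
  "twisted_mult scaleH multH unitH scale mult act \<mu> a b =
     tensor_lift2 scale mult
       (tensor_componentwise act (inverse2 scaleH multH unitH \<mu>) (pure_tensor [a, b]))"


locale connected_graded_algebra = assoc_algebra scale mult unit
  for scale :: "'k::field \<Rightarrow> 'a::ab_group_add \<Rightarrow> 'a" and mult unit +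
  fixes A :: "nat \<Rightarrow> 'a set"
  assumes graded_subspace: "subspace (A i)"
    and graded_decomposition:
      "\<exists>!f. (\<forall>i. f i \<in> A i) \<and> finite {i. f i \<noteq> 0} \<and> a = (\<Sum>i | f i \<noteq> 0. f i)"
    and graded_mult: "a \<in> A i \<Longrightarrow> b \<in> A j \<Longrightarrow> mult a b \<in> A (i + j)"
    and connected: "A 0 = range (\<lambda>c. scale c unit)" "unit \<noteq> 0"
begin

definition augmentation_ideal :: "'a set" where
  "augmentation_ideal = span (\<Union>i\<in>{0<..}. A i)"

text \<open>The augmentation \<open>A \<rightarrow> A/A\<^sub>+ = k\<close>.\<close>

definition augmentation :: "'a \<Rightarrow> 'k" where
  "augmentation a = (THE c. a - scale c unit \<in> augmentation_ideal)"

definition locally_finite_dim :: bool where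
  "locally_finite_dim \<longleftrightarrow> (\<forall>i. \<exists>S. finite S \<and> span S = A i)"

end

text \<open>
  The free left module with basis \<open>B\<close> consists of the finitely supported functions from \<open>B\<close>
  to the algebra. \<open>free_component A B n j\<close> is its degree \<open>j\<close> part if the basis is
  placed in degree \<open>n\<close>.
\<close>

definition free_module :: "'b set \<Rightarrow> ('b \<Rightarrow>\<^sub>0 'a::ab_group_add) set" where
  "free_module B = {x. Poly_Mapping.keys x \<subseteq> B}"

definition free_smult ::
  "('a \<Rightarrow> 'a \<Rightarrow> 'a) \<Rightarrow> 'a \<Rightarrow> ('b \<Rightarrow>\<^sub>0 'a::ab_group_add) \<Rightarrow> ('b \<Rightarrow>\<^sub>0 'a)" where
  "free_smult mult a x = Poly_Mapping.map (mult a) x"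

definition free_component ::
  "(nat \<Rightarrow> 'a set) \<Rightarrow> 'b set \<Rightarrow> nat \<Rightarrow> nat \<Rightarrow> ('b \<Rightarrow>\<^sub>0 'a::ab_group_add) set" where
  "free_component A B n j =
     {x \<in> free_module B. \<forall>b\<in>B.
        if n \<le> j then Poly_Mapping.lookup x b \<in> A (j - n) else Poly_Mapping.lookup x b = 0}"

text \<open>
  A linear graded free resolution of \<open>k\<close>: \<open>P\<^sub>n\<close> is free on \<open>B n\<close>, with the basis in degree
  \<open>n\<close>; \<open>d n\<close> is the differential \<open>P\<^sub>n\<^sub>+\<^sub>1 \<rightarrow> P\<^sub>n\<close> and \<open>e\<close> is the map \<open>P\<^sub>0 \<rightarrow> k\<close>.
\<close>

locale linear_free_resolution = connected_graded_algebra scale mult unit A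
  for scale :: "'k::field \<Rightarrow> 'a::ab_group_add \<Rightarrow> 'a" and mult unit A +
  fixes B :: "nat \<Rightarrow> 'b set"
    and d :: "nat \<Rightarrow> ('b \<Rightarrow>\<^sub>0 'a) \<Rightarrow> ('b \<Rightarrow>\<^sub>0 'a)"
    and e :: "('b \<Rightarrow>\<^sub>0 'a) \<Rightarrow> 'k"
  assumes d_in: "x \<in> free_module (B (Suc n)) \<Longrightarrow> d n x \<in> free_module (B n)"
    and d_add: "x \<in> free_module (B (Suc n)) \<Longrightarrow> y \<in> free_module (B (Suc n)) \<Longrightarrow>
                  d n (x + y) = d n x + d n y"
    and d_smult: "x \<in> free_module (B (Suc n)) \<Longrightarrow>
                  d n (free_smult mult a x) = free_smult mult a (d n x)"
    and d_degree: "x \<in> free_component A (B (Suc n)) (Suc n) j \<Longrightarrow>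
                  d n x \<in> free_component A (B n) n j"
    and e_add: "x \<in> free_module (B 0) \<Longrightarrow> y \<in> free_module (B 0) \<Longrightarrow> e (x + y) = e x + e y"
    and e_smult: "x \<in> free_module (B 0) \<Longrightarrow> e (free_smult mult a x) = augmentation a * e x"
    and e_degree: "x \<in> free_component A (B 0) 0 j \<Longrightarrow> j > 0 \<Longrightarrow> e x = 0"
    and exact_k: "e ` free_module (B 0) = UNIV"
    and exact_0: "{x \<in> free_module (B 0). e x = 0} = d 0 ` free_module (B 1)"
    and exact_Suc: "{x \<in> free_module (B (Suc n)). d n x = 0} = d (Suc n) ` free_module (B (Suc (Suc n)))"

text \<open>
  Taking the bases to be sets of natural numbers is no restriction for locally
  finite-dimensional \<open>A\<close>. In a linear resolution \<open>P\<^sub>n\<^sub>+\<^sub>1\<close> vanishes in degree \<open>n\<close>, so by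
  exactness the span of the basis of \<open>P\<^sub>n\<close> embeds in the degree \<open>n\<close> part of \<open>P\<^sub>n\<^sub>-\<^sub>1\<close>
  (of \<open>k\<close> if \<open>n = 0\<close>), and by induction all bases are finite.
\<close>

definition koszul_algebra ::
  "('k::field \<Rightarrow> 'a::ab_group_add \<Rightarrow> 'a) \<Rightarrow> ('a \<Rightarrow> 'a \<Rightarrow> 'a) \<Rightarrow> 'a \<Rightarrow> (nat \<Rightarrow> 'a set) \<Rightarrow> bool" where
  "koszul_algebra scale mult unit A \<longleftrightarrow>
     connected_graded_algebra scale mult unit A \<and>
     connected_graded_algebra.locally_finite_dim scale A \<and>
     (\<exists>(B :: nat \<Rightarrow> nat set) d e. linear_free_resolution scale mult unit A B d e)"


text \<open>
  The two-sided ideal of \<open>T(V)\<close> generated by the classes of the elements of \<open>S\<close>, as a set of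
  representatives closed under \<open>tensor_eq\<close>.
\<close>

definition tensor_ideal ::
  "('k::field \<Rightarrow> 'a \<Rightarrow> 'a) \<Rightarrow> 'a::ab_group_add set \<Rightarrow> ('a, 'k) tensor set \<Rightarrow> ('a, 'k) tensor set" where
  "tensor_ideal scale V S =
     {x \<in> tensor_algebra V.
        \<exists>y \<in> module.span fscale
               {p \<otimes>\<^sub>t r \<otimes>\<^sub>t q | p r q. p \<in> tensor_algebra V \<and> r \<in> S \<and> q \<in> tensor_algebra V}.
          tensor_eq scale V x y}"

text \<open>The algebra homomorphism from \<open>T(V)\<close> extending the inclusion of \<open>V\<close>.\<close>

definition canonical_hom ::
  "('k::field \<Rightarrow> 'a \<Rightarrow> 'a) \<Rightarrow> ('a \<Rightarrow> 'a \<Rightarrow> 'a) \<Rightarrow> 'a::ab_group_add \<Rightarrow> ('a, 'k) tensor \<Rightarrow> 'a" where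
  "canonical_hom scale mult unit x = linear_ext scale (\<lambda>w. foldr mult w unit) x"

text \<open>
  The equality of an algebra with \<open>T(V)/(R)\<close>, where \<open>R\<close> represents a subspace of \<open>V \<otimes> V\<close>.
\<close>

definition quadratic_presentation ::
  "('k::field \<Rightarrow> 'a::ab_group_add \<Rightarrow> 'a) \<Rightarrow> ('a \<Rightarrow> 'a \<Rightarrow> 'a) \<Rightarrow> 'a \<Rightarrow>
   'a set \<Rightarrow> ('a, 'k) tensor set \<Rightarrow> bool" where
  "quadratic_presentation scale mult unit V R \<longleftrightarrow>
     R \<subseteq> tensor_power V 2 \<and> module.subspace fscale R \<and>
     canonical_hom scale mult unit ` tensor_algebra V = UNIV \<and>
     {x \<in> tensor_algebra V. canonical_hom scale mult unit x = 0} = tensor_ideal scale V R"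

end

theory Submission
  imports Defs
begin

text \<open>
  In a linear free resolution of \<open>k\<close> the generators \<open>W\<^sub>n\<^sub>+\<^sub>1\<close> of \<open>P\<^sub>n\<^sub>+\<^sub>1\<close> embed via the differential as the
  lowest degree part of the boundaries of \<open>P\<^sub>n = A \<otimes> W\<^sub>n\<close>. By induction on \<open>n\<close> this puts an \<open>H\<close>-action on
  every \<open>W\<^sub>n\<close> such that all differentials are equivariant. The action of \<open>\<mu>\<^sup>-\<^sup>1\<close> on \<open>A \<otimes> W\<^sub>n\<close> identifies the free
  \<open>A\<^sub>\<mu>\<close>-module on \<open>W\<^sub>n\<close> with the twist of \<open>P\<^sub>n\<close>, and conjugating the differentials with these isomorphisms
  gives a linear free resolution over \<open>A\<^sub>\<mu>\<close>.

  The presentation of \<open>A\<^sub>\<mu>\<close> is read off from this resolution: any algebra with a linear free resolution of \<open>k\<close>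
  is generated in degree one with relations in degree two, so only the kernel of \<open>V \<otimes> V \<rightarrow> A\<^sub>\<mu>\<close> remains
  to be determined. As this map is \<open>m \<circ> \<mu>\<^sup>-\<^sup>1\<close>, the kernel is \<open>R\<^sub>\<mu>\<close>.
\<close>

section \<open>Formal linear combinations\<close>

text \<open>The free modules \<open>P_n\<close> are modules over A, not over A_mu. Twisting their
  scalar multiplication needs a compatible action of H, and the twisted module must be recognised as
  free again. Actions on the generators settle both: with H acting diagonally on
  \<open>A \<otimes> W_n\<close>, multiplication by A is equivariant by coassociativity, and the
  cocycle identity makes the action of the inverse of mu intertwine the two structures over A_mu.
  The actions start with the trivial one on W_0, and they propagate because an equivariant
  differential has a stable kernel, which by exactness is the next space of boundaries.

  The coproduct and cocycle laws hold only modulo multilinearity relations, so they are used by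
  evaluating them in a multilinear map, where they become equations. Hence associativity for the
  inverse cocycle is tested after precomposing with mu instead of by inverting in the triple tensor
  power.

  For the presentation, generators of \<open>P_1\<close> in degree one make V generate the algebra,
  and generators of \<open>P_2\<close> in degree two make every relation a consequence of quadratic
  ones.\<close>

definition lin :: "('k \<Rightarrow> 'a \<Rightarrow> 'a) \<Rightarrow> ('k \<Rightarrow> 'b \<Rightarrow> 'b) \<Rightarrow> ('a::plus \<Rightarrow> 'b::plus) \<Rightarrow> bool" where
  "lin s s' f \<longleftrightarrow> (\<forall>x y. f (x + y) = f x + f y) \<and> (\<forall>c x. f (s c x) = s' c (f x))"

definition bilin ::
  "('k \<Rightarrow> 'a \<Rightarrow> 'a) \<Rightarrow> ('k \<Rightarrow> 'b \<Rightarrow> 'b) \<Rightarrow> ('k \<Rightarrow> 'c \<Rightarrow> 'c) \<Rightarrow> ('a::plus \<Rightarrow> 'b::plus \<Rightarrow> 'c::plus) \<Rightarrow> bool" where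
  "bilin s s' s'' f \<longleftrightarrow> (\<forall>y. lin s s'' (\<lambda>x. f x y)) \<and> (\<forall>x. lin s' s'' (f x))"

lemma linI: "(\<And>x y. f (x + y) = f x + f y) \<Longrightarrow> (\<And>c x. f (s c x) = s' c (f x)) \<Longrightarrow> lin s s' f"
  by (simp add: lin_def)

lemma lin_add: "lin s s' f \<Longrightarrow> f (x + y) = f x + f y"
  by (simp add: lin_def)

lemma lin_scale: "lin s s' f \<Longrightarrow> f (s c x) = s' c (f x)"
  by (simp add: lin_def)

lemma bilinI: "(\<And>y. lin s s'' (\<lambda>x. f x y)) \<Longrightarrow> (\<And>x. lin s' s'' (f x)) \<Longrightarrow> bilin s s' s'' f"
  by (simp add: bilin_def)

lemma bilin_left: "bilin s s' s'' f \<Longrightarrow> lin s s'' (\<lambda>x. f x y)"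
  and bilin_right: "bilin s s' s'' f \<Longrightarrow> lin s' s'' (f x)"
  by (simp_all add: bilin_def)

lemma lin_comp: "lin s s' f \<Longrightarrow> lin s' s'' g \<Longrightarrow> lin s s'' (\<lambda>x. g (f x))"
  by (simp add: lin_def)

lemma lin_zero:
  fixes f :: "'a::ab_group_add \<Rightarrow> 'b::ab_group_add"
  assumes "lin s s' f" shows "f 0 = 0"
  using lin_add[OF assms, of 0 0] by simp

lemma lin_diff:
  fixes f :: "'a::ab_group_add \<Rightarrow> 'b::ab_group_add"
  assumes "lin s s' f" shows "f (x - y) = f x - f y"
  using lin_add[OF assms, of "x - y" y] by (simp add: algebra_simps)

lemma lin_sum:
  fixes f :: "'a::ab_group_add \<Rightarrow> 'b::ab_group_add"
  assumes "lin s s' f" shows "f (sum g S) = (\<Sum>i\<in>S. f (g i))"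
  by (induction S rule: infinite_finite_induct) (simp_all add: lin_zero[OF assms] lin_add[OF assms])

lemma lin_linear_ext: "lin s s' f \<Longrightarrow> f (linear_ext s g x) = linear_ext s' (\<lambda>w. f (g w)) x"
  for f :: "'a::ab_group_add \<Rightarrow> 'b::ab_group_add"
  by (simp add: linear_ext_def lin_sum lin_scale)

interpretation fs: vector_space "fscale :: 'k::field \<Rightarrow> ('b \<Rightarrow>\<^sub>0 'k) \<Rightarrow> _"
  by (rule vector_space_fscale)

lemma lookup_sum': "Poly_Mapping.lookup (sum f S) b = (\<Sum>i\<in>S. Poly_Mapping.lookup (f i) b)"
  by (induction S rule: infinite_finite_induct) (simp_all add: lookup_add)

lemma fscale_single: "fscale c (Poly_Mapping.single b a) = Poly_Mapping.single b (c * a)"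
  by (rule poly_mapping_eqI) (simp add: lookup_single when_def)

lemma poly_mapping_sum_single:
  "x = (\<Sum>b\<in>Poly_Mapping.keys x. Poly_Mapping.single b (Poly_Mapping.lookup x b))"
  by (rule poly_mapping_eqI) (auto simp: lookup_sum' lookup_single when_def in_keys_iff)

lemma length2E: assumes "length u + length w + 1 = (2::nat)"
  obtains b where "u = []" "w = [b]" | b where "u = [b]" "w = []"
  using assms by (cases u; cases w) auto

lemma length3E: assumes "length u + length w + 1 = (3::nat)"
  obtains b c where "u = []" "w = [b, c]" | b c where "u = [b]" "w = [c]" | b c where "u = [b, c]" "w = []"
proof -
  have "length u = 0 \<and> length w = 2 \<or> length u = 1 \<and> length w = 1 \<or> length u = 2 \<and> length w = 0"
    using assms by arith
  then show ?thesis using that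
    by (auto simp: numeral_2_eq_2 length_Suc_conv)
qed

section \<open>Linear extension of maps on words, and descent to tensor classes\<close>

context vector_space
begin

lemma linear_ext_superset:
  "finite S \<Longrightarrow> Poly_Mapping.keys x \<subseteq> S \<Longrightarrow>
    linear_ext scale f x = (\<Sum>b\<in>S. scale (Poly_Mapping.lookup x b) (f b))"
  unfolding linear_ext_def by (rule sum.mono_neutral_left) (auto simp: in_keys_iff)

lemma linear_ext_zero [simp]: "linear_ext scale f 0 = 0"
  by (simp add: linear_ext_def)

lemma linear_ext_add: "linear_ext scale f (x + y) = linear_ext scale f x + linear_ext scale f y"
proof -
  let ?S = "Poly_Mapping.keys x \<union> Poly_Mapping.keys y"
  have "linear_ext scale f z = (\<Sum>b\<in>?S. scale (Poly_Mapping.lookup z b) (f b))"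
    if "Poly_Mapping.keys z \<subseteq> ?S" for z
    using that by (intro linear_ext_superset) auto
  then show ?thesis
    by (simp add: keys_add lookup_add scale_left_distrib sum.distrib)
qed

lemma linear_ext_fscale: "linear_ext scale f (fscale c x) = scale c (linear_ext scale f x)"
proof -
  have "Poly_Mapping.keys (fscale c x) \<subseteq> Poly_Mapping.keys x"
    by (auto simp: in_keys_iff)
  from linear_ext_superset[OF finite_keys this] show ?thesis
    by (simp add: linear_ext_def scale_sum_right)
qed

lemma lin_linear_ext_arg: "lin fscale scale (linear_ext scale f)"
  by (rule linI) (simp_all add: linear_ext_add linear_ext_fscale)

lemmas linear_ext_diff = lin_diff[OF lin_linear_ext_arg]
lemmas linear_ext_sum = lin_sum[OF lin_linear_ext_arg]

lemma linear_ext_single [simp]: "linear_ext scale f (Poly_Mapping.single b c) = scale c (f b)"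
  by (cases "c = 0") (simp_all add: linear_ext_def)

lemma linear_ext_pure [simp]: "linear_ext scale f (pure_tensor w) = f w"
  by (simp add: pure_tensor_def)

lemma linear_ext_cong:
  "(\<And>w. w \<in> Poly_Mapping.keys x \<Longrightarrow> f w = g w) \<Longrightarrow> linear_ext scale f x = linear_ext scale g x"
  by (simp add: linear_ext_def)

lemma linear_ext_cong_simp:
  "x = y \<Longrightarrow> (\<And>w. w \<in> Poly_Mapping.keys y \<Longrightarrow> f w = g w) \<Longrightarrow> linear_ext scale f x = linear_ext scale g y"
  by (simp add: linear_ext_def)

lemma linear_ext_fun_add:
  "linear_ext scale (\<lambda>w. f w + g w) x = linear_ext scale f x + linear_ext scale g x"
  by (simp add: linear_ext_def scale_right_distrib sum.distrib)

lemma linear_ext_fun_scale: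
  "linear_ext scale (\<lambda>w. scale c (f w)) x = scale c (linear_ext scale f x)"
  by (simp add: linear_ext_def scale_sum_right mult.commute)

lemma lin_linear_ext_fun:
  "(\<And>w. w \<in> Poly_Mapping.keys t \<Longrightarrow> lin s scale (\<lambda>x. f x w)) \<Longrightarrow> lin s scale (\<lambda>x. linear_ext scale (f x) t)"
  unfolding lin_def
  by (auto simp flip: linear_ext_fun_add linear_ext_fun_scale intro!: linear_ext_cong)

lemma linear_ext_swap:
  "linear_ext scale (\<lambda>w. linear_ext scale (f w) y) x = linear_ext scale (\<lambda>v. linear_ext scale (\<lambda>w. f w v) x) y"
  unfolding linear_ext_def scale_sum_right
  by (subst sum.swap) (simp add: mult.commute)

lemma linear_ext_linear_ext:
  "linear_ext scale g (linear_ext fscale f x) = linear_ext scale (\<lambda>w. linear_ext scale g (f w)) x"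
  by (rule lin_linear_ext[OF lin_linear_ext_arg])

lemma linear_ext_in_subspace:
  "subspace N \<Longrightarrow> (\<And>w. w \<in> Poly_Mapping.keys x \<Longrightarrow> f w \<in> N) \<Longrightarrow> linear_ext scale f x \<in> N"
  unfolding linear_ext_def by (intro subspace_sum subspace_scale)

lemma linear_ext_bilinear_ext:
  "linear_ext scale g (bilinear_ext f x y) =
    linear_ext scale (\<lambda>b. linear_ext scale (\<lambda>c. g (f b c)) y) x"
  unfolding bilinear_ext_def
  by (simp add: linear_ext_sum) (simp add: linear_ext_def scale_sum_right)

lemma lin_eqI:
  assumes "lin fscale scale f" "lin fscale scale g" "\<And>b. b \<in> Poly_Mapping.keys x \<Longrightarrow> f (Poly_Mapping.single b 1) = g (Poly_Mapping.single b 1)"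
  shows "f x = g x"
proof -
  have "f (Poly_Mapping.single b c) = g (Poly_Mapping.single b c)" if "b \<in> Poly_Mapping.keys x" for b c
    using lin_scale[OF assms(1), of c "Poly_Mapping.single b 1"] lin_scale[OF assms(2), of c "Poly_Mapping.single b 1"]
      assms(3)[OF that] by (simp add: fscale_single)
  then have "f (\<Sum>b\<in>Poly_Mapping.keys x. Poly_Mapping.single b (Poly_Mapping.lookup x b)) =
    g (\<Sum>b\<in>Poly_Mapping.keys x. Poly_Mapping.single b (Poly_Mapping.lookup x b))"
    by (simp add: lin_sum[OF assms(1)] lin_sum[OF assms(2)])
  then show ?thesis unfolding poly_mapping_sum_single[symmetric] .
qed

text \<open>Relations are tested modulo a subspace: \<open>N = {0}\<close> gives well-defined maps
  out of tensor classes, and \<open>N\<close> the span of the relations gives maps that preserve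
  \<open>tensor_eq\<close>.\<close>

lemma linear_ext_respects_aux:
  assumes N: "subspace N"
    and add: "\<And>u w a b. set u \<subseteq> V \<Longrightarrow> set w \<subseteq> V \<Longrightarrow> a \<in> V \<Longrightarrow> b \<in> V \<Longrightarrow>
      f (u @ [a + b] @ w) - f (u @ [a] @ w) - f (u @ [b] @ w) \<in> N"
    and scl: "\<And>u w c a. set u \<subseteq> V \<Longrightarrow> set w \<subseteq> V \<Longrightarrow> a \<in> V \<Longrightarrow>
      f (u @ [s c a] @ w) - scale c (f (u @ [a] @ w)) \<in> N"
    and eq: "tensor_eq s V x y"
  shows "linear_ext scale f x - linear_ext scale f y \<in> N"
proof -
  have "z \<in> fs.span (multilinear_relations s V) \<Longrightarrow> linear_ext scale f z \<in> N" for z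
  proof (induction rule: fs.span_induct_alt)
    case (step c z z')
    have "linear_ext scale f z \<in> N"
      using step(1) add scl unfolding multilinear_relations_def
      by (force simp: linear_ext_diff linear_ext_fscale)
    then show ?case
      using N step by (simp add: linear_ext_add linear_ext_fscale subspace_add subspace_scale)
  qed (use N in \<open>simp add: subspace_0\<close>)
  then show ?thesis using eq by (simp add: tensor_eq_def flip: linear_ext_diff)
qed

lemma linear_ext_respects:
  assumes N: "subspace N"
    and add: "\<And>u w a b. set u \<subseteq> V \<Longrightarrow> set w \<subseteq> V \<Longrightarrow> a \<in> V \<Longrightarrow> b \<in> V \<Longrightarrow> length u + length w + 1 = n \<Longrightarrow>
      f (u @ [a + b] @ w) - f (u @ [a] @ w) - f (u @ [b] @ w) \<in> N"
    and scl: "\<And>u w c a. set u \<subseteq> V \<Longrightarrow> set w \<subseteq> V \<Longrightarrow> a \<in> V \<Longrightarrow> length u + length w + 1 = n \<Longrightarrow>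
      f (u @ [s c a] @ w) - scale c (f (u @ [a] @ w)) \<in> N"
    and eq: "tensor_eq s V x y" and x: "x \<in> tensor_power V n" and y: "y \<in> tensor_power V n"
  shows "linear_ext scale f x - linear_ext scale f y \<in> N"
proof -
  \<comment> \<open>The relations are homogeneous, so \<open>f\<close> can be cut off to words of
    length \<open>n\<close>; the conditions of the previous lemma then hold for words of every
    length.\<close>
  let ?g = "\<lambda>w. if length w = n then f w else 0"
  have "linear_ext scale ?g x - linear_ext scale ?g y \<in> N"
    using add scl subspace_0[OF N] by (intro linear_ext_respects_aux[OF N _ _ eq]) auto
  moreover have "linear_ext scale ?g z = linear_ext scale f z" if "z \<in> tensor_power V n" for z
    using that by (intro linear_ext_cong) (auto simp: tensor_power_def)
  ultimately show ?thesis using x y by simp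
qed

lemma lift2_respects:
  assumes "bilin s s scale f" "tensor_eq s UNIV x y" "x \<in> tensor_power UNIV 2" "y \<in> tensor_power UNIV 2"
  shows "linear_ext scale (\<lambda>w. f (w ! 0) (w ! 1)) x = linear_ext scale (\<lambda>w. f (w ! 0) (w ! 1)) y"
proof -
  note l = bilin_left[OF assms(1)] bilin_right[OF assms(1)]
  have "linear_ext scale (\<lambda>w. f (w ! 0) (w ! 1)) x - linear_ext scale (\<lambda>w. f (w ! 0) (w ! 1)) y \<in> {0}"
    by (rule linear_ext_respects[OF subspace_single_0 _ _ assms(2-4)])
       (erule length2E; simp add: l[THEN lin_add] l[THEN lin_scale])+
  then show ?thesis by simp
qed

lemma lift3_respects:
  assumes "\<And>b c. lin s scale (\<lambda>a. f a b c)" "\<And>a c. lin s scale (\<lambda>b. f a b c)" "\<And>a b. lin s scale (\<lambda>c. f a b c)"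
    "tensor_eq s UNIV x y" "x \<in> tensor_power UNIV 3" "y \<in> tensor_power UNIV 3"
  shows "linear_ext scale (\<lambda>w. f (w ! 0) (w ! 1) (w ! 2)) x = linear_ext scale (\<lambda>w. f (w ! 0) (w ! 1) (w ! 2)) y"
proof -
  note l = assms(1-3)
  have "linear_ext scale (\<lambda>w. f (w ! 0) (w ! 1) (w ! 2)) x - linear_ext scale (\<lambda>w. f (w ! 0) (w ! 1) (w ! 2)) y \<in> {0}"
    by (rule linear_ext_respects[OF subspace_single_0 _ _ assms(4-6)])
       (erule length3E; simp add: l[THEN lin_add] l[THEN lin_scale])+
  then show ?thesis by simp
qed

end

section \<open>Membership in tensor powers, and congruence of tensors\<close>

lemma bilinear_ext_eq:
  "bilinear_ext f x y = linear_ext fscale (\<lambda>b. linear_ext fscale (\<lambda>c. Poly_Mapping.single (f b c) 1) y) x"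
  unfolding bilinear_ext_def linear_ext_def fs.scale_sum_right by (simp add: fscale_single)

lemma keys_bilinear_ext:
  fixes x :: "_ \<Rightarrow>\<^sub>0 'd::field"
  assumes "w \<in> Poly_Mapping.keys (bilinear_ext f x y)"
  obtains u v where "u \<in> Poly_Mapping.keys x" "v \<in> Poly_Mapping.keys y" "w = f u v"
proof -
  have "\<exists>u\<in>Poly_Mapping.keys x. \<exists>v\<in>Poly_Mapping.keys y. w = f u v"
  proof (rule ccontr)
    assume "\<not> ?thesis"
    then have "Poly_Mapping.lookup (Poly_Mapping.single (f u v) c) w = 0"
      if "u \<in> Poly_Mapping.keys x" "v \<in> Poly_Mapping.keys y" for u v and c :: 'd
      using that by (auto simp: lookup_single when_def)
    then have "Poly_Mapping.lookup (bilinear_ext f x y) w = 0"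
      by (simp add: bilinear_ext_def lookup_sum')
    with assms show False by (simp add: in_keys_iff)
  qed
  then show ?thesis using that by blast
qed

lemma tensor_power_2D:
  assumes "x \<in> tensor_power V 2" "w \<in> Poly_Mapping.keys x"
  shows "w = [w ! 0, w ! 1] \<and> w ! 0 \<in> V \<and> w ! 1 \<in> V"
proof -
  have "length w = 2" "set w \<subseteq> V"
    using assms unfolding tensor_power_def tensor_algebra_def by blast+
  then show ?thesis by (auto simp: numeral_2_eq_2 length_Suc_conv)
qed

lemma in_tensor_power_iff:
  "x \<in> tensor_power V n \<longleftrightarrow> (\<forall>w\<in>Poly_Mapping.keys x. set w \<subseteq> V \<and> length w = n)"
  unfolding tensor_power_def tensor_algebra_def by blast

lemma tensor_componentwise_power:
  assumes "x \<in> tensor_power U n" "y \<in> tensor_power V n" "\<And>a b. a \<in> U \<Longrightarrow> b \<in> V \<Longrightarrow> f a b \<in> W"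
  shows "tensor_componentwise f x y \<in> tensor_power W n"
  unfolding in_tensor_power_iff tensor_componentwise_def
proof
  fix w assume "w \<in> Poly_Mapping.keys (bilinear_ext (map2 f) x y)"
  then obtain u v where uv: "u \<in> Poly_Mapping.keys x" "v \<in> Poly_Mapping.keys y" "w = map2 f u v"
    by (rule keys_bilinear_ext)
  have "set u \<subseteq> U" "length u = n" "set v \<subseteq> V" "length v = n"
    using uv assms(1,2) unfolding in_tensor_power_iff by blast+
  then show "set w \<subseteq> W \<and> length w = n"
    using uv(3) assms(3) by (auto elim!: in_set_zipE)
qed

lemma concat_power:
  assumes "x \<in> tensor_power V m" "y \<in> tensor_power V n"
  shows "x \<otimes>\<^sub>t y \<in> tensor_power V (m + n)"
  unfolding in_tensor_power_iff tensor_concat_def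
proof
  fix w assume "w \<in> Poly_Mapping.keys (bilinear_ext (@) x y)"
  then obtain u v where uv: "u \<in> Poly_Mapping.keys x" "v \<in> Poly_Mapping.keys y" "w = u @ v"
    by (rule keys_bilinear_ext)
  then show "set w \<subseteq> V \<and> length w = m + n"
    using assms unfolding in_tensor_power_iff by auto
qed

lemma concat_algebra:
  assumes "x \<in> tensor_algebra V" "y \<in> tensor_algebra V"
  shows "x \<otimes>\<^sub>t y \<in> tensor_algebra V"
  unfolding tensor_algebra_def tensor_concat_def
proof (rule CollectI, rule ballI)
  fix w assume "w \<in> Poly_Mapping.keys (bilinear_ext (@) x y)"
  then obtain u v where "u \<in> Poly_Mapping.keys x" "v \<in> Poly_Mapping.keys y" "w = u @ v"
    by (rule keys_bilinear_ext)
  then show "set w \<subseteq> V"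
    using assms unfolding tensor_algebra_def by auto
qed

lemma pure_tensor_power: "set w \<subseteq> V \<Longrightarrow> length w = n \<Longrightarrow> pure_tensor w \<in> tensor_power V n"
  by (auto simp: tensor_power_def tensor_algebra_def pure_tensor_def)

lemma tensor_eq_refl: "tensor_eq s V x x"
  by (simp add: tensor_eq_def fs.span_zero)

lemma tensor_eq_sym: "tensor_eq s V x y \<Longrightarrow> tensor_eq s V y x"
  unfolding tensor_eq_def using fs.span_neg by fastforce

lemma tensor_eq_trans: "tensor_eq s V x y \<Longrightarrow> tensor_eq s V y z \<Longrightarrow> tensor_eq s V x z"
  unfolding tensor_eq_def using fs.span_add by fastforce

section \<open>Twisting bilinear maps\<close>

lemma keys_fscale_subset: "Poly_Mapping.keys (fscale c x) \<subseteq> Poly_Mapping.keys x"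
  by (auto simp: in_keys_iff)

lemma subspace_tensor_power: "fs.subspace (tensor_power V n :: ('a, 'k::field) tensor set)"
proof (rule fs.subspaceI)
  show "x + y \<in> tensor_power V n" if "x \<in> tensor_power V n" "y \<in> tensor_power V n" for x y :: "('a, 'k) tensor"
    using that Poly_Mapping.keys_add[of x y] unfolding in_tensor_power_iff by blast
  show "fscale c x \<in> tensor_power V n" if "x \<in> tensor_power V n" for c and x :: "('a, 'k) tensor"
    using that keys_fscale_subset[of c x] unfolding in_tensor_power_iff by blast
qed (simp add: in_tensor_power_iff)

lemma pure_tensor_2_power: "pure_tensor [a, b] \<in> tensor_power UNIV 2"
  by (simp add: pure_tensor_power)

text \<open>This is \<open>\<beta>\<close> precomposed with the action of \<open>t\<close> on a
  tensor product of two modules. The inverse of the cocycle as \<open>t\<close> gives twisted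
  products, \<open>coprod h\<close> gives the diagonal action of \<open>h\<close>. An arbitrary
  \<open>\<beta>\<close> allows twists to be iterated.\<close>

definition twist where
  "twist s \<beta> \<rho> \<sigma> t a b = linear_ext s (\<lambda>w. \<beta> (\<rho> (w ! 0) a) (\<sigma> (w ! 1) b)) t"

context hopf_algebra
begin

text \<open>A module fills its whole type. An action on the generators of a free module must
  therefore also be defined off the chosen basis.\<close>

definition hmodule :: "('k \<Rightarrow> 'v::ab_group_add \<Rightarrow> 'v) \<Rightarrow> ('h \<Rightarrow> 'v \<Rightarrow> 'v) \<Rightarrow> bool" where
  "hmodule s \<rho> \<longleftrightarrow> vector_space s \<and> bilin scale s s \<rho> \<and>
     (\<forall>g h a. \<rho> (mult g h) a = \<rho> g (\<rho> h a)) \<and> (\<forall>a. \<rho> unit a = a)"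

lemma hmoduleD:
  assumes "hmodule s \<rho>"
  shows "vector_space s" "bilin scale s s \<rho>" "\<rho> (mult g h) a = \<rho> g (\<rho> h a)" "\<rho> unit a = a"
    "lin scale s (\<lambda>h. \<rho> h a)" "lin s s (\<rho> h)"
  using assms by (auto simp: hmodule_def bilin_def)

lemma bilin_act:
  assumes "bilin sA sB s \<beta>" "hmodule sA \<rho>" "hmodule sB \<sigma>"
  shows "bilin scale scale s (\<lambda>g h. \<beta> (\<rho> g a) (\<sigma> h b))"
  by (rule bilinI; rule lin_comp)
     (rule hmoduleD(5)[OF assms(2)] hmoduleD(5)[OF assms(3)] bilin_left[OF assms(1)] bilin_right[OF assms(1)])+

lemma twist_respects:
  assumes "vector_space s" "bilin sA sB s \<beta>" "hmodule sA \<rho>" "hmodule sB \<sigma>"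
    and "tensor_eq scale UNIV x y" "x \<in> tensor_power UNIV 2" "y \<in> tensor_power UNIV 2"
  shows "twist s \<beta> \<rho> \<sigma> x a b = twist s \<beta> \<rho> \<sigma> y a b"
  unfolding twist_def
  by (rule vector_space.lift2_respects[OF assms(1) bilin_act[OF assms(2-4)] assms(5-7)])

lemma bilin_twist:
  assumes "vector_space s" "bilin sA sB s \<beta>" "hmodule sA \<rho>" "hmodule sB \<sigma>"
  shows "bilin sA sB s (twist s \<beta> \<rho> \<sigma> t)"
  unfolding twist_def
  by (rule bilinI; rule vector_space.lin_linear_ext_fun[OF assms(1)]; rule lin_comp)
     (rule hmoduleD(6)[OF assms(3)] hmoduleD(6)[OF assms(4)] bilin_left[OF assms(2)] bilin_right[OF assms(2)])+

text \<open>Acting by the product of \<open>x\<close> and \<open>y\<close> means acting by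
  \<open>y\<close> first, so under precomposition \<open>x\<close> ends up in the inner
  twist.\<close>

lemma twist_mult:
  assumes "vector_space s" "hmodule sA \<rho>" "hmodule sB \<sigma>"
    and x: "x \<in> tensor_power UNIV 2" and y: "y \<in> tensor_power UNIV 2"
  shows "twist s \<beta> \<rho> \<sigma> (tensor_componentwise mult x y) a b = twist s (twist s \<beta> \<rho> \<sigma> x) \<rho> \<sigma> y a b"
proof -
  interpret s: vector_space s by fact
  have "\<beta> (\<rho> (map2 mult u v ! 0) a) (\<sigma> (map2 mult u v ! 1) b) =
      \<beta> (\<rho> (u ! 0) (\<rho> (v ! 0) a)) (\<sigma> (u ! 1) (\<sigma> (v ! 1) b))"
    if "u \<in> Poly_Mapping.keys x" "v \<in> Poly_Mapping.keys y" for u v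
  proof -
    have "length u = 2" "length v = 2"
      using that x y by (auto simp: in_tensor_power_iff)
    then show ?thesis by (simp add: hmoduleD(3)[OF assms(2)] hmoduleD(3)[OF assms(3)])
  qed
  then have "twist s \<beta> \<rho> \<sigma> (tensor_componentwise mult x y) a b =
    linear_ext s (\<lambda>u. linear_ext s (\<lambda>v. \<beta> (\<rho> (u ! 0) (\<rho> (v ! 0) a)) (\<sigma> (u ! 1) (\<sigma> (v ! 1) b))) y) x"
    unfolding twist_def tensor_componentwise_def s.linear_ext_bilinear_ext
    by (intro s.linear_ext_cong) simp
  then show ?thesis unfolding twist_def by (simp add: s.linear_ext_swap[of _ y])
qed

lemma twist_unit:
  assumes "vector_space s" "hmodule sA \<rho>" "hmodule sB \<sigma>"
  shows "twist s \<beta> \<rho> \<sigma> (pure_tensor [unit, unit]) a b = \<beta> a b"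
  unfolding twist_def
  by (simp add: vector_space.linear_ext_pure[OF assms(1)] hmoduleD(4)[OF assms(2)] hmoduleD(4)[OF assms(3)])

lemma twist_linear_ext:
  "vector_space s \<Longrightarrow> twist s (\<lambda>x y. linear_ext s (\<lambda>w. f w x y) z) \<rho> \<sigma> t a b = linear_ext s (\<lambda>w. twist s (f w) \<rho> \<sigma> t a b) z"
  unfolding twist_def by (rule vector_space.linear_ext_swap)

text \<open>\<open>coprod\<close> is linear only up to \<open>tensor_eq\<close>; bilinearity of
  \<open>\<beta>\<close> turns this into genuine linearity.\<close>

lemma lin_twist_coprod:
  assumes "vector_space s" "bilin sA sB s \<beta>" "hmodule sA \<rho>" "hmodule sB \<sigma>"
  shows "lin scale s (\<lambda>h. twist s \<beta> \<rho> \<sigma> (coprod h) a b)"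
proof -
  interpret s: vector_space s by fact
  note sub = fs.subspace_add[OF subspace_tensor_power] fs.subspace_scale[OF subspace_tensor_power]
  note r = twist_respects[OF assms]
  show ?thesis
    using r[OF coprod_add coprod_in sub(1)[OF coprod_in coprod_in]]
      r[OF coprod_scale coprod_in sub(2)[OF coprod_in]]
    by (intro linI) (simp_all add: twist_def s.linear_ext_add s.linear_ext_fscale)
qed

lemma twist_coprod_mult:
  assumes "vector_space s" "bilin sA sB s \<beta>" "hmodule sA \<rho>" "hmodule sB \<sigma>"
  shows "twist s \<beta> \<rho> \<sigma> (coprod (mult g h)) a b = twist s (twist s \<beta> \<rho> \<sigma> (coprod g)) \<rho> \<sigma> (coprod h) a b"
  using twist_respects[OF assms coprod_mult coprod_in tensor_componentwise_power[OF coprod_in coprod_in UNIV_I]]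
  by (simp add: twist_mult[OF assms(1,3,4) coprod_in coprod_in])

lemma twist_coprod_unit:
  assumes "vector_space s" "bilin sA sB s \<beta>" "hmodule sA \<rho>" "hmodule sB \<sigma>"
  shows "twist s \<beta> \<rho> \<sigma> (coprod unit) a b = \<beta> a b"
  using twist_respects[OF assms coprod_unit coprod_in pure_tensor_2_power]
  by (simp add: twist_unit[OF assms(1,3,4)])

text \<open>Such a \<open>\<beta>\<close> is a module map out of the diagonal tensor product; for
  the product of \<open>A\<close> this is the module algebra law.\<close>

definition equivariant where
  "equivariant s \<beta> \<rho> \<sigma> \<tau> \<longleftrightarrow> (\<forall>h a b. \<tau> h (\<beta> a b) = twist s \<beta> \<rho> \<sigma> (coprod h) a b)"

lemma two_cocycleD:
  assumes "two_cocycle \<mu>"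
  shows "\<mu> \<in> tensor_power UNIV 2" "\<exists>\<nu>. is_inverse2 scale mult unit \<mu> \<nu>"
  using assms unfolding two_cocycle_def by auto

lemma inverse2D:
  assumes "is_inverse2 scale mult unit \<mu> \<nu>"
  shows "\<nu> \<in> tensor_power UNIV 2"
    "tensor_eq scale UNIV (tensor_componentwise mult \<mu> \<nu>) (pure_tensor [unit, unit])"
    "tensor_eq scale UNIV (tensor_componentwise mult \<nu> \<mu>) (pure_tensor [unit, unit])"
  using assms unfolding is_inverse2_def by auto

lemma twist_twist_inverse:
  assumes "vector_space s" "bilin sA sB s \<beta>" "hmodule sA \<rho>" "hmodule sB \<sigma>"
    and x: "x \<in> tensor_power UNIV 2" and y: "y \<in> tensor_power UNIV 2"
    and eq: "tensor_eq scale UNIV (tensor_componentwise mult x y) (pure_tensor [unit, unit])"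
  shows "twist s (twist s \<beta> \<rho> \<sigma> x) \<rho> \<sigma> y a b = \<beta> a b"
  using twist_respects[OF assms(1-4) eq tensor_componentwise_power[OF x y UNIV_I] pure_tensor_2_power]
  by (simp add: twist_mult[OF assms(1,3,4) x y] twist_unit[OF assms(1,3,4)])

section \<open>Coassociativity and the cocycle identity on trilinear maps\<close>

lemma map2_coprod_power:
  "tensor_map2 coprod (\<lambda>x. pure_tensor [x]) x \<in> tensor_power UNIV 3"
  "tensor_map2 (\<lambda>x. pure_tensor [x]) coprod x \<in> tensor_power UNIV 3"
proof -
  have "coprod g \<otimes>\<^sub>t pure_tensor [h] \<in> tensor_power UNIV 3" for g h
    using concat_power[OF coprod_in pure_tensor_power, of "[h]" 1 g] by simp
  then show "tensor_map2 coprod (\<lambda>x. pure_tensor [x]) x \<in> tensor_power UNIV 3"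
    unfolding tensor_map2_def by (intro fs.linear_ext_in_subspace subspace_tensor_power)
  have "pure_tensor [h] \<otimes>\<^sub>t coprod g \<in> tensor_power UNIV 3" for g h
    using concat_power[OF pure_tensor_power coprod_in, of "[h]" 1 g] by (simp add: eval_nat_numeral)
  then show "tensor_map2 (\<lambda>x. pure_tensor [x]) coprod x \<in> tensor_power UNIV 3"
    unfolding tensor_map2_def by (intro fs.linear_ext_in_subspace subspace_tensor_power)
qed

text \<open>\<open>coassoc\<close> is a congruence between combinations of words of length three,
  and a trilinear \<open>f\<close> cannot tell congruent combinations apart. In Sweedler notation
  the result is \<open>f(h11, h12, h2) = f(h1, h21, h22)\<close>.\<close>

lemma coprod_coassoc:
  assumes s: "vector_space s"
    and l: "\<And>b c. lin scale s (\<lambda>a. f a b c)" "\<And>a c. lin scale s (\<lambda>b. f a b c)" "\<And>a b. lin scale s (\<lambda>c. f a b c)"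
  shows "linear_ext s (\<lambda>w. linear_ext s (\<lambda>v. f (v ! 0) (v ! 1) (w ! 1)) (coprod (w ! 0))) (coprod h) =
    linear_ext s (\<lambda>w. linear_ext s (\<lambda>v. f (w ! 0) (v ! 0) (v ! 1)) (coprod (w ! 1))) (coprod h)"
proof -
  interpret s: vector_space s by fact
  note mem = map2_coprod_power
  have "linear_ext s (\<lambda>w. f (w ! 0) (w ! 1) (w ! 2)) (tensor_map2 coprod (\<lambda>x. pure_tensor [x]) (coprod h)) =
      linear_ext s (\<lambda>w. f (w ! 0) (w ! 1) (w ! 2)) (tensor_map2 (\<lambda>x. pure_tensor [x]) coprod (coprod h))"
    by (rule s.lift3_respects[OF l coassoc mem])
  moreover have "f ((v @ [z]) ! 0) ((v @ [z]) ! 1) ((v @ [z]) ! 2) = f (v ! 0) (v ! 1) z"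
    if "v \<in> Poly_Mapping.keys (coprod g)" for v z g
  proof -
    have "length v = 2"
      using that coprod_in[of g] unfolding in_tensor_power_iff by blast
    then show ?thesis by (simp add: nth_append)
  qed
  ultimately show ?thesis
    by (simp add: tensor_map2_def s.linear_ext_linear_ext tensor_concat_def s.linear_ext_bilinear_ext
        cong: s.linear_ext_cong_simp)
qed

text \<open>In the nested sums \<open>w\<close> runs over \<open>\<mu>\<close>, \<open>v\<close>
  over the coproduct of one leg of \<open>w\<close>, and \<open>u\<close> over the other copy of
  \<open>\<mu>\<close>, the factor of \<open>\<mu> \<otimes> 1\<close> or
  \<open>1 \<otimes> \<mu>\<close>. This nesting is the one in which the operators of the
  associativity proof unfold.\<close>

lemma two_cocycle_apply:
  assumes s: "vector_space s"
    and l: "\<And>b c. lin scale s (\<lambda>a. f a b c)" "\<And>a c. lin scale s (\<lambda>b. f a b c)" "\<And>a b. lin scale s (\<lambda>c. f a b c)"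
    and \<mu>: "two_cocycle \<mu>"
  shows "linear_ext s (\<lambda>w. linear_ext s (\<lambda>v. linear_ext s (\<lambda>u.
      f (mult (u ! 0) (v ! 0)) (mult (u ! 1) (v ! 1)) (w ! 1)) \<mu>) (coprod (w ! 0))) \<mu> =
    linear_ext s (\<lambda>w. linear_ext s (\<lambda>v. linear_ext s (\<lambda>u.
      f (w ! 0) (mult (u ! 0) (v ! 0)) (mult (u ! 1) (v ! 1))) \<mu>) (coprod (w ! 1))) \<mu>"
proof -
  interpret s: vector_space s by fact
  note mem = map2_coprod_power
  note \<mu>2 = two_cocycleD(1)[OF \<mu>]
  have mem': "\<mu> \<otimes>\<^sub>t pure_tensor [unit] \<in> tensor_power UNIV 3" "pure_tensor [unit] \<otimes>\<^sub>t \<mu> \<in> tensor_power UNIV 3"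
    using concat_power[OF \<mu>2 pure_tensor_power, of "[unit]" 1]
      concat_power[OF pure_tensor_power \<mu>2, of "[unit]" 1] by (simp_all add: eval_nat_numeral)
  let ?f = "linear_ext s (\<lambda>w. f (w ! 0) (w ! 1) (w ! 2))"
  let ?L = "tensor_componentwise mult (\<mu> \<otimes>\<^sub>t pure_tensor [unit]) (tensor_map2 coprod (\<lambda>x. pure_tensor [x]) \<mu>)"
  let ?R = "tensor_componentwise mult (pure_tensor [unit] \<otimes>\<^sub>t \<mu>) (tensor_map2 (\<lambda>x. pure_tensor [x]) coprod \<mu>)"
  have "?f ?L = ?f ?R"
    using \<mu> unfolding two_cocycle_def
    by (intro s.lift3_respects[OF l _ tensor_componentwise_power[OF mem'(1) mem(1) UNIV_I]
          tensor_componentwise_power[OF mem'(2) mem(2) UNIV_I]]) blast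
  also have "?f ?L = linear_ext s (\<lambda>u. linear_ext s (\<lambda>w. linear_ext s (\<lambda>v.
      f (mult (u ! 0) (v ! 0)) (mult (u ! 1) (v ! 1)) (w ! 1)) (coprod (w ! 0))) \<mu>) \<mu>"
  proof -
    \<comment> \<open>The unit appended by \<open>\<mu> \<otimes> 1\<close> leaves the third letter
      alone.\<close>
    have "f (map2 mult (u @ [unit]) (v @ [z]) ! 0) (map2 mult (u @ [unit]) (v @ [z]) ! 1) (map2 mult (u @ [unit]) (v @ [z]) ! 2)
        = f (mult (u ! 0) (v ! 0)) (mult (u ! 1) (v ! 1)) z"
      if "u \<in> Poly_Mapping.keys \<mu>" "v \<in> Poly_Mapping.keys (coprod g)" for u v z g
      by (subst (1 2 3) conjunct1[OF tensor_power_2D[OF \<mu>2 that(1)]],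
          subst (1 2 3) conjunct1[OF tensor_power_2D[OF coprod_in that(2)]]) (simp add: mult_unit_left)
    then show ?thesis
      by (simp add: tensor_map2_def s.linear_ext_linear_ext tensor_concat_def tensor_componentwise_def
          s.linear_ext_bilinear_ext cong: s.linear_ext_cong_simp)
  qed
  also have "\<dots> = linear_ext s (\<lambda>w. linear_ext s (\<lambda>v. linear_ext s (\<lambda>u.
      f (mult (u ! 0) (v ! 0)) (mult (u ! 1) (v ! 1)) (w ! 1)) \<mu>) (coprod (w ! 0))) \<mu>"
    by (subst s.linear_ext_swap, rule s.linear_ext_cong, rule s.linear_ext_swap)
  also have "?f ?R = linear_ext s (\<lambda>u. linear_ext s (\<lambda>w. linear_ext s (\<lambda>v.
      f (w ! 0) (mult (u ! 0) (v ! 0)) (mult (u ! 1) (v ! 1))) (coprod (w ! 1))) \<mu>) \<mu>"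
  proof -
    have "f (map2 mult (unit # u) (z # v) ! 0) (map2 mult (unit # u) (z # v) ! 1) (map2 mult (unit # u) (z # v) ! 2)
        = f z (mult (u ! 0) (v ! 0)) (mult (u ! 1) (v ! 1))"
      if "u \<in> Poly_Mapping.keys \<mu>" "v \<in> Poly_Mapping.keys (coprod g)" for u v z g
      by (subst (1 2 3) conjunct1[OF tensor_power_2D[OF \<mu>2 that(1)]],
          subst (1 2 3) conjunct1[OF tensor_power_2D[OF coprod_in that(2)]]) (simp add: mult_unit_left)
    then show ?thesis
      by (simp add: tensor_map2_def s.linear_ext_linear_ext tensor_concat_def tensor_componentwise_def
          s.linear_ext_bilinear_ext cong: s.linear_ext_cong_simp)
  qed
  also have "\<dots> = linear_ext s (\<lambda>w. linear_ext s (\<lambda>v. linear_ext s (\<lambda>u.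
      f (w ! 0) (mult (u ! 0) (v ! 0)) (mult (u ! 1) (v ! 1))) \<mu>) (coprod (w ! 1))) \<mu>"
    by (subst s.linear_ext_swap, rule s.linear_ext_cong, rule s.linear_ext_swap)
  finally show ?thesis .
qed

text \<open>Three modules are allowed because two instances are needed: all maps equal to the
  product of the algebra, and \<open>free_tensor\<close> with \<open>free_smult\<close> on a free
  module.\<close>

lemma twisted_associative:
  fixes sA :: "'k \<Rightarrow> 'x::ab_group_add \<Rightarrow> 'x" and sM :: "'k \<Rightarrow> 'y::ab_group_add \<Rightarrow> 'y"
    and sN :: "'k \<Rightarrow> 'z::ab_group_add \<Rightarrow> 'z"
  assumes A: "hmodule sA \<rho>" and M: "hmodule sM \<sigma>" and N: "hmodule sN \<tau>"
    and m: "bilin sA sA sA m" and t: "bilin sA sM sN t" and n: "bilin sA sN sN n"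
    and em: "equivariant sA m \<rho> \<rho> \<rho>" and et: "equivariant sN t \<rho> \<sigma> \<tau>"
    and assoc: "\<And>a b c. t (m a b) c = n a (t b c)"
    and \<mu>: "two_cocycle \<mu>" and \<nu>: "is_inverse2 scale mult unit \<mu> \<nu>"
  shows "twist sN t \<rho> \<sigma> \<nu> (twist sA m \<rho> \<rho> \<nu> a b) c = twist sN n \<rho> \<tau> \<nu> a (twist sN t \<rho> \<sigma> \<nu> b c)"
proof -
  interpret N: vector_space sN using N by (rule hmoduleD)
  note vsA = hmoduleD(1)[OF A] and vsN = hmoduleD(1)[OF N]
  note \<mu>2 = two_cocycleD(1)[OF \<mu>] and \<nu>2 = inverse2D(1)[OF \<nu>]
  note inv = inverse2D(2,3)[OF \<nu>]
  txt \<open>\<open>E \<mu> (K \<mu> F)\<close> is \<open>F\<close> precomposed with \<open>(\<mu> \<otimes> 1) (\<triangle> \<otimes> id)(\<mu>)\<close> and \<open>E' \<mu> (K' \<mu> F)\<close> is \<open>F\<close>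
    precomposed with \<open>(1 \<otimes> \<mu>) (id \<otimes> \<triangle>)(\<mu>)\<close>. These substitutions agree, are injective in \<open>F\<close> and
    turn both sides of the claim into the untwisted associativity law.\<close>
  define tri :: "('x \<Rightarrow> 'x \<Rightarrow> 'y \<Rightarrow> 'z) \<Rightarrow> bool" where
    "tri F \<longleftrightarrow> (\<forall>b c. lin sA sN (\<lambda>a. F a b c)) \<and> (\<forall>a c. lin sA sN (\<lambda>b. F a b c)) \<and> (\<forall>a b. lin sM sN (\<lambda>c. F a b c))"
    for F
  define K where "K x F a b c = twist sN (\<lambda>a b. F a b c) \<rho> \<rho> x a b"
    for x and F :: "'x \<Rightarrow> 'x \<Rightarrow> 'y \<Rightarrow> 'z" and a b c
  define E where "E x F a b c = linear_ext sN (\<lambda>w. K (coprod (w ! 0)) F a b (\<sigma> (w ! 1) c)) x"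
    for x and F :: "'x \<Rightarrow> 'x \<Rightarrow> 'y \<Rightarrow> 'z" and a b c
  define K' where "K' x F a b c = twist sN (F a) \<rho> \<sigma> x b c"
    for x and F :: "'x \<Rightarrow> 'x \<Rightarrow> 'y \<Rightarrow> 'z" and a b c
  define E' where "E' x F a b c = linear_ext sN (\<lambda>w. K' (coprod (w ! 1)) F (\<rho> (w ! 0) a) b c) x"
    for x and F :: "'x \<Rightarrow> 'x \<Rightarrow> 'y \<Rightarrow> 'z" and a b c
  have triD: "bilin sA sA sN (\<lambda>a b. F a b c)" "bilin sA sM sN (F a)" "lin sM sN (F a b)" if "tri F" for F a b c
    using that by (auto simp: tri_def bilin_def)
  have tri_K: "tri (K x F)" if "tri F" for x F
  proof -
    have "lin sM sN (K x F a b)" for a b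
      unfolding K_def[abs_def] twist_def by (rule N.lin_linear_ext_fun) (rule triD(3)[OF that])
    then show ?thesis
      using bilin_twist[OF vsN triD(1)[OF that] A A] unfolding tri_def K_def bilin_def by simp
  qed
  have K_inv: "K \<nu> (K \<mu> F) = F" if "tri F" for F
    unfolding K_def
    by (intro ext, rule twist_twist_inverse[OF vsN triD(1)[OF that] A A \<mu>2 \<nu>2 inv(1)])
  have E_inv: "E \<nu> (E \<mu> F) a b c = F a b c" if F: "tri F" for F a b c
  proof -
    let ?g = "\<lambda>g h. K (coprod g) F a b (\<sigma> h c)"
    have g: "bilin scale scale sN ?g"
    proof (rule bilinI)
      show "lin scale sN (\<lambda>g. ?g g h)" for h
        unfolding K_def by (rule lin_twist_coprod[OF vsN triD(1)[OF F] A A])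
      show "lin scale sN (?g g)" for g
        by (rule lin_comp[OF hmoduleD(5)[OF M] triD(3)[OF tri_K[OF F]]])
    qed
    have "E \<nu> (E \<mu> F) a b c = linear_ext sN (\<lambda>w. linear_ext sN (\<lambda>v.
        K (coprod (w ! 0)) (K (coprod (v ! 0)) F) a b (\<sigma> (v ! 1) (\<sigma> (w ! 1) c))) \<mu>) \<nu>"
      unfolding E_def K_def by (simp add: twist_linear_ext[OF vsN])
    also have "\<dots> = linear_ext sN (\<lambda>w. linear_ext sN (\<lambda>v. ?g (mult (v ! 0) (w ! 0)) (mult (v ! 1) (w ! 1))) \<mu>) \<nu>"
      unfolding K_def by (simp add: twist_coprod_mult[OF vsN triD(1)[OF F] A A] hmoduleD(3)[OF M])
    also have "\<dots> = linear_ext sN (\<lambda>v. linear_ext sN (\<lambda>w. ?g (mult (v ! 0) (w ! 0)) (mult (v ! 1) (w ! 1))) \<nu>) \<mu>"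
      by (rule N.linear_ext_swap)
    also have "\<dots> = linear_ext sN (\<lambda>w. ?g (w ! 0) (w ! 1)) (tensor_componentwise mult \<mu> \<nu>)"
      unfolding tensor_componentwise_def N.linear_ext_bilinear_ext
    proof (intro N.linear_ext_cong)
      fix v w assume "v \<in> Poly_Mapping.keys \<mu>" "w \<in> Poly_Mapping.keys \<nu>"
      then have "length v = 2" "length w = 2"
        using \<mu>2 \<nu>2 unfolding in_tensor_power_iff by blast+
      then show "?g (mult (v ! 0) (w ! 0)) (mult (v ! 1) (w ! 1)) = ?g (map2 mult v w ! 0) (map2 mult v w ! 1)"
        by simp
    qed
    also have "\<dots> = linear_ext sN (\<lambda>w. ?g (w ! 0) (w ! 1)) (pure_tensor [unit, unit])"
      by (rule N.lift2_respects[OF g inv(1) tensor_componentwise_power[OF \<mu>2 \<nu>2 UNIV_I] pure_tensor_2_power])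
    also have "\<dots> = F a b c"
      by (simp add: K_def twist_coprod_unit[OF vsN triD(1)[OF F] A A] hmoduleD(4)[OF M])
    finally show ?thesis .
  qed
  have cocycle: "E \<mu> (K \<mu> F) a b c = E' \<mu> (K' \<mu> F) a b c" if F: "tri F" for F a b c
  proof -
    let ?g = "\<lambda>p q r. F (\<rho> p a) (\<rho> q b) (\<sigma> r c)"
    have g: "lin scale sN (\<lambda>p. ?g p q r)" "lin scale sN (\<lambda>q. ?g p q r)" "lin scale sN (\<lambda>r. ?g p q r)" for p q r
      by (rule lin_comp[OF hmoduleD(5)[OF A] bilin_left[OF triD(1)[OF F]]]
        lin_comp[OF hmoduleD(5)[OF A] bilin_right[OF triD(1)[OF F]]]
        lin_comp[OF hmoduleD(5)[OF M] triD(3)[OF F]])+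
    show ?thesis
      using two_cocycle_apply[OF vsN g \<mu>]
      unfolding E_def E'_def K_def K'_def twist_def hmoduleD(3)[OF A] hmoduleD(3)[OF M] .
  qed
  define L where "L a b c = twist sN t \<rho> \<sigma> \<nu> (twist sA m \<rho> \<rho> \<nu> a b) c" for a b c
  define R where "R a b c = twist sN n \<rho> \<tau> \<nu> a (twist sN t \<rho> \<sigma> \<nu> b c)" for a b c
  note bm = bilin_twist[OF vsA m A A, of \<nu>] and bt = bilin_twist[OF vsN t A M, of \<nu>] and bn = bilin_twist[OF vsN n A N, of \<nu>]
  have L: "tri L" unfolding tri_def L_def
    by (intro conjI allI lin_comp[OF bilin_left[OF bm] bilin_left[OF bt]]
      lin_comp[OF bilin_right[OF bm] bilin_left[OF bt]] bilin_right[OF bt])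
  have R: "tri R" unfolding tri_def R_def
    by (intro conjI allI lin_comp[OF bilin_left[OF bt] bilin_right[OF bn]]
      lin_comp[OF bilin_right[OF bt] bilin_right[OF bn]] bilin_left[OF bn])
  \<comment> \<open>The inner twist of \<open>L\<close> by \<open>\<nu>\<close> affects the first
    two arguments, exactly where \<open>K \<mu>\<close> acts, so the two cancel.\<close>
  have "K \<mu> L a b c = twist sN t \<rho> \<sigma> \<nu> (m a b) c" for a b c
  proof -
    have "K \<mu> L a b c = twist sN t \<rho> \<sigma> \<nu> (twist sA (twist sA m \<rho> \<rho> \<nu>) \<rho> \<rho> \<mu> a b) c"
      unfolding K_def L_def twist_def[of _ _ _ _ \<mu>]
      by (rule lin_linear_ext[OF bilin_left[OF bt], symmetric])
    then show ?thesis by (simp add: twist_twist_inverse[OF vsA m A A \<nu>2 \<mu>2 inv(2)])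
  qed
  \<comment> \<open>Equivariance of \<open>m\<close> merges the coproduct acting on \<open>a\<close>
    and \<open>b\<close> into one action on \<open>m a b\<close>. What remains is an outer twist by
    \<open>\<mu>\<close>, which cancels the remaining \<open>\<nu>\<close>.\<close>
  then have "E \<mu> (K \<mu> L) a b c = twist sN (twist sN t \<rho> \<sigma> \<nu>) \<rho> \<sigma> \<mu> (m a b) c" for a b c
    using em unfolding E_def K_def[of "coprod _"] equivariant_def twist_def[of _ _ _ _ \<mu>]
    by (simp add: lin_linear_ext[OF bilin_left[OF bt]] twist_def[of _ _ _ _ "coprod _"])
  then have EL: "E \<mu> (K \<mu> L) a b c = t (m a b) c" for a b c
    by (simp add: twist_twist_inverse[OF vsN t A M \<nu>2 \<mu>2 inv(2)])
  have "K' \<mu> R a b c = twist sN n \<rho> \<tau> \<nu> a (t b c)" for a b c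
  proof -
    have "K' \<mu> R a b c = twist sN n \<rho> \<tau> \<nu> a (twist sN (twist sN t \<rho> \<sigma> \<nu>) \<rho> \<sigma> \<mu> b c)"
      unfolding K'_def R_def twist_def[of _ _ _ _ \<mu>]
      by (rule lin_linear_ext[OF bilin_right[OF bn], symmetric])
    then show ?thesis by (simp add: twist_twist_inverse[OF vsN t A M \<nu>2 \<mu>2 inv(2)])
  qed
  then have "E' \<mu> (K' \<mu> R) a b c = twist sN (twist sN n \<rho> \<tau> \<nu>) \<rho> \<tau> \<mu> a (t b c)" for a b c
    using et unfolding E'_def K'_def[of "coprod _"] equivariant_def twist_def[of _ _ _ _ \<mu>]
    by (simp add: lin_linear_ext[OF bilin_right[OF bn]] twist_def[of _ _ _ _ "coprod _"])
  then have "E \<mu> (K \<mu> R) a b c = n a (t b c)" for a b c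
    by (simp add: cocycle[OF R] twist_twist_inverse[OF vsN n A N \<nu>2 \<mu>2 inv(2)])
  then have "E \<mu> (K \<mu> L) = E \<mu> (K \<mu> R)"
    by (simp add: EL assoc fun_eq_iff)
  \<comment> \<open>The operators are stripped one at a time: \<open>E \<nu>\<close> removes
    \<open>E \<mu>\<close>, and then \<open>K \<nu>\<close> removes \<open>K \<mu>\<close>.\<close>
  then have "E \<nu> (E \<mu> (K \<mu> L)) a b c = E \<nu> (E \<mu> (K \<mu> R)) a b c" for a b c
    by (rule arg_cong)
  then have KLR: "K \<mu> L a b c = K \<mu> R a b c" for a b c
    unfolding E_inv[OF tri_K[OF L]] E_inv[OF tri_K[OF R]] .
  have "K \<mu> L = K \<mu> R"
    by (rule ext, rule ext, rule ext, rule KLR)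
  have "L = K \<nu> (K \<mu> L)"
    by (rule K_inv[OF L, symmetric])
  also have "\<dots> = K \<nu> (K \<mu> R)"
    by (simp only: \<open>K \<mu> L = K \<mu> R\<close>)
  also have "\<dots> = R"
    by (rule K_inv[OF R])
  finally have "L = R" .
  then have "L a b c = R a b c"
    by (simp only:)
  then show ?thesis unfolding L_def R_def .
qed

end

section \<open>The twisted algebra\<close>

context hopf_algebra
begin

section \<open>The counit, counital cocycles and unit laws\<close>

lemma lin_counit: "counit (g + h) = counit g + counit h" "counit (scale c h) = c * counit h"
  using counit_linear by (simp_all add: Vector_Spaces.linear_iff)

text \<open>\<open>\<epsilon> \<otimes> id\<close> is an algebra map because \<open>counit\<close>
  is one, so it can be applied to the equation relating a cocycle and its inverse.\<close>

lemma lift2_componentwise_counit_left: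
  assumes x: "x \<in> tensor_power UNIV 2" and y: "y \<in> tensor_power UNIV 2"
  shows "tensor_lift2 scale (\<lambda>g h. scale (counit g) h) (tensor_componentwise mult x y) =
    mult (tensor_lift2 scale (\<lambda>g h. scale (counit g) h) x) (tensor_lift2 scale (\<lambda>g h. scale (counit g) h) y)"
proof -
  have l: "lin scale scale (mult a)" "lin scale scale (\<lambda>a. mult a b)" for a b
    by (simp_all add: lin_def mult_add_left mult_add_right mult_scale_left mult_scale_right)
  have "scale (counit (map2 mult u v ! 0)) (map2 mult u v ! 1) =
      mult (scale (counit (u ! 0)) (u ! 1)) (scale (counit (v ! 0)) (v ! 1))"
    if "u \<in> Poly_Mapping.keys x" "v \<in> Poly_Mapping.keys y" for u v
  proof -
    have "length u = 2" "length v = 2"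
      using that x y unfolding in_tensor_power_iff by blast+
    then show ?thesis by (simp add: counit_mult mult_scale_left mult_scale_right mult.commute)
  qed
  then show ?thesis
    unfolding tensor_lift2_def tensor_componentwise_def
    by (simp add: linear_ext_bilinear_ext lin_linear_ext[OF l(1)] lin_linear_ext[OF l(2)] cong: linear_ext_cong_simp)
       (rule linear_ext_swap)
qed

lemma lift2_componentwise_counit_right:
  assumes x: "x \<in> tensor_power UNIV 2" and y: "y \<in> tensor_power UNIV 2"
  shows "tensor_lift2 scale (\<lambda>g h. scale (counit h) g) (tensor_componentwise mult x y) =
    mult (tensor_lift2 scale (\<lambda>g h. scale (counit h) g) x) (tensor_lift2 scale (\<lambda>g h. scale (counit h) g) y)"
proof -
  have l: "lin scale scale (mult a)" "lin scale scale (\<lambda>a. mult a b)" for a b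
    by (simp_all add: lin_def mult_add_left mult_add_right mult_scale_left mult_scale_right)
  have "scale (counit (map2 mult u v ! 1)) (map2 mult u v ! 0) =
      mult (scale (counit (u ! 1)) (u ! 0)) (scale (counit (v ! 1)) (v ! 0))"
    if "u \<in> Poly_Mapping.keys x" "v \<in> Poly_Mapping.keys y" for u v
  proof -
    have "length u = 2" "length v = 2"
      using that x y unfolding in_tensor_power_iff by blast+
    then show ?thesis by (simp add: counit_mult mult_scale_left mult_scale_right mult.commute)
  qed
  then show ?thesis
    unfolding tensor_lift2_def tensor_componentwise_def
    by (simp add: linear_ext_bilinear_ext lin_linear_ext[OF l(1)] lin_linear_ext[OF l(2)] cong: linear_ext_cong_simp)
       (rule linear_ext_swap)
qed

lemma bilin_counit: "bilin scale scale scale (\<lambda>g h. scale (counit g) h)" "bilin scale scale scale (\<lambda>g h. scale (counit h) g)"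
  by (simp_all add: bilin_def lin_def lin_counit algebra_simps)

text \<open>Applying \<open>\<epsilon> \<otimes> id\<close> and
  \<open>id \<otimes> \<epsilon>\<close> to \<open>\<mu> \<nu> = 1\<close> turns the factor coming
  from \<open>\<mu>\<close> into the unit.\<close>

lemma counital_inverse:
  assumes "counital \<mu>" "two_cocycle \<mu>" "is_inverse2 scale mult unit \<mu> \<nu>"
  shows "counital \<nu>"
proof -
  note \<mu>2 = two_cocycleD(1)[OF assms(2)] and \<nu>2 = inverse2D(1)[OF assms(3)]
  note r = lift2_respects[OF _ inverse2D(2)[OF assms(3)] tensor_componentwise_power[OF \<mu>2 \<nu>2 UNIV_I] pure_tensor_2_power]
  have "tensor_lift2 scale (\<lambda>g h. scale (counit g) h) \<nu> = unit"
    using r[OF bilin_counit(1)] assms(1) lift2_componentwise_counit_left[OF \<mu>2 \<nu>2]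
    unfolding counital_def tensor_lift2_def by (simp add: counit_unit mult_unit_left)
  moreover have "tensor_lift2 scale (\<lambda>g h. scale (counit h) g) \<nu> = unit"
    using r[OF bilin_counit(2)] conjunct2[OF assms(1)[unfolded counital_def]]
      lift2_componentwise_counit_right[OF \<mu>2 \<nu>2]
    unfolding tensor_lift2_def by (simp add: counit_unit mult_unit_left)
  ultimately show ?thesis unfolding counital_def ..
qed

text \<open>If \<open>\<beta>\<close> sees \<open>H\<close> act on its left argument through the
  counit, only \<open>(\<epsilon> \<otimes> id)(\<nu>) = 1\<close> is left to act on the right one.
  With \<open>a\<close> the unit of the algebra this becomes the left unit law of the twist.\<close>

lemma twist_counit_left:
  assumes "counital \<nu>" and v: "vector_space s" and \<sigma>: "hmodule sB \<sigma>"
    and \<rho>: "\<And>h. \<beta> (\<rho> h a) = (\<lambda>b. s (counit h) (\<beta>' b))" and \<beta>': "lin sB s \<beta>'"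
  shows "twist s \<beta> \<rho> \<sigma> \<nu> a b = \<beta>' b"
proof -
  have "twist s \<beta> \<rho> \<sigma> \<nu> a b = linear_ext s (\<lambda>w. \<beta>' (\<sigma> (scale (counit (w ! 0)) (w ! 1)) b)) \<nu>"
    unfolding twist_def \<rho> lin_scale[OF hmoduleD(5)[OF \<sigma>]] lin_scale[OF \<beta>'] ..
  also have "\<dots> = \<beta>' (\<sigma> (linear_ext scale (\<lambda>w. scale (counit (w ! 0)) (w ! 1)) \<nu>) b)"
    by (simp add: lin_linear_ext[OF \<beta>'] lin_linear_ext[OF hmoduleD(5)[OF \<sigma>]])
  finally show ?thesis
    using assms(1) by (simp add: counital_def tensor_lift2_def hmoduleD(4)[OF \<sigma>])
qed

lemma twist_counit_right:
  assumes "counital \<nu>" and v: "vector_space s" and \<rho>: "hmodule sA \<rho>"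
    and \<sigma>: "\<And>h a. \<beta> a (\<sigma> h b) = s (counit h) (\<beta>' a)" and \<beta>': "lin sA s \<beta>'"
  shows "twist s \<beta> \<rho> \<sigma> \<nu> a b = \<beta>' a"
proof -
  have "twist s \<beta> \<rho> \<sigma> \<nu> a b = linear_ext s (\<lambda>w. \<beta>' (\<rho> (scale (counit (w ! 1)) (w ! 0)) a)) \<nu>"
    unfolding twist_def \<sigma> lin_scale[OF hmoduleD(5)[OF \<rho>]] lin_scale[OF \<beta>'] ..
  also have "\<dots> = \<beta>' (\<rho> (linear_ext scale (\<lambda>w. scale (counit (w ! 1)) (w ! 0)) \<nu>) a)"
    by (simp add: lin_linear_ext[OF \<beta>'] lin_linear_ext[OF hmoduleD(5)[OF \<rho>]])
  finally show ?thesis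
    using assms(1) by (simp add: counital_def tensor_lift2_def hmoduleD(4)[OF \<rho>])
qed

end

context assoc_algebra
begin

lemma bilin_mult: "bilin scale scale scale mult"
  by (simp add: bilin_def lin_def mult_add_left mult_add_right mult_scale_left mult_scale_right)

lemmas mult_zero_left [simp] = lin_zero[OF bilin_left[OF bilin_mult]]
lemmas mult_zero_right [simp] = lin_zero[OF bilin_right[OF bilin_mult]]

end

context module_algebra
begin

text \<open>The bridge to \<open>twist\<close> from the formulas in words that define the module
  algebra law and the twisted product.\<close>

lemma lift2_act_eq:
  assumes "x \<in> tensor_power UNIV 2"
  shows "tensor_lift2 scale mult (tensor_componentwise act x (pure_tensor [a, b])) = twist scale mult act act x a b"
proof -
  have "mult (map2 act w [a, b] ! 0) (map2 act w [a, b] ! 1) = mult (act (w ! 0) a) (act (w ! 1) b)"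
    if "w \<in> Poly_Mapping.keys x" for w
    by (subst (1 2) conjunct1[OF tensor_power_2D[OF assms that]]) simp
  then show ?thesis
    unfolding tensor_lift2_def tensor_componentwise_def twist_def
    by (simp add: A.linear_ext_bilinear_ext cong: A.linear_ext_cong_simp)
qed

lemma hmodule_act: "H.hmodule scale act"
  unfolding H.hmodule_def bilin_def lin_def
  by (simp add: A.vector_space_axioms act_add_left act_scale_left act_add_right act_scale_right act_multH act_unitH)

lemma equivariant_mult: "H.equivariant scale mult act act act"
  unfolding H.equivariant_def act_mult by (simp add: lift2_act_eq H.coprod_in)

end

locale cocycle_twist =
  module_algebra scaleH multH unitH coprod counit antipode scale mult unit act +
  G: connected_graded_algebra scale mult unit A
  for scaleH :: "'k::field \<Rightarrow> 'h::ab_group_add \<Rightarrow> 'h" and multH unitH coprod counit antipode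
    and scale :: "'k \<Rightarrow> 'a::ab_group_add \<Rightarrow> 'a" and mult unit act and A :: "nat \<Rightarrow> 'a set" +
  fixes \<mu> :: "('h, 'k) tensor"
  assumes act_degree: "a \<in> A i \<Longrightarrow> act h a \<in> A i"
    and two_cocycle_\<mu>: "H.two_cocycle \<mu>" and counital_\<mu>: "H.counital \<mu>"
begin

definition \<nu> :: "('h, 'k) tensor" where
  "\<nu> = inverse2 scaleH multH unitH \<mu>"

lemma inverse_\<nu>: "is_inverse2 scaleH multH unitH \<mu> \<nu>"
  unfolding \<nu>_def inverse2_def using H.two_cocycleD(2)[OF two_cocycle_\<mu>] by (rule someI_ex)

lemmas \<mu>2 = H.two_cocycleD(1)[OF two_cocycle_\<mu>]
lemmas \<nu>2 = H.inverse2D(1)[OF inverse_\<nu>]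
lemmas \<mu>\<nu> = H.inverse2D(2)[OF inverse_\<nu>]
lemmas \<nu>\<mu> = H.inverse2D(3)[OF inverse_\<nu>]
lemmas counital_\<nu> = H.counital_inverse[OF counital_\<mu> two_cocycle_\<mu> inverse_\<nu>]

abbreviation tmult where
  "tmult \<equiv> twisted_mult scaleH multH unitH scale mult act \<mu>"

lemma tmult_eq: "tmult = twist scale mult act act \<nu>"
  by (intro ext) (simp add: twisted_mult_def lift2_act_eq[OF \<nu>2] flip: \<nu>_def)

lemma assoc_algebra_twist: "assoc_algebra scale tmult unit"
proof -
  note b = H.bilin_twist[OF A.vector_space_axioms A.bilin_mult hmodule_act hmodule_act, of \<nu>]
  note a = H.twisted_associative[OF hmodule_act hmodule_act hmodule_act A.bilin_mult A.bilin_mult A.bilin_mult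
      equivariant_mult equivariant_mult A.mult_assoc two_cocycle_\<mu> inverse_\<nu>]
  have "twist scale mult act act \<nu> unit x = x" for x
    by (rule H.twist_counit_left[OF counital_\<nu> A.vector_space_axioms hmodule_act])
       (simp_all add: act_unit A.mult_scale_left A.mult_unit_left lin_def fun_eq_iff)
  moreover have "twist scale mult act act \<nu> x unit = x" for x
    by (rule H.twist_counit_right[OF counital_\<nu> A.vector_space_axioms hmodule_act])
       (simp_all add: act_unit A.mult_scale_right A.mult_unit_right lin_def)
  ultimately show ?thesis
    unfolding tmult_eq
    by unfold_locales
      (use b in \<open>simp_all add: a lin_add[OF bilin_left] lin_add[OF bilin_right] lin_scale[OF bilin_left] lin_scale[OF bilin_right]\<close>)
qed


lemma connected_graded_algebra_twist: "connected_graded_algebra scale tmult unit A"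
proof -
  interpret T: assoc_algebra scale tmult unit by (rule assoc_algebra_twist)
  show ?thesis
  proof
    show "\<exists>!f. (\<forall>i. f i \<in> A i) \<and> finite {i. f i \<noteq> 0} \<and> a = (\<Sum>i | f i \<noteq> 0. f i)" for a
      by (rule G.graded_decomposition)
    show "tmult a b \<in> A (i + j)" if "a \<in> A i" "b \<in> A j" for a b i j
      unfolding tmult_eq twist_def using that
      by (intro A.linear_ext_in_subspace G.graded_subspace G.graded_mult act_degree)
  qed (use G.graded_subspace G.connected in auto)
qed

end

section \<open>Free modules\<close>

definition free_scale :: "('k \<Rightarrow> 'a \<Rightarrow> 'a) \<Rightarrow> 'k \<Rightarrow> ('b \<Rightarrow>\<^sub>0 'a::ab_group_add) \<Rightarrow> ('b \<Rightarrow>\<^sub>0 'a)" where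
  "free_scale s c x = Poly_Mapping.map (s c) x"

text \<open>The free module on \<open>'b\<close> is \<open>A \<otimes> W\<close> where \<open>W\<close> is the vector space \<open>'b \<Rightarrow>\<^sub>0 'k\<close>.\<close>

definition free_tensor :: "('k \<Rightarrow> 'a \<Rightarrow> 'a) \<Rightarrow> 'a \<Rightarrow> ('b \<Rightarrow>\<^sub>0 'k::field) \<Rightarrow> ('b \<Rightarrow>\<^sub>0 'a::ab_group_add)" where
  "free_tensor s a w = Poly_Mapping.map (\<lambda>c. s c a) w"

text \<open>For bilinear \<open>\<beta>\<close> this is the induced linear map out of
  \<open>A \<otimes> W\<close>, as \<open>free_ext_tensor\<close> confirms.\<close>

definition free_ext :: "('a \<Rightarrow> ('b \<Rightarrow>\<^sub>0 'k::field) \<Rightarrow> 'c) \<Rightarrow> ('b \<Rightarrow>\<^sub>0 'a::ab_group_add) \<Rightarrow> 'c::ab_group_add" where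
  "free_ext \<beta> x = (\<Sum>b\<in>Poly_Mapping.keys x. \<beta> (Poly_Mapping.lookup x b) (Poly_Mapping.single b 1))"

lemma lookup_map: "f 0 = 0 \<Longrightarrow> Poly_Mapping.lookup (Poly_Mapping.map f x) b = f (Poly_Mapping.lookup x b)"
  by (simp add: Poly_Mapping.map.rep_eq when_def)

lemma map_single: "f 0 = 0 \<Longrightarrow> Poly_Mapping.map f (Poly_Mapping.single b a) = Poly_Mapping.single b (f a)"
  by (rule poly_mapping_eqI) (simp add: lookup_map lookup_single when_def)

context vector_space
begin

lemma lookup_free_scale [simp]: "Poly_Mapping.lookup (free_scale scale c x) b = scale c (Poly_Mapping.lookup x b)"
  by (simp add: free_scale_def lookup_map)

lemma lookup_free_tensor [simp]: "Poly_Mapping.lookup (free_tensor scale a w) b = scale (Poly_Mapping.lookup w b) a"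
  by (simp add: free_tensor_def lookup_map)

lemma vector_space_free_scale: "vector_space (free_scale scale)"
  by unfold_locales (auto intro!: poly_mapping_eqI simp: lookup_add algebra_simps)

lemma bilin_free_tensor: "bilin scale fscale (free_scale scale) (free_tensor scale)"
  by (auto simp: bilin_def lin_def lookup_add algebra_simps intro!: poly_mapping_eqI)

lemma free_tensor_in_free_module: "Poly_Mapping.keys w \<subseteq> B \<Longrightarrow> free_tensor scale a w \<in> free_module B"
  by (auto simp: free_module_def in_keys_iff)

lemma free_tensor_single: "free_tensor scale a (Poly_Mapping.single b c) = Poly_Mapping.single b (scale c a)"
  by (simp add: free_tensor_def map_single)

lemma free_decomposition:
  "x = (\<Sum>b\<in>Poly_Mapping.keys x. free_tensor scale (Poly_Mapping.lookup x b) (Poly_Mapping.single b 1))"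
  by (simp add: free_tensor_single flip: poly_mapping_sum_single)

lemma free_lin_eqI:
  fixes f g :: "('c \<Rightarrow>\<^sub>0 'b) \<Rightarrow> 'd::ab_group_add"
  assumes "lin (free_scale scale) s f" "lin (free_scale scale) s g"
    and "\<And>a b. b \<in> Poly_Mapping.keys x \<Longrightarrow> f (free_tensor scale a (Poly_Mapping.single b 1)) = g (free_tensor scale a (Poly_Mapping.single b 1))"
  shows "f x = g x"
proof -
  let ?x = "\<Sum>b\<in>Poly_Mapping.keys x. free_tensor scale (Poly_Mapping.lookup x b) (Poly_Mapping.single b 1)"
  have "f ?x = g ?x"
    by (simp add: lin_sum[OF assms(1)] lin_sum[OF assms(2)] assms(3))
  then show ?thesis unfolding free_decomposition[symmetric] .
qed

lemma free_ext_superset: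
  assumes "bilin scale fscale s \<beta>" "finite S" "Poly_Mapping.keys x \<subseteq> S"
  shows "free_ext \<beta> x = (\<Sum>b\<in>S. \<beta> (Poly_Mapping.lookup x b) (Poly_Mapping.single b 1))"
  unfolding free_ext_def
  by (rule sum.mono_neutral_left) (use assms in \<open>auto simp: in_keys_iff lin_zero[OF bilin_left]\<close>)

lemma lin_free_ext:
  fixes \<beta> :: "'b \<Rightarrow> ('d \<Rightarrow>\<^sub>0 'a) \<Rightarrow> 'c::ab_group_add"
  assumes "vector_space s" "bilin scale fscale s \<beta>"
  shows "lin (free_scale scale) s (free_ext \<beta>)"
proof (rule linI)
  interpret s: vector_space s by fact
  note l = bilin_left[OF assms(2)]
  fix x y :: "'d \<Rightarrow>\<^sub>0 'b" and c :: 'a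
  let ?S = "Poly_Mapping.keys x \<union> Poly_Mapping.keys y"
  have "free_ext \<beta> z = (\<Sum>b\<in>?S. \<beta> (Poly_Mapping.lookup z b) (Poly_Mapping.single b 1))"
    if "Poly_Mapping.keys z \<subseteq> ?S" for z
    using that by (intro free_ext_superset[OF assms(2)]) auto
  then show "free_ext \<beta> (x + y) = free_ext \<beta> x + free_ext \<beta> y"
    by (simp add: Poly_Mapping.keys_add lookup_add lin_add[OF l] sum.distrib)
  have "Poly_Mapping.keys (free_scale scale c x) \<subseteq> Poly_Mapping.keys x"
    by (auto simp: in_keys_iff)
  from free_ext_superset[OF assms(2) finite_keys this]
  show "free_ext \<beta> (free_scale scale c x) = s c (free_ext \<beta> x)"
    by (simp add: free_ext_def lin_scale[OF l] s.scale_sum_right)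
qed

lemma free_ext_tensor:
  assumes "vector_space s" "bilin scale fscale s \<beta>"
  shows "free_ext \<beta> (free_tensor scale a w) = \<beta> a w"
proof -
  interpret s: vector_space s by fact
  have "free_ext \<beta> (free_tensor scale a w) = (\<Sum>b\<in>Poly_Mapping.keys w. \<beta> (scale (Poly_Mapping.lookup w b) a) (Poly_Mapping.single b 1))"
    by (subst free_ext_superset[OF assms(2), of "Poly_Mapping.keys w"]) (auto simp: in_keys_iff)
  also have "\<dots> = \<beta> a (\<Sum>b\<in>Poly_Mapping.keys w. Poly_Mapping.single b (Poly_Mapping.lookup w b))"
    unfolding lin_sum[OF bilin_right[OF assms(2)]]
    by (simp add: lin_scale[OF bilin_left[OF assms(2)]] fscale_single flip: lin_scale[OF bilin_right[OF assms(2)]])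
  finally show ?thesis unfolding poly_mapping_sum_single[symmetric] .
qed

end

context assoc_algebra
begin

lemma lookup_free_smult [simp]: "Poly_Mapping.lookup (free_smult mult a x) b = mult a (Poly_Mapping.lookup x b)"
  by (simp add: free_smult_def lookup_map)

lemma free_scale_eq_smult: "free_scale scale c x = free_smult mult (scale c unit) x"
  by (rule poly_mapping_eqI) (simp add: mult_scale_left mult_unit_left)

lemma bilin_free_smult: "bilin scale (free_scale scale) (free_scale scale) (free_smult mult)"
  by (auto simp: bilin_def lin_def lookup_add mult_add_left mult_add_right mult_scale_left mult_scale_right
      intro!: poly_mapping_eqI)

lemma free_smult_tensor: "free_smult mult a (free_tensor scale b w) = free_tensor scale (mult a b) w"
  by (rule poly_mapping_eqI) (simp add: mult_scale_right)

end

section \<open>Actions on free modules\<close>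

context module_algebra
begin

abbreviation (input) sF where "sF \<equiv> free_scale scale"

text \<open>The action of \<open>t\<close> on \<open>A \<otimes> W\<close>: diagonal for
  \<open>t = coprod h\<close>, and for the cocycle or its inverse the comparison between the free
  modules over the two algebras.\<close>

definition free_act ::
  "('h \<Rightarrow> ('b \<Rightarrow>\<^sub>0 'k) \<Rightarrow> ('b \<Rightarrow>\<^sub>0 'k)) \<Rightarrow> ('h, 'k) tensor \<Rightarrow> ('b \<Rightarrow>\<^sub>0 'a) \<Rightarrow> ('b \<Rightarrow>\<^sub>0 'a)" where
  "free_act \<rho> t = free_ext (twist (free_scale scale) (free_tensor scale) act \<rho> t)"

context
  fixes \<rho> :: "'h \<Rightarrow> ('b \<Rightarrow>\<^sub>0 'k) \<Rightarrow> ('b \<Rightarrow>\<^sub>0 'k)"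
  assumes \<rho>: "H.hmodule fscale \<rho>"
begin

private lemmas vF = A.vector_space_free_scale
lemmas bilin_twist_tensor = H.bilin_twist[OF A.vector_space_free_scale A.bilin_free_tensor hmodule_act \<rho>]

lemma lin_free_act: "lin sF sF (free_act \<rho> t)"
  unfolding free_act_def by (rule A.lin_free_ext[OF vF bilin_twist_tensor])

lemma free_act_tensor: "free_act \<rho> t (free_tensor scale a w) = twist sF (free_tensor scale) act \<rho> t a w"
  unfolding free_act_def by (rule A.free_ext_tensor[OF vF bilin_twist_tensor])

lemma free_act_respects:
  assumes "tensor_eq scaleH UNIV x y" "x \<in> tensor_power UNIV 2" "y \<in> tensor_power UNIV 2"
  shows "free_act \<rho> x = free_act \<rho> y"
  unfolding free_act_def free_ext_def
  by (simp add: H.twist_respects[OF vF A.bilin_free_tensor hmodule_act \<rho> assms])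

lemma free_act_mult:
  assumes x: "x \<in> tensor_power UNIV 2" and y: "y \<in> tensor_power UNIV 2"
  shows "free_act \<rho> (tensor_componentwise multH x y) z = free_act \<rho> x (free_act \<rho> y z)"
proof (rule A.free_lin_eqI[OF lin_free_act lin_comp[OF lin_free_act lin_free_act]])
  fix a and b :: 'b let ?b = "Poly_Mapping.single b 1"
  show "free_act \<rho> (tensor_componentwise multH x y) (free_tensor scale a ?b) =
    free_act \<rho> x (free_act \<rho> y (free_tensor scale a ?b))"
    unfolding free_act_tensor H.twist_mult[OF vF hmodule_act \<rho> x y]
    by (simp add: twist_def[of _ _ _ _ y] lin_linear_ext[OF lin_free_act] free_act_tensor)
qed

lemma free_act_unit: "free_act \<rho> (pure_tensor [unitH, unitH]) z = z"
  by (rule A.free_lin_eqI[OF lin_free_act])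
     (simp_all add: lin_def free_act_tensor H.twist_unit[OF vF hmodule_act \<rho>])

lemma free_act_inverse:
  assumes "x \<in> tensor_power UNIV 2" "y \<in> tensor_power UNIV 2"
    "tensor_eq scaleH UNIV (tensor_componentwise multH x y) (pure_tensor [unitH, unitH])"
  shows "free_act \<rho> x (free_act \<rho> y z) = z"
  using free_act_respects[OF assms(3) tensor_componentwise_power[OF assms(1,2) UNIV_I] pure_tensor_2_power]
  by (simp add: free_act_unit flip: free_act_mult[OF assms(1,2)])

lemma hmodule_free_act: "H.hmodule sF (\<lambda>h. free_act \<rho> (coprod h))"
  unfolding H.hmodule_def
proof (intro conjI allI bilinI lin_free_act vF)
  show "lin scaleH sF (\<lambda>h. free_act \<rho> (coprod h) z)" for z
  proof -
    interpret F: vector_space sF by (rule vF)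
    note l = H.lin_twist_coprod[OF vF A.bilin_free_tensor hmodule_act \<rho>]
    show ?thesis
      unfolding free_act_def free_ext_def
      by (rule linI) (simp_all add: lin_add[OF l] lin_scale[OF l] sum.distrib F.scale_sum_right)
  qed
  show "free_act \<rho> (coprod (multH g h)) z = free_act \<rho> (coprod g) (free_act \<rho> (coprod h) z)" for g h z
    using free_act_respects[OF H.coprod_mult H.coprod_in tensor_componentwise_power[OF H.coprod_in H.coprod_in UNIV_I]]
    by (simp add: free_act_mult[OF H.coprod_in H.coprod_in])
  show "free_act \<rho> (coprod unitH) z = z" for z
    using free_act_respects[OF H.coprod_unit H.coprod_in pure_tensor_2_power]
    by (simp add: free_act_unit)
qed

lemma equivariant_free_tensor:
  "H.equivariant sF (free_tensor scale) act \<rho> (\<lambda>h. free_act \<rho> (coprod h))"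
  unfolding H.equivariant_def by (simp add: free_act_tensor)

text \<open>On pure tensors both sides are \<open>(h1 a)(h2 a') \<otimes> h3 b\<close>: the product
  rule of \<open>A\<close> splits the first leg of the coproduct, the action on the free module
  splits the second, and coassociativity identifies the results.\<close>

lemma equivariant_free_smult:
  "H.equivariant sF (free_smult mult) act (\<lambda>h. free_act \<rho> (coprod h)) (\<lambda>h. free_act \<rho> (coprod h))"
  unfolding H.equivariant_def
proof (intro allI)
  interpret F: vector_space sF by (rule vF)
  fix h a and x :: "'b \<Rightarrow>\<^sub>0 'a"
  note b = H.bilin_twist[OF vF A.bilin_free_smult hmodule_act hmodule_free_act]
  show "free_act \<rho> (coprod h) (free_smult mult a x) =
    twist sF (free_smult mult) act (\<lambda>h. free_act \<rho> (coprod h)) (coprod h) a x"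
  proof (rule A.free_lin_eqI[OF lin_comp[OF bilin_right[OF A.bilin_free_smult] lin_free_act] bilin_right[OF b]])
    fix a' and b' :: 'b
    let ?b = "Poly_Mapping.single b' 1"
    let ?f = "\<lambda>p q r. free_tensor scale (mult (act p a) (act q a')) (\<rho> r ?b)"
    note lt = bilin_left[OF A.bilin_free_tensor]
    have "free_act \<rho> (coprod h) (free_smult mult a (free_tensor scale a' ?b)) =
        linear_ext sF (\<lambda>w. linear_ext sF (\<lambda>v. ?f (v ! 0) (v ! 1) (w ! 1)) (coprod (w ! 0))) (coprod h)"
      unfolding A.free_smult_tensor free_act_tensor twist_def
        equivariant_mult[unfolded H.equivariant_def, rule_format] lin_linear_ext[OF lt] ..
    also have "\<dots> = linear_ext sF (\<lambda>w. linear_ext sF (\<lambda>v. ?f (w ! 0) (v ! 0) (v ! 1)) (coprod (w ! 1))) (coprod h)"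
      by (intro H.coprod_coassoc vF lin_comp[OF _ lt]
          lin_comp[OF H.hmoduleD(5)[OF \<rho>] bilin_right[OF A.bilin_free_tensor]]
          lin_comp[OF H.hmoduleD(5)[OF hmodule_act] bilin_left[OF A.bilin_mult]]
          lin_comp[OF H.hmoduleD(5)[OF hmodule_act] bilin_right[OF A.bilin_mult]])
    also have "\<dots> = twist sF (free_smult mult) act (\<lambda>h. free_act \<rho> (coprod h)) (coprod h) a (free_tensor scale a' ?b)"
      unfolding twist_def free_act_tensor lin_linear_ext[OF bilin_right[OF A.bilin_free_smult]] A.free_smult_tensor ..
    finally show "free_act \<rho> (coprod h) (free_smult mult a (free_tensor scale a' ?b)) =
      twist sF (free_smult mult) act (\<lambda>h. free_act \<rho> (coprod h)) (coprod h) a (free_tensor scale a' ?b)" .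
  qed
qed

end

end

context cocycle_twist
begin

text \<open>The action of \<open>\<nu>\<close> is thus linear from the free module over the twisted
  algebra to the original free module with twisted scalar multiplication. On pure tensors this is
  \<open>twisted_associative\<close>.\<close>

lemma free_act_\<nu>_smult:
  assumes \<rho>: "H.hmodule fscale \<rho>"
  shows "free_act \<rho> \<nu> (free_smult tmult a x) =
    twist sF (free_smult mult) act (\<lambda>h. free_act \<rho> (coprod h)) \<nu> a (free_act \<rho> \<nu> x)"
proof -
  interpret T: assoc_algebra scale tmult unit by (rule assoc_algebra_twist)
  note b = H.bilin_twist[OF A.vector_space_free_scale A.bilin_free_smult hmodule_act hmodule_free_act[OF \<rho>], of \<nu>]
  note l = lin_free_act[OF \<rho>]
  note assoc = H.twisted_associative[OF hmodule_act \<rho> hmodule_free_act[OF \<rho>] A.bilin_mult A.bilin_free_tensor A.bilin_free_smult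
      equivariant_mult equivariant_free_tensor[OF \<rho>] A.free_smult_tensor[symmetric] two_cocycle_\<mu> inverse_\<nu>]
  show ?thesis
    by (rule A.free_lin_eqI[OF lin_comp[OF bilin_right[OF T.bilin_free_smult] l] lin_comp[OF l bilin_right[OF b]]])
       (simp add: T.free_smult_tensor free_act_tensor[OF \<rho>], simp add: tmult_eq assoc)
qed

end

lemma free_module_iff: "x \<in> free_module B \<longleftrightarrow> (\<forall>b. b \<notin> B \<longrightarrow> Poly_Mapping.lookup x b = 0)"
  by (auto simp: free_module_def subset_iff in_keys_iff)

section \<open>Homogeneous components\<close>

context connected_graded_algebra
begin

definition hcomp :: "'a \<Rightarrow> nat \<Rightarrow> 'a" where
  "hcomp a = (THE f. (\<forall>i. f i \<in> A i) \<and> finite {i. f i \<noteq> 0} \<and> a = (\<Sum>i | f i \<noteq> 0. f i))"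

lemma hcomp: "hcomp a i \<in> A i" "finite {i. hcomp a i \<noteq> 0}" "a = (\<Sum>i | hcomp a i \<noteq> 0. hcomp a i)"
  using theI'[OF graded_decomposition[of a]] unfolding hcomp_def by auto

lemma hcomp_eqI:
  assumes "\<And>i. f i \<in> A i" "finite S" "\<And>i. i \<notin> S \<Longrightarrow> f i = 0" "a = (\<Sum>i\<in>S. f i)"
  shows "hcomp a = f"
proof -
  have sub: "{i. f i \<noteq> 0} \<subseteq> S" using assms(3) by auto
  then have "finite {i. f i \<noteq> 0}" using assms(2) finite_subset by blast
  moreover have "a = (\<Sum>i | f i \<noteq> 0. f i)"
    unfolding assms(4) by (rule sum.mono_neutral_right[OF assms(2) sub]) auto
  ultimately show ?thesis
    unfolding hcomp_def using assms(1) graded_decomposition[of a]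
    by (intro the1_equality) auto
qed

lemma hcomp_sum:
  assumes "finite S" "\<And>i. i \<notin> S \<Longrightarrow> hcomp a i = 0"
  shows "a = (\<Sum>i\<in>S. hcomp a i)"
proof -
  have "{i. hcomp a i \<noteq> 0} \<subseteq> S" using assms(2) by auto
  then show ?thesis
    by (subst hcomp(3)[of a]) (rule sum.mono_neutral_left, use assms in auto)
qed

lemma lin_hcomp: "lin scale scale (\<lambda>a. hcomp a i)"
proof (rule linI)
  fix a b c
  let ?S = "{i. hcomp a i \<noteq> 0} \<union> {i. hcomp b i \<noteq> 0}"
  have S: "finite ?S" by (simp add: hcomp(2))
  have ab: "a = (\<Sum>i\<in>?S. hcomp a i)" "b = (\<Sum>i\<in>?S. hcomp b i)"
    by (auto intro: hcomp_sum[OF S])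
  have "hcomp (a + b) = (\<lambda>i. hcomp a i + hcomp b i)"
    by (rule hcomp_eqI[OF _ S])
      (simp_all add: sum.distrib subspace_add[OF graded_subspace] hcomp(1) ab[symmetric])
  then show "hcomp (a + b) i = hcomp a i + hcomp b i" by simp
  have "hcomp (scale c a) = (\<lambda>i. scale c (hcomp a i))"
    by (rule hcomp_eqI[OF _ S])
      (simp_all add: subspace_scale[OF graded_subspace] hcomp(1) ab[symmetric] flip: scale_sum_right)
  then show "hcomp (scale c a) i = scale c (hcomp a i)" by simp
qed

lemma hcomp_zero [simp]: "hcomp 0 i = 0"
  by (rule lin_zero[OF lin_hcomp])

lemma hcomp_homogeneous: "a \<in> A i \<Longrightarrow> hcomp a j = (if j = i then a else 0)"
  by (subst hcomp_eqI[where S = "{i}"]) (auto simp: subspace_0[OF graded_subspace])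

lemma unit_degree: "scale c unit \<in> A 0"
  by (simp add: connected)

lemma augmentation_ideal_iff: "a \<in> augmentation_ideal \<longleftrightarrow> hcomp a 0 = 0"
proof
  have sub: "subspace {a. hcomp a 0 = 0}"
    by (rule subspaceI) (simp_all add: lin_add[OF lin_hcomp] lin_scale[OF lin_hcomp])
  show "hcomp a 0 = 0" if "a \<in> augmentation_ideal"
  proof -
    have "span (\<Union>i\<in>{0<..}. A i) \<subseteq> {a. hcomp a 0 = 0}"
      by (rule span_minimal[OF _ sub]) (auto simp: hcomp_homogeneous)
    then show ?thesis using that unfolding augmentation_ideal_def by auto
  qed
  show "a \<in> augmentation_ideal" if "hcomp a 0 = 0"
  proof -
    have "hcomp a i \<in> augmentation_ideal" if "hcomp a i \<noteq> 0" for i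
    proof -
      have "i \<in> {0<..}"
        using that \<open>hcomp a 0 = 0\<close> by (cases i) auto
      then have "hcomp a i \<in> (\<Union>i\<in>{0<..}. A i)"
        using hcomp(1) by blast
      then show ?thesis
        unfolding augmentation_ideal_def by (rule span_base)
    qed
    then have "(\<Sum>i | hcomp a i \<noteq> 0. hcomp a i) \<in> augmentation_ideal"
      unfolding augmentation_ideal_def by (intro span_sum) auto
    then show ?thesis using hcomp(3)[of a] by simp
  qed
qed

lemma hcomp_0_augmentation: "hcomp a 0 = scale (augmentation a) unit"
proof -
  obtain c where c: "hcomp a 0 = scale c unit"
    using hcomp(1)[of a 0] unfolding connected by auto
  have *: "a - scale c' unit \<in> augmentation_ideal \<longleftrightarrow> c' = c" for c'
    using connected(2) by (simp add: augmentation_ideal_iff lin_diff[OF lin_hcomp] hcomp_homogeneous[OF unit_degree] c eq_commute[of c])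
  show ?thesis unfolding augmentation_def * c by simp
qed

lemma augmentation_eqI: "hcomp a 0 = scale c unit \<Longrightarrow> augmentation a = c"
  using connected(2) by (simp add: hcomp_0_augmentation)

lemma augmentation_scale_unit [simp]: "augmentation (scale c unit) = c"
  by (rule augmentation_eqI) (simp add: hcomp_homogeneous[OF unit_degree])

lemma lin_augmentation: "lin scale (*) augmentation"
  by (rule linI; rule augmentation_eqI, unfold lin_add[OF lin_hcomp] lin_scale[OF lin_hcomp])
     (simp_all add: hcomp_0_augmentation scale_left_distrib)

lemma augmentation_eq_0: "a \<in> A i \<Longrightarrow> i > 0 \<Longrightarrow> augmentation a = 0"
  by (rule augmentation_eqI) (simp add: hcomp_homogeneous)

text \<open>The index is the degree of the coefficients, without the shift by the degree of the
  basis: on \<open>P_n\<close>, \<open>fcomp i\<close> selects total degree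
  \<open>i + n\<close>.\<close>

definition fcomp :: "nat \<Rightarrow> ('b \<Rightarrow>\<^sub>0 'a) \<Rightarrow> ('b \<Rightarrow>\<^sub>0 'a)" where
  "fcomp i x = Poly_Mapping.map (\<lambda>a. hcomp a i) x"

lemma lookup_fcomp [simp]: "Poly_Mapping.lookup (fcomp i x) b = hcomp (Poly_Mapping.lookup x b) i"
  by (simp add: fcomp_def lookup_map)

lemma lin_fcomp: "lin (free_scale scale) (free_scale scale) (fcomp i)"
  by (rule linI; rule poly_mapping_eqI)
     (simp_all add: lookup_add lin_add[OF lin_hcomp] lin_scale[OF lin_hcomp])

lemma fcomp_zero [simp]: "fcomp i 0 = 0"
  by (rule lin_zero[OF lin_fcomp])

lemma fcomp_free_module: "x \<in> free_module B \<Longrightarrow> fcomp i x \<in> free_module B"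
  by (auto simp: free_module_iff)

text \<open>The lower bound \<open>M\<close> lets a caller keep a chosen index inside the summation
  range.\<close>

lemma fcomp_decomposition: "\<exists>N\<ge>M. x = (\<Sum>i<N. fcomp i x)"
proof -
  have "finite (\<Union>b\<in>Poly_Mapping.keys x. {i. hcomp (Poly_Mapping.lookup x b) i \<noteq> 0})"
    by (simp add: hcomp(2))
  then obtain N where N: "\<forall>i\<in>(\<Union>b\<in>Poly_Mapping.keys x. {i. hcomp (Poly_Mapping.lookup x b) i \<noteq> 0}). i < N"
    using finite_nat_set_iff_bounded by blast
  have "hcomp (Poly_Mapping.lookup x b) i = 0" if "i \<notin> {..<max M N}" for b i
  proof (cases "b \<in> Poly_Mapping.keys x")
    case True
    then show ?thesis using that N by (meson UN_I lessThan_iff less_max_iff_disj mem_Collect_eq)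
  qed (simp add: in_keys_iff)
  then have "Poly_Mapping.lookup x b = (\<Sum>i<max M N. hcomp (Poly_Mapping.lookup x b) i)" for b
    by (intro hcomp_sum) auto
  then have "x = (\<Sum>i<max M N. fcomp i x)"
    by (auto intro!: poly_mapping_eqI simp: lookup_sum')
  then show ?thesis by (intro exI[of _ "max M N"]) simp
qed

lemma fcomp_homogeneous:
  "(\<And>b. Poly_Mapping.lookup x b \<in> A i) \<Longrightarrow> fcomp j x = (if j = i then x else 0)"
  by (rule poly_mapping_eqI) (simp add: hcomp_homogeneous[of _ i])

lemma fcomp_tensor: "a \<in> A i \<Longrightarrow> fcomp j (free_tensor scale a w) = (if j = i then free_tensor scale a w else 0)"
  by (rule fcomp_homogeneous) (simp add: subspace_scale[OF graded_subspace])

lemma free_component_iff: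
  "x \<in> free_component A B n j \<longleftrightarrow> x \<in> free_module B \<and> (if n \<le> j then \<forall>b. Poly_Mapping.lookup x b \<in> A (j - n) else x = 0)"
proof -
  have *: "Poly_Mapping.lookup x b = 0" if "x \<in> free_module B" "b \<notin> B" for b
    using that by (auto simp: free_module_iff)
  then show ?thesis
    using subspace_0[OF graded_subspace, of "j - n"]
    by (auto simp: free_component_def intro!: poly_mapping_eqI split: if_splits)
qed

text \<open>By connectedness the coefficients are scalar multiples of the unit, and these scalars
  form the vector on the right.\<close>

lemma degree_zero_tensor:
  assumes "fcomp 0 x = x"
  shows "x = free_tensor scale unit (Poly_Mapping.map augmentation x)"
proof (rule poly_mapping_eqI)
  fix b
  have "Poly_Mapping.lookup x b = hcomp (Poly_Mapping.lookup x b) 0"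
    using arg_cong[OF assms, of "\<lambda>x. Poly_Mapping.lookup x b"] by simp
  then show "Poly_Mapping.lookup x b = Poly_Mapping.lookup (free_tensor scale unit (Poly_Mapping.map augmentation x)) b"
    by (simp add: lookup_map lin_zero[OF lin_augmentation] hcomp_0_augmentation)
qed

end

section \<open>Linear free resolutions\<close>

definition restrict_keys :: "'b set \<Rightarrow> ('b \<Rightarrow>\<^sub>0 'v::ab_group_add) \<Rightarrow> ('b \<Rightarrow>\<^sub>0 'v)" where
  "restrict_keys S x = (\<Sum>b\<in>Poly_Mapping.keys x \<inter> S. Poly_Mapping.single b (Poly_Mapping.lookup x b))"

lemma lookup_restrict_keys [simp]:
  "Poly_Mapping.lookup (restrict_keys S x) b = (if b \<in> S then Poly_Mapping.lookup x b else 0)"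
  by (auto simp: restrict_keys_def lookup_sum' lookup_single when_def in_keys_iff)

lemma restrict_keys_in: "restrict_keys S x \<in> free_module S"
  by (auto simp: free_module_iff split: if_splits)

lemma restrict_keys_id: "x \<in> free_module S \<Longrightarrow> restrict_keys S x = x"
  by (rule poly_mapping_eqI) (auto simp: free_module_iff)

lemma restrict_keys_add: "restrict_keys S (x + y) = restrict_keys S x + restrict_keys S y"
  by (rule poly_mapping_eqI) (simp add: lookup_add)

context linear_free_resolution
begin

text \<open>Extended by zero off the basis, the maps are additive without membership premises.\<close>

definition dt where "dt n x = d n (restrict_keys (B (Suc n)) x)"
definition et where "et x = e (restrict_keys (B 0) x)"

lemma restrict_keys_smult: "restrict_keys S (free_smult mult a x) = free_smult mult a (restrict_keys S x)"
  by (rule poly_mapping_eqI) simp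

lemma dt_eq: "x \<in> free_module (B (Suc n)) \<Longrightarrow> dt n x = d n x"
  by (simp add: dt_def restrict_keys_id)

lemma et_eq: "x \<in> free_module (B 0) \<Longrightarrow> et x = e x"
  by (simp add: et_def restrict_keys_id)

lemma dt_in: "dt n x \<in> free_module (B n)"
  by (simp add: dt_def d_in restrict_keys_in)

lemma dt_smult: "dt n (free_smult mult a x) = free_smult mult a (dt n x)"
  by (simp add: dt_def restrict_keys_smult d_smult restrict_keys_in)

lemma et_smult: "et (free_smult mult a x) = augmentation a * et x"
  by (simp add: et_def restrict_keys_smult e_smult restrict_keys_in)

lemma lin_dt: "lin (free_scale scale) (free_scale scale) (dt n)"
  by (rule linI, simp add: dt_def restrict_keys_add d_add restrict_keys_in)
     (simp add: free_scale_eq_smult dt_smult)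

lemma lin_et: "lin (free_scale scale) (*) et"
  by (rule linI, simp add: et_def restrict_keys_add e_add restrict_keys_in)
     (simp add: free_scale_eq_smult et_smult)

lemma dt_exact_Suc: "x \<in> free_module (B (Suc n)) \<Longrightarrow> dt n x = 0 \<longleftrightarrow> (\<exists>y\<in>free_module (B (Suc (Suc n))). x = dt (Suc n) y)"
  using exact_Suc[of n] by (auto simp: dt_eq)

lemma dt_exact_0: "x \<in> free_module (B 0) \<Longrightarrow> et x = 0 \<longleftrightarrow> (\<exists>y\<in>free_module (B 1). x = dt 0 y)"
  using exact_0 by (auto simp: dt_eq et_eq)

text \<open>The bases sit in degrees \<open>n + 1\<close> and \<open>n\<close>, so a differential
  that preserves total degree raises coefficient degree by one. Boundaries therefore start in
  coefficient degree one.\<close>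

lemma fcomp_Suc_dt: 
  assumes x: "x \<in> free_module (B (Suc n))"
  shows "fcomp (Suc i) (dt n x) = dt n (fcomp i x)" "fcomp 0 (dt n x) = 0"
proof -
  have deg: "Poly_Mapping.lookup (dt n (fcomp i x)) b \<in> A (Suc i)" for i b
  proof -
    \<comment> \<open>Total degree \<open>i + Suc n\<close>, measured from a basis in degree
      \<open>n\<close>, is coefficient degree \<open>Suc i\<close>.\<close>
    have "fcomp i x \<in> free_component A (B (Suc n)) (Suc n) (i + Suc n)"
      by (simp add: free_component_iff fcomp_free_module x hcomp(1))
    from d_degree[OF this] show ?thesis
      by (auto simp: free_component_iff dt_eq fcomp_free_module x)
  qed
  obtain N where N: "N \<ge> Suc i" and dec: "x = (\<Sum>i<N. fcomp i x)"
    using fcomp_decomposition by blast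
  have "dt n x = (\<Sum>i<N. dt n (fcomp i x))"
    by (subst dec) (rule lin_sum[OF lin_dt])
  then have *: "fcomp j (dt n x) = (\<Sum>i<N. if j = Suc i then dt n (fcomp i x) else 0)" for j
    by (simp add: lin_sum[OF lin_fcomp] fcomp_homogeneous[OF deg])
  show "fcomp (Suc i) (dt n x) = dt n (fcomp i x)"
    unfolding * using N by (simp add: sum.delta')
  show "fcomp 0 (dt n x) = 0"
    unfolding * by simp
qed

lemma et_fcomp_0:
  assumes x: "x \<in> free_module (B 0)"
  shows "et (fcomp 0 x) = et x"
proof -
  have z: "et (fcomp i x) = 0" if "i > 0" for i
    using e_degree[of "fcomp i x" i] that
    by (simp add: free_component_iff fcomp_free_module x hcomp(1) et_eq)
  obtain N where N: "N \<ge> 1" and dec: "x = (\<Sum>i<N. fcomp i x)"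
    using fcomp_decomposition by blast
  have "et x = (\<Sum>i<N. et (fcomp i x))"
    by (subst dec) (rule lin_sum[OF lin_et])
  also have "\<dots> = (\<Sum>i<N. if i = 0 then et (fcomp 0 x) else 0)"
    by (rule sum.cong) (auto simp: z)
  finally show ?thesis using N by simp
qed

text \<open>The generators of \<open>P\<^sub>n\<^sub>+\<^sub>1\<close> embed in \<open>P\<^sub>n\<close> because \<open>P\<^sub>n\<^sub>+\<^sub>2\<close> lives in higher degrees.\<close>

lemma dt_generators_inj:
  assumes "w \<in> free_module (B (Suc n))" "dt n (free_tensor scale unit w) = 0"
  shows "w = 0"
proof -
  have in1: "free_tensor scale unit w \<in> free_module (B (Suc n))"
    using assms(1) by (simp add: free_module_iff)
  then obtain y where y: "y \<in> free_module (B (Suc (Suc n)))" "free_tensor scale unit w = dt (Suc n) y"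
    using assms(2) dt_exact_Suc by blast
  have "fcomp 0 (free_tensor scale unit w) = 0"
    using fcomp_Suc_dt(2)[OF y(1)] y(2) by simp
  then have "free_tensor scale unit w = 0"
    using fcomp_tensor[of unit 0 0 w] unit_degree[of 1] by simp
  then have "scale (Poly_Mapping.lookup w b) unit = 0" for b
    by (metis lookup_free_tensor lookup_zero)
  then show ?thesis
    using connected(2) by (intro poly_mapping_eqI) simp
qed

text \<open>The same argument at the end of the resolution: the kernel of \<open>et\<close> consists
  of boundaries, which have no part in coefficient degree zero.\<close>

lemma et_generators_inj:
  assumes "w \<in> free_module (B 0)" "et (free_tensor scale unit w) = 0"
  shows "w = 0"
proof -
  have in1: "free_tensor scale unit w \<in> free_module (B 0)"
    using assms(1) by (simp add: free_module_iff)
  then obtain y where y: "y \<in> free_module (B 1)" "free_tensor scale unit w = dt 0 y"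
    using assms(2) dt_exact_0 by blast
  have "fcomp 0 (free_tensor scale unit w) = 0"
    using fcomp_Suc_dt(2)[of y 0] y by simp
  then have "free_tensor scale unit w = 0"
    using fcomp_tensor[of unit 0 0 w] unit_degree[of 1] by simp
  then have "scale (Poly_Mapping.lookup w b) unit = 0" for b
    by (metis lookup_free_tensor lookup_zero)
  then show ?thesis
    using connected(2) by (intro poly_mapping_eqI) simp
qed

text \<open>Only the degree zero part of a preimage contributes to a boundary of coefficient degree
  one, and connectedness writes that part as \<open>1 \<otimes> w\<close>.\<close>

lemma dt_lowest_degree:
  assumes y: "y \<in> free_module (B (Suc n))" and deg: "fcomp (Suc 0) (dt n y) = dt n y"
  shows "\<exists>w\<in>free_module (B (Suc n)). dt n y = dt n (free_tensor scale unit w)"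
proof -
  have 0: "fcomp 0 (fcomp 0 y) = fcomp 0 y"
    by (rule poly_mapping_eqI) (simp add: hcomp_homogeneous[OF hcomp(1)])
  let ?w = "Poly_Mapping.map augmentation (fcomp 0 y)"
  have "dt n y = dt n (fcomp 0 y)"
    using deg by (simp add: fcomp_Suc_dt(1)[OF y])
  also have "\<dots> = dt n (free_tensor scale unit ?w)"
    using degree_zero_tensor[OF 0] by simp
  finally show ?thesis
    using fcomp_free_module[OF y, of 0]
    by (intro bexI[of _ ?w]) (auto simp: free_module_iff lookup_map lin_zero[OF lin_augmentation])
qed

end

section \<open>The twisted resolution\<close>

lemma subspace_free_module: "vector_space s \<Longrightarrow> module.subspace (free_scale s) (free_module S)"
proof -
  assume "vector_space s"
  then interpret s: vector_space s .
  interpret F: vector_space "free_scale s" by (rule s.vector_space_free_scale)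
  show ?thesis
    by (rule F.subspaceI) (auto simp: free_module_iff lookup_add)
qed

context linear_free_resolution
begin

lemma dt_restrict_keys: "dt n (restrict_keys (B (Suc n)) x) = dt n x"
  unfolding dt_def by (simp add: restrict_keys_id[OF restrict_keys_in])

lemma dt_dt: "dt n (dt (Suc n) x) = 0"
  using dt_exact_Suc[OF dt_in] dt_restrict_keys[of "Suc n" x] restrict_keys_in[of "B (Suc (Suc n))" x]
  by metis

lemma et_dt: "et (dt 0 x) = 0"
  using dt_exact_0[OF dt_in] dt_restrict_keys[of 0 x] restrict_keys_in[of "B 1" x] by (metis One_nat_def)

lemma restrict_keys_tensor: "restrict_keys S (free_tensor scale a w) = free_tensor scale a (restrict_keys S w)"
  by (rule poly_mapping_eqI) simp

lemma dt_tensor: "dt n (free_tensor scale a w) = free_smult mult a (dt n (free_tensor scale unit w))"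
  by (simp add: free_smult_tensor mult_unit_right flip: dt_smult)

lemma dt_generator_degree: "Poly_Mapping.lookup (dt n (free_tensor scale unit w)) b \<in> A 1"
proof -
  let ?x = "restrict_keys (B (Suc n)) (free_tensor scale unit w)"
  have "fcomp 0 ?x = ?x"
    unfolding restrict_keys_tensor using fcomp_tensor[of unit 0 0] unit_degree[of 1] by simp
  then have "dt n ?x = fcomp 1 (dt n ?x)"
    using fcomp_Suc_dt(1)[OF restrict_keys_in, where i = 0 and n = n] by simp
  then have "Poly_Mapping.lookup (dt n ?x) b = hcomp (Poly_Mapping.lookup (dt n ?x) b) 1"
    by (metis lookup_fcomp)
  then show ?thesis
    unfolding dt_restrict_keys by (metis hcomp(1))
qed

end

section \<open>Equivariance of the resolution and its conjugation\<close>

locale twisted_resolution =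
  cocycle_twist scaleH multH unitH coprod counit antipode scale mult unit act A \<mu> +
  R: linear_free_resolution scale mult unit A B d e
  for scaleH :: "'k::field \<Rightarrow> 'h::ab_group_add \<Rightarrow> 'h" and multH unitH coprod counit antipode
    and scale :: "'k \<Rightarrow> 'a::ab_group_add \<Rightarrow> 'a" and mult unit act and A :: "nat \<Rightarrow> 'a set" and \<mu>
    and B :: "nat \<Rightarrow> 'b set" and d e
begin

lemma hcomp_act: "G.hcomp (act h a) i = act h (G.hcomp a i)"
proof -
  note l = H.hmoduleD(6)[OF hmodule_act, of h]
  have "act h a = act h (\<Sum>i | G.hcomp a i \<noteq> 0. G.hcomp a i)"
    by (simp flip: G.hcomp(3))
  then have "G.hcomp (act h a) = (\<lambda>i. act h (G.hcomp a i))"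
    by (intro G.hcomp_eqI[OF act_degree[OF G.hcomp(1)] G.hcomp(2)[of a]])
      (auto simp: lin_zero[OF l] lin_sum[OF l])
  then show ?thesis by simp
qed

lemma augmentation_act: "G.augmentation (act h a) = counit h * G.augmentation a"
  by (rule G.augmentation_eqI)
    (unfold hcomp_act, simp add: G.hcomp_0_augmentation act_scale_right act_unit mult.commute)

lemma free_act_degree:
  assumes "\<And>b. Poly_Mapping.lookup x b \<in> A i"
  shows "Poly_Mapping.lookup (free_act \<rho> t x) b \<in> A i"
proof -
  interpret F: vector_space sF by (rule A.vector_space_free_scale)
  have "F.subspace {y. \<forall>b. Poly_Mapping.lookup y b \<in> A i}"
    by (rule F.subspaceI)
      (simp_all add: lookup_add A.subspace_0[OF G.graded_subspace] A.subspace_add[OF G.graded_subspace]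
        A.subspace_scale[OF G.graded_subspace])
  then have "free_act \<rho> t x \<in> {y. \<forall>b. Poly_Mapping.lookup y b \<in> A i}"
    unfolding free_act_def free_ext_def twist_def
    by (intro F.subspace_sum F.linear_ext_in_subspace)
      (auto intro!: A.subspace_scale[OF G.graded_subspace] act_degree assms)
  then show ?thesis by simp
qed

lemma free_act_in:
  assumes "\<And>h w. w \<in> free_module S \<Longrightarrow> \<rho> h w \<in> free_module S" "x \<in> free_module S"
  shows "free_act \<rho> t x \<in> free_module S"
proof -
  interpret F: vector_space sF by (rule A.vector_space_free_scale)
  have "Poly_Mapping.single b (1 :: 'k) \<in> free_module S" if "b \<in> Poly_Mapping.keys x" for b
    using that assms(2) by (auto simp: free_module_def)
  then have "free_tensor scale a (\<rho> h (Poly_Mapping.single b 1)) \<in> free_module S" if "b \<in> Poly_Mapping.keys x" for a h b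
    using assms(1) that by (intro A.free_tensor_in_free_module) (auto simp: free_module_def)
  then show ?thesis
    unfolding free_act_def free_ext_def twist_def
    by (intro F.subspace_sum F.linear_ext_in_subspace subspace_free_module A.vector_space_axioms)
qed

text \<open>The induction invariant. Stability of the boundaries produces the action on the next
  generators; equivariance of \<open>et\<close> starts the induction and later gives linearity of
  the twisted augmentation.\<close>

definition generator_action :: "nat \<Rightarrow> ('h \<Rightarrow> ('b \<Rightarrow>\<^sub>0 'k) \<Rightarrow> ('b \<Rightarrow>\<^sub>0 'k)) \<Rightarrow> bool" where
  "generator_action n \<rho> \<longleftrightarrow> H.hmodule fscale \<rho> \<and>
     (\<forall>h w. w \<in> free_module (B n) \<longrightarrow> \<rho> h w \<in> free_module (B n)) \<and>
     (\<forall>h x. \<exists>y\<in>free_module (B (Suc n)). free_act \<rho> (coprod h) (R.dt n x) = R.dt n y) \<and>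
     (n = 0 \<longrightarrow> (\<forall>h x. R.et (free_act \<rho> (coprod h) x) = counit h * R.et x))"

lemma generator_action_0: "\<exists>\<rho>. generator_action 0 \<rho>"
proof
  \<comment> \<open>The generators of \<open>P_0\<close> embed in \<open>k\<close>, on which
    \<open>H\<close> acts by the counit.\<close>
  let ?\<rho> = "\<lambda>h (w :: 'b \<Rightarrow>\<^sub>0 'k). fscale (counit h) w"
  have \<rho>: "H.hmodule fscale ?\<rho>"
    unfolding H.hmodule_def bilin_def lin_def
    by (simp add: fs.vector_space_axioms H.lin_counit H.counit_mult H.counit_unit fs.scale_left_distrib
        fs.scale_right_distrib mult.commute)
  \<comment> \<open>With a trivial action on \<open>w\<close>, the coproduct enters only through
    \<open>id \<otimes> \<epsilon>\<close>, which returns \<open>h\<close>.\<close>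
  have tens: "free_act ?\<rho> (coprod h) (free_tensor scale a w) = free_tensor scale (act h a) w" for h a w
  proof -
    have "free_act ?\<rho> (coprod h) (free_tensor scale a w) =
        linear_ext sF (\<lambda>v. free_tensor scale (act (scaleH (counit (v ! 1)) (v ! 0)) a) w) (coprod h)"
      unfolding free_act_tensor[OF \<rho>] twist_def lin_scale[OF bilin_right[OF A.bilin_free_tensor]]
        act_scale_left lin_scale[OF bilin_left[OF A.bilin_free_tensor]] ..
    also have "\<dots> = free_tensor scale (act (linear_ext scaleH (\<lambda>v. scaleH (counit (v ! 1)) (v ! 0)) (coprod h)) a) w"
      unfolding lin_linear_ext[OF H.hmoduleD(5)[OF hmodule_act]] lin_linear_ext[OF bilin_left[OF A.bilin_free_tensor]] ..
    finally show ?thesis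
      using H.counit_right[of h] by (simp add: tensor_lift2_def)
  qed
  have et: "R.et (free_act ?\<rho> (coprod h) x) = counit h * R.et x" for h x
  proof (rule A.free_lin_eqI[OF lin_comp[OF lin_free_act[OF \<rho>] R.lin_et]])
    show "lin sF (*) (\<lambda>x. counit h * R.et x)"
      by (rule linI) (simp_all add: lin_add[OF R.lin_et] lin_scale[OF R.lin_et] algebra_simps)
    fix a and b :: 'b
    have "R.et (free_tensor scale a' w) = G.augmentation a' * R.et (free_tensor scale unit w)" for a' w
      by (simp add: A.free_smult_tensor A.mult_unit_right flip: R.et_smult)
    then show "R.et (free_act ?\<rho> (coprod h) (free_tensor scale a (Poly_Mapping.single b 1))) =
        counit h * R.et (free_tensor scale a (Poly_Mapping.single b 1))"
      by (metis tens augmentation_act mult.assoc)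
  qed
  have keep: "?\<rho> h w \<in> free_module S" if "w \<in> free_module S" for h w S
    using that by (auto simp: free_module_iff)
  \<comment> \<open>Equivariance of \<open>et\<close> makes its kernel stable, and by exactness this
    kernel is the image of \<open>dt 0\<close>.\<close>
  have "\<exists>y\<in>free_module (B (Suc 0)). free_act ?\<rho> (coprod h) (R.dt 0 x) = R.dt 0 y" for h x
  proof -
    have "R.et (free_act ?\<rho> (coprod h) (R.dt 0 x)) = 0"
      by (simp add: et R.et_dt)
    then show ?thesis
      using R.dt_exact_0[OF free_act_in[OF keep R.dt_in]] by auto
  qed
  then show "generator_action 0 ?\<rho>"
    unfolding generator_action_def using \<rho> et keep by blast
qed

lemma generator_action_Suc:
  assumes "generator_action n \<rho>"
  shows "\<exists>\<rho>'. generator_action (Suc n) \<rho>' \<and>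
    (\<forall>h x. R.dt n (free_act \<rho>' (coprod h) x) = free_act \<rho> (coprod h) (R.dt n x))"
proof -
  have \<rho>: "H.hmodule fscale \<rho>"
    and stable: "\<And>h x. \<exists>y\<in>free_module (B (Suc n)). free_act \<rho> (coprod h) (R.dt n x) = R.dt n y"
    using assms by (auto simp: generator_action_def)
  note F = hmodule_free_act[OF \<rho>]
  note actF = H.hmoduleD[OF F]
  txt \<open>Off \<open>B (Suc n)\<close> the new action is by the counit, which makes it an action on the whole type.\<close>
  define \<delta> where "\<delta> w = R.dt n (free_tensor scale unit w)" for w
  define q where "q w = w - restrict_keys (B (Suc n)) w" for w :: "'b \<Rightarrow>\<^sub>0 'k"
  have lin_\<delta>: "lin fscale sF \<delta>"
    unfolding \<delta>_def by (rule lin_comp[OF bilin_right[OF A.bilin_free_tensor] R.lin_dt])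
  have lin_q: "lin fscale fscale q"
    by (rule linI; rule poly_mapping_eqI) (simp_all add: q_def lookup_add lookup_minus algebra_simps)
  have \<delta>_restrict: "\<delta> (restrict_keys (B (Suc n)) w) = \<delta> w" for w
    unfolding \<delta>_def R.restrict_keys_tensor[symmetric] by (rule R.dt_restrict_keys)
  have \<delta>_q: "\<delta> (q w) = 0" for w
    by (simp add: q_def lin_diff[OF lin_\<delta>] \<delta>_restrict)
  have q_q: "q (q w) = q w" for w
    by (rule poly_mapping_eqI) (simp add: q_def lookup_minus)
  have q_eq_0: "q w = 0 \<longleftrightarrow> w \<in> free_module (B (Suc n))" for w
    using restrict_keys_in[of "B (Suc n)" w] by (auto simp: q_def restrict_keys_id)
  \<comment> \<open>A vector is determined by the pair \<open>\<delta> w\<close>,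
    \<open>q w\<close>: the first sees its part on the basis, the second its part off the
    basis.\<close>
  have inj: "w = w'" if "\<delta> w = \<delta> w'" "q w = q w'" for w w'
    using R.dt_generators_inj[of "w - w'" n] that
    by (simp add: lin_diff[OF lin_\<delta>] lin_diff[OF lin_q] flip: q_eq_0 \<delta>_def)
  \<comment> \<open>The image of \<open>\<delta> w\<close> under \<open>h\<close> is again a
    boundary of coefficient degree one, so \<open>dt_lowest_degree\<close> provides a preimage on
    the basis.\<close>
  have ex: "\<exists>w'. \<delta> w' = free_act \<rho> (coprod h) (\<delta> w) \<and> q w' = fscale (counit h) (q w)" for h w
  proof -
    obtain y where y: "y \<in> free_module (B (Suc n))" "free_act \<rho> (coprod h) (\<delta> w) = R.dt n y"
      using stable unfolding \<delta>_def by blast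
    have "Poly_Mapping.lookup (R.dt n y) b \<in> A (Suc 0)" for b
      unfolding y(2)[symmetric] \<delta>_def using R.dt_generator_degree by (intro free_act_degree) simp
    then have "G.fcomp (Suc 0) (R.dt n y) = R.dt n y"
      using G.fcomp_homogeneous[of "R.dt n y" "Suc 0" "Suc 0"] by simp
    from R.dt_lowest_degree[OF y(1) this]
    obtain w0 where w0: "w0 \<in> free_module (B (Suc n))" "\<delta> w0 = R.dt n y"
      unfolding \<delta>_def by metis
    have F0: "sF c 0 = 0" for c
      by (rule poly_mapping_eqI) simp
    have "q w0 = 0" using w0(1) by (simp add: q_eq_0)
    \<comment> \<open>As \<open>\<delta>\<close> vanishes on \<open>q w\<close> and \<open>q\<close>
      vanishes on \<open>w0\<close>, the two coordinates of the pair can be prescribed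
      independently.\<close>
    then have "\<delta> (w0 + fscale (counit h) (q w)) = free_act \<rho> (coprod h) (\<delta> w)"
        "q (w0 + fscale (counit h) (q w)) = fscale (counit h) (q w)"
      using y(2) w0
      by (simp_all add: lin_add[OF lin_\<delta>] lin_add[OF lin_q] lin_scale[OF lin_\<delta>] lin_scale[OF lin_q] \<delta>_q q_q
          lin_zero[OF bilin_right[OF A.bilin_free_tensor]] F0)
    then show ?thesis by blast
  qed
  define \<rho>' where "\<rho>' h w = (SOME w'. \<delta> w' = free_act \<rho> (coprod h) (\<delta> w) \<and> q w' = fscale (counit h) (q w))" for h w
  have \<rho>'\<delta>: "\<delta> (\<rho>' h w) = free_act \<rho> (coprod h) (\<delta> w)" and \<rho>'q: "q (\<rho>' h w) = fscale (counit h) (q w)" for h w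
    using someI_ex[OF ex[of h w]] unfolding \<rho>'_def by blast+
  note l\<delta> = lin_add[OF lin_\<delta>] lin_scale[OF lin_\<delta>] and lq = lin_add[OF lin_q] lin_scale[OF lin_q]
  \<comment> \<open>Each module law is checked on the pair of \<open>\<delta>\<close> and
    \<open>q\<close>, where it becomes a law of the action on \<open>P_n\<close> or of the
    counit.\<close>
  have \<rho>': "H.hmodule fscale \<rho>'"
    unfolding H.hmodule_def
    by (intro conjI allI bilinI linI fs.vector_space_axioms; rule inj)
      (simp_all add: \<rho>'\<delta> \<rho>'q l\<delta> lq actF(3,4) lin_add[OF actF(5)] lin_scale[OF actF(5)]
        lin_add[OF actF(6)] lin_scale[OF actF(6)] H.lin_counit H.counit_mult H.counit_unit
        fs.scale_left_distrib fs.scale_right_distrib mult.commute)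
  have keep: "\<rho>' h w \<in> free_module (B (Suc n))" if "w \<in> free_module (B (Suc n))" for h w
    using that by (simp add: \<rho>'q flip: q_eq_0)
  have equiv: "R.dt n (free_act \<rho>' (coprod h) x) = free_act \<rho> (coprod h) (R.dt n x)" for h x
  proof (rule A.free_lin_eqI[OF lin_comp[OF lin_free_act[OF \<rho>'] R.lin_dt] lin_comp[OF R.lin_dt lin_free_act[OF \<rho>]]])
    fix a and b :: 'b
    let ?b = "Poly_Mapping.single b 1"
    \<comment> \<open>The differential of \<open>a \<otimes> w\<close> is the multiple of
      \<open>\<delta> w\<close> by \<open>a\<close>, so equivariance of scalar multiplication
      extends equivariance from the generators.\<close>
    show "R.dt n (free_act \<rho>' (coprod h) (free_tensor scale a ?b)) =
        free_act \<rho> (coprod h) (R.dt n (free_tensor scale a ?b))"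
      unfolding R.dt_tensor[of _ a] equivariant_free_smult[OF \<rho>, unfolded H.equivariant_def, rule_format]
        free_act_tensor[OF \<rho>'] twist_def lin_linear_ext[OF R.lin_dt]
      unfolding R.dt_tensor[of _ "act _ _"] \<rho>'\<delta>[unfolded \<delta>_def] ..
  qed
  have "\<exists>y\<in>free_module (B (Suc (Suc n))). free_act \<rho>' (coprod h) (R.dt (Suc n) x) = R.dt (Suc n) y" for h x
  proof -
    \<comment> \<open>Equivariance makes the kernel of \<open>dt n\<close> stable, and exactness
      turns kernel elements into boundaries.\<close>
    have "R.dt n (free_act \<rho>' (coprod h) (R.dt (Suc n) x)) = 0"
      by (simp add: equiv R.dt_dt lin_zero[OF lin_free_act[OF \<rho>]])
    moreover have "free_act \<rho>' (coprod h) (R.dt (Suc n) x) \<in> free_module (B (Suc n))"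
      by (rule free_act_in[OF _ R.dt_in]) (rule keep)
    ultimately show ?thesis
      using R.dt_exact_Suc by blast
  qed
  then have "generator_action (Suc n) \<rho>'"
    unfolding generator_action_def using \<rho>' keep by blast
  with equiv show ?thesis by blast
qed

lemma twisted_resolution: "\<exists>d' e'. linear_free_resolution scale tmult unit A B d' e'"
proof -
  interpret T: connected_graded_algebra scale tmult unit A by (rule connected_graded_algebra_twist)
  have "\<exists>\<rho>. \<forall>n. generator_action n (\<rho> n) \<and>
      (\<forall>h x. R.dt n (free_act (\<rho> (Suc n)) (coprod h) x) = free_act (\<rho> n) (coprod h) (R.dt n x))"
    by (rule dependent_nat_choice[OF generator_action_0 generator_action_Suc])
  then obtain \<rho> where \<rho>: "\<And>n. generator_action n (\<rho> n)"
    and equiv: "\<And>n h x. R.dt n (free_act (\<rho> (Suc n)) (coprod h) x) = free_act (\<rho> n) (coprod h) (R.dt n x)"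
    by blast
  have \<rho>m: "H.hmodule fscale (\<rho> n)" and keep: "\<And>h w. w \<in> free_module (B n) \<Longrightarrow> \<rho> n h w \<in> free_module (B n)"
    and et: "\<And>h x. R.et (free_act (\<rho> 0) (coprod h) x) = counit h * R.et x" for n
    using \<rho>[of n] \<rho>[of 0] unfolding generator_action_def by blast+
  define \<phi> where "\<phi> n = free_act (\<rho> n) \<nu>" for n
  define \<psi> where "\<psi> n = free_act (\<rho> n) \<mu>" for n
  have \<phi>\<psi>: "\<phi> n (\<psi> n x) = x" and \<psi>\<phi>: "\<psi> n (\<phi> n x) = x" for n x
    unfolding \<phi>_def \<psi>_def by (simp_all add: free_act_inverse[OF \<rho>m] \<mu>2 \<nu>2 \<mu>\<nu> \<nu>\<mu>)
  have lin_\<phi>: "lin sF sF (\<phi> n)" and lin_\<psi>: "lin sF sF (\<psi> n)" for n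
    unfolding \<phi>_def \<psi>_def by (rule lin_free_act[OF \<rho>m])+
  have in_\<phi>: "\<phi> n x \<in> free_module (B n)" and in_\<psi>: "\<psi> n x \<in> free_module (B n)" if "x \<in> free_module (B n)" for n x
    unfolding \<phi>_def \<psi>_def by (auto intro: free_act_in[OF _ that] keep)
  have comp: "free_act (\<rho> n) t x \<in> free_component A (B n) m j" if "x \<in> free_component A (B n) m j" for n t x m j
    using that free_act_in[where S = "B n" and \<rho> = "\<rho> n" and x = x and t = t, OF keep] free_act_degree[of x "j - m" "\<rho> n" t] lin_zero[OF lin_free_act[OF \<rho>m]]
    by (auto simp: G.free_component_iff split: if_splits)
  define d' where "d' n x = \<psi> n (R.dt n (\<phi> (Suc n) x))" for n x
  define e' where "e' x = R.et (\<phi> 0 x)" for x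
  \<comment> \<open>Being \<open>A\<close>-linear and equivariant, the differentials also commute
    with the twisted scalar multiplication.\<close>
  have dt_twist: "R.dt n (twist sF (free_smult mult) act (\<lambda>h. free_act (\<rho> (Suc n)) (coprod h)) \<nu> a x) =
      twist sF (free_smult mult) act (\<lambda>h. free_act (\<rho> n) (coprod h)) \<nu> a (R.dt n x)" for n a x
    unfolding twist_def lin_linear_ext[OF R.lin_dt] R.dt_smult equiv ..
  \<comment> \<open>\<open>H\<close> acts on \<open>k\<close> by the counit, so both legs of
    \<open>\<nu>\<close> are evaluated by the counit, and counitality leaves 1.\<close>
  have et_twist: "R.et (twist sF (free_smult mult) act (\<lambda>h. free_act (\<rho> 0) (coprod h)) \<nu> a x) =
      G.augmentation a * R.et x" for a x
  proof -
    let ?c = "G.augmentation a * R.et x"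
    have l: "lin scaleH (*) (\<lambda>h. counit h * ?c)"
      by (rule linI) (simp_all add: H.lin_counit algebra_simps)
    have "R.et (twist sF (free_smult mult) act (\<lambda>h. free_act (\<rho> 0) (coprod h)) \<nu> a x) =
        linear_ext (*) (\<lambda>w. counit (scaleH (counit (w ! 0)) (w ! 1)) * ?c) \<nu>"
      unfolding twist_def lin_linear_ext[OF R.lin_et] R.et_smult et augmentation_act H.lin_counit
      by (simp add: ac_simps)
    also have "\<dots> = counit (linear_ext scaleH (\<lambda>w. scaleH (counit (w ! 0)) (w ! 1)) \<nu>) * ?c"
      by (rule lin_linear_ext[OF l, symmetric])
    finally show ?thesis
      using counital_\<nu> by (simp add: H.counital_def tensor_lift2_def H.counit_unit)
  qed
  have \<phi>_smult: "\<phi> n (free_smult tmult a x) =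
      twist sF (free_smult mult) act (\<lambda>h. free_act (\<rho> n) (coprod h)) \<nu> a (\<phi> n x)" for n a x
    unfolding \<phi>_def by (rule free_act_\<nu>_smult[OF \<rho>m])
  have "linear_free_resolution scale tmult unit A B d' e'"
  proof
    show "d' n x \<in> free_module (B n)" if "x \<in> free_module (B (Suc n))" for n x
      unfolding d'_def by (intro in_\<psi> R.dt_in)
    show "d' n (x + y) = d' n x + d' n y" for n x y
      by (simp add: d'_def lin_add[OF lin_\<phi>] lin_add[OF lin_\<psi>] lin_add[OF R.lin_dt])
    show "d' n (free_smult tmult a x) = free_smult tmult a (d' n x)" for n a x
    proof -
      have "d' n (free_smult tmult a x) =
          \<psi> n (twist sF (free_smult mult) act (\<lambda>h. free_act (\<rho> n) (coprod h)) \<nu> a (\<phi> n (d' n x)))"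
        by (simp add: d'_def \<phi>_smult dt_twist \<phi>\<psi>)
      then show ?thesis by (simp add: \<psi>\<phi> flip: \<phi>_smult)
    qed
    show "d' n x \<in> free_component A (B n) n j" if "x \<in> free_component A (B (Suc n)) (Suc n) j" for n x j
    proof -
      have "\<phi> (Suc n) x \<in> free_component A (B (Suc n)) (Suc n) j"
        unfolding \<phi>_def by (rule comp[OF that])
      moreover from this have "\<phi> (Suc n) x \<in> free_module (B (Suc n))"
        unfolding G.free_component_iff ..
      ultimately have "R.dt n (\<phi> (Suc n) x) \<in> free_component A (B n) n j"
        using R.d_degree by (simp only: R.dt_eq)
      then show ?thesis unfolding d'_def \<psi>_def by (rule comp)
    qed
    show "e' (x + y) = e' x + e' y" for x y
      by (simp add: e'_def lin_add[OF lin_\<phi>] lin_add[OF R.lin_et])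
    \<comment> \<open>The augmentation depends on the grading, the scalars and the unit, which the
      twist keeps; hence it is the same function for both algebras.\<close>
    show "e' (free_smult tmult a x) = G.augmentation a * e' x" for a x
      by (simp add: e'_def \<phi>_smult et_twist)
    show "e' x = 0" if "x \<in> free_component A (B 0) 0 j" "j > 0" for x j
    proof -
      have "\<phi> 0 x \<in> free_component A (B 0) 0 j"
        unfolding \<phi>_def by (rule comp[OF that(1)])
      moreover from this have "\<phi> 0 x \<in> free_module (B 0)"
        unfolding G.free_component_iff ..
      ultimately show ?thesis
        using R.e_degree[OF _ that(2)] by (simp only: e'_def R.et_eq)
    qed
    show "e' ` free_module (B 0) = UNIV"
    proof -
      have "c \<in> e' ` free_module (B 0)" for c
      proof -
        obtain x where "x \<in> free_module (B 0)" "c = R.et x"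
          using R.exact_k R.et_eq by (metis UNIV_I imageE)
        then show ?thesis
          by (intro image_eqI[of _ _ "\<psi> 0 x"]) (simp_all add: e'_def \<phi>\<psi> in_\<psi>)
      qed
      then show ?thesis by blast
    qed
    \<comment> \<open>Conjugation by mutually inverse maps carries boundaries to boundaries, so
      exactness is inherited.\<close>
    have bdry: "(\<exists>y\<in>free_module (B (Suc n)). \<phi> n x = R.dt n y) \<longleftrightarrow> x \<in> d' n ` free_module (B (Suc n))" for n x
    proof
      assume "\<exists>y\<in>free_module (B (Suc n)). \<phi> n x = R.dt n y"
      then obtain y where y: "y \<in> free_module (B (Suc n))" "\<phi> n x = R.dt n y" by blast
      then have "x = d' n (\<psi> (Suc n) y)"
        by (simp add: d'_def \<phi>\<psi> \<psi>\<phi> flip: y(2))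
      then show "x \<in> d' n ` free_module (B (Suc n))" using in_\<psi>[OF y(1)] by blast
    next
      assume "x \<in> d' n ` free_module (B (Suc n))"
      then show "\<exists>y\<in>free_module (B (Suc n)). \<phi> n x = R.dt n y"
        by (auto simp: d'_def \<phi>\<psi> intro: in_\<phi>)
    qed
    have bin: "x \<in> free_module (B n)" if "x \<in> d' n ` free_module (B (Suc n))" for n x
      using that by (auto simp: d'_def intro: in_\<psi> R.dt_in)
    show "{x \<in> free_module (B 0). e' x = 0} = d' 0 ` free_module (B 1)"
      using R.dt_exact_0[OF in_\<phi>] bdry[of 0] bin[of _ 0] by (auto simp: e'_def)
    show "{x \<in> free_module (B (Suc n)). d' n x = 0} = d' (Suc n) ` free_module (B (Suc (Suc n)))" for n
    proof -
      have "d' n x = 0 \<longleftrightarrow> R.dt n (\<phi> (Suc n) x) = 0" for x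
        unfolding d'_def by (metis \<phi>\<psi> lin_zero[OF lin_\<phi>] lin_zero[OF lin_\<psi>])
      then have "d' n x = 0 \<longleftrightarrow> x \<in> d' (Suc n) ` free_module (B (Suc (Suc n)))"
        if "x \<in> free_module (B (Suc n))" for x
        using R.dt_exact_Suc[OF in_\<phi>[OF that]] by (simp only: bdry)
      with bin show ?thesis by auto
    qed
  qed
  then show ?thesis by blast
qed

end

section \<open>Quadratic presentations from linear resolutions\<close>

lemma concat_eq:
  "x \<otimes>\<^sub>t y = linear_ext fscale (\<lambda>u. linear_ext fscale (\<lambda>v. pure_tensor (u @ v)) y) x"
  by (simp add: tensor_concat_def bilinear_ext_eq pure_tensor_def)

lemma linear_ext_pure_tensor [simp]: "linear_ext fscale pure_tensor x = x"
  by (rule fs.lin_eqI[OF fs.lin_linear_ext_arg]) (simp_all add: lin_def pure_tensor_def)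

lemma bilin_concat: "bilin fscale fscale fscale (\<otimes>\<^sub>t)"
  unfolding concat_eq[abs_def]
  by (intro bilinI fs.lin_linear_ext_arg fs.lin_linear_ext_fun)

lemma concat_assoc: "(x \<otimes>\<^sub>t y) \<otimes>\<^sub>t z = x \<otimes>\<^sub>t (y \<otimes>\<^sub>t z)"
  by (simp add: concat_eq fs.linear_ext_linear_ext)

lemma concat_pure_Nil [simp]: "x \<otimes>\<^sub>t pure_tensor [] = x"
  by (simp add: concat_eq)

lemma concat_pure: "pure_tensor u \<otimes>\<^sub>t pure_tensor v = pure_tensor (u @ v)"
  by (simp add: concat_eq)

lemma subspace_tensor_algebra: "fs.subspace (tensor_algebra V :: ('a, 'k::field) tensor set)"
proof (rule fs.subspaceI)
  show "x + y \<in> tensor_algebra V" if "x \<in> tensor_algebra V" "y \<in> tensor_algebra V" for x y :: "('a, 'k) tensor"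
    using that Poly_Mapping.keys_add[of x y] unfolding tensor_algebra_def by blast
  show "fscale c x \<in> tensor_algebra V" if "x \<in> tensor_algebra V" for c and x :: "('a, 'k) tensor"
    using that keys_fscale_subset[of c x] unfolding tensor_algebra_def by blast
qed (simp add: tensor_algebra_def)

lemma tensor_power_subset: "tensor_power V n \<subseteq> tensor_algebra V"
  by (auto simp: tensor_power_def)

lemma tensor_eq_add: "tensor_eq s V x y \<Longrightarrow> tensor_eq s V x' y' \<Longrightarrow> tensor_eq s V (x + x') (y + y')"
  unfolding tensor_eq_def using fs.span_add by (fastforce simp: algebra_simps)

lemma tensor_eq_scale: "tensor_eq s V x y \<Longrightarrow> tensor_eq s V (fscale c x) (fscale c y)"
  unfolding tensor_eq_def using fs.span_scale by (fastforce simp flip: fs.scale_right_diff_distrib)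

lemma relation_add:
  "set u \<subseteq> V \<Longrightarrow> set w \<subseteq> V \<Longrightarrow> a \<in> V \<Longrightarrow> b \<in> V \<Longrightarrow>
    pure_tensor (u @ [a + b] @ w) - pure_tensor (u @ [a] @ w) - pure_tensor (u @ [b] @ w)
      \<in> fs.span (multilinear_relations s V)"
  by (rule fs.span_base) (unfold multilinear_relations_def, blast)

lemma relation_scale:
  "set u \<subseteq> V \<Longrightarrow> set w \<subseteq> V \<Longrightarrow> a \<in> V \<Longrightarrow>
    pure_tensor (u @ [s c a] @ w) - fscale c (pure_tensor (u @ [a] @ w))
      \<in> fs.span (multilinear_relations s V)"
  by (rule fs.span_base) (unfold multilinear_relations_def, blast)

text \<open>The left-hand side is the additivity condition of \<open>linear_ext_respects_aux\<close>
  for a map given by linear extensions; moving the differences inside reduces it to single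
  words.\<close>

lemma linear_ext_fun_diff3:
  "linear_ext fscale f x - linear_ext fscale g x - linear_ext fscale h x = linear_ext fscale (\<lambda>w. f w - g w - h w) x"
  by (simp add: linear_ext_def fs.scale_right_diff_distrib sum_subtractf)

lemma linear_ext_fun_diff_scale:
  "linear_ext fscale f x - fscale c (linear_ext fscale g x) = linear_ext fscale (\<lambda>w. f w - fscale c (g w)) x"
  by (simp add: linear_ext_def fs.scale_right_diff_distrib sum_subtractf fs.scale_sum_right mult.commute)

text \<open>A word over \<open>V\<close> put in front of a multilinearity relation is absorbed into
  the context \<open>u\<close>, giving another relation. On the right it goes into
  \<open>w\<close>.\<close>

lemma tensor_eq_concat_left:
  assumes "p \<in> tensor_algebra V" "tensor_eq s V x y"
  shows "tensor_eq s V (p \<otimes>\<^sub>t x) (p \<otimes>\<^sub>t y)"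
proof -
  let ?N = "fs.span (multilinear_relations s V)"
  have p: "set v \<subseteq> V" if "v \<in> Poly_Mapping.keys p" for v
    using that assms(1) by (auto simp: tensor_algebra_def)
  have "linear_ext fscale (\<lambda>w. linear_ext fscale (\<lambda>v. pure_tensor (v @ w)) p) x -
      linear_ext fscale (\<lambda>w. linear_ext fscale (\<lambda>v. pure_tensor (v @ w)) p) y \<in> ?N"
  proof (rule fs.linear_ext_respects_aux[OF fs.subspace_span _ _ assms(2)];
      unfold linear_ext_fun_diff3 linear_ext_fun_diff_scale;
      rule fs.linear_ext_in_subspace[OF fs.subspace_span])
    fix u w a b v assume "set u \<subseteq> V" "set w \<subseteq> V" "a \<in> V" "b \<in> V" "v \<in> Poly_Mapping.keys p"
    then show "pure_tensor (v @ u @ [a + b] @ w) - pure_tensor (v @ u @ [a] @ w) - pure_tensor (v @ u @ [b] @ w) \<in> ?N"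
      using relation_add[of "v @ u" V w a b s] p[of v] by (simp only: append_assoc set_append Un_subset_iff)
  next
    fix u w a c v assume "set u \<subseteq> V" "set w \<subseteq> V" "a \<in> V" "v \<in> Poly_Mapping.keys p"
    then show "pure_tensor (v @ u @ [s c a] @ w) - fscale c (pure_tensor (v @ u @ [a] @ w)) \<in> ?N"
      using relation_scale[of "v @ u" V w a s c] p[of v] by (simp only: append_assoc set_append Un_subset_iff)
  qed
  then show ?thesis
    unfolding tensor_eq_def concat_eq fs.linear_ext_swap[of _ _ p] .
qed

lemma tensor_eq_concat_right:
  assumes "p \<in> tensor_algebra V" "tensor_eq s V x y"
  shows "tensor_eq s V (x \<otimes>\<^sub>t p) (y \<otimes>\<^sub>t p)"
proof -
  let ?N = "fs.span (multilinear_relations s V)"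
  have p: "set v \<subseteq> V" if "v \<in> Poly_Mapping.keys p" for v
    using that assms(1) by (auto simp: tensor_algebra_def)
  show ?thesis
    unfolding tensor_eq_def concat_eq
  proof (rule fs.linear_ext_respects_aux[OF fs.subspace_span _ _ assms(2)];
      unfold linear_ext_fun_diff3 linear_ext_fun_diff_scale;
      rule fs.linear_ext_in_subspace[OF fs.subspace_span])
    fix u w a b v assume "set u \<subseteq> V" "set w \<subseteq> V" "a \<in> V" "b \<in> V" "v \<in> Poly_Mapping.keys p"
    then show "pure_tensor ((u @ [a + b] @ w) @ v) - pure_tensor ((u @ [a] @ w) @ v) - pure_tensor ((u @ [b] @ w) @ v) \<in> ?N"
      using relation_add[of u V "w @ v" a b s] p[of v] by (simp only: append_assoc set_append Un_subset_iff)
  next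
    fix u w a c v assume "set u \<subseteq> V" "set w \<subseteq> V" "a \<in> V" "v \<in> Poly_Mapping.keys p"
    then show "pure_tensor ((u @ [s c a] @ w) @ v) - fscale c (pure_tensor ((u @ [a] @ w) @ v)) \<in> ?N"
      using relation_scale[of u V "w @ v" a s c] p[of v] by (simp only: append_assoc set_append Un_subset_iff)
  qed
qed

lemma subspace_tensor_ideal: "fs.subspace (tensor_ideal s V S)"
proof (rule fs.subspaceI)
  show "0 \<in> tensor_ideal s V S"
    unfolding tensor_ideal_def using fs.span_zero tensor_eq_refl fs.subspace_0[OF subspace_tensor_algebra] by blast
  show "x + y \<in> tensor_ideal s V S" if "x \<in> tensor_ideal s V S" "y \<in> tensor_ideal s V S" for x y
    using that unfolding tensor_ideal_def
    by (blast intro: fs.subspace_add[OF subspace_tensor_algebra] fs.span_add tensor_eq_add)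
  show "fscale c x \<in> tensor_ideal s V S" if "x \<in> tensor_ideal s V S" for c x
    using that unfolding tensor_ideal_def
    by (blast intro: fs.subspace_scale[OF subspace_tensor_algebra] fs.span_scale tensor_eq_scale)
qed

lemma tensor_ideal_eq: "x \<in> tensor_algebra V \<Longrightarrow> tensor_eq s V x y \<Longrightarrow> y \<in> tensor_ideal s V S \<Longrightarrow> x \<in> tensor_ideal s V S"
  unfolding tensor_ideal_def using tensor_eq_trans by blast

lemma tensor_ideal_concat_right:
  assumes "x \<in> tensor_ideal s V S" "t \<in> tensor_algebra V"
  shows "x \<otimes>\<^sub>t t \<in> tensor_ideal s V S"
proof -
  let ?G = "{p \<otimes>\<^sub>t r \<otimes>\<^sub>t q | p r q. p \<in> tensor_algebra V \<and> r \<in> S \<and> q \<in> tensor_algebra V}"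
  obtain y where x: "x \<in> tensor_algebra V" and y: "y \<in> fs.span ?G" "tensor_eq s V x y"
    using assms(1) unfolding tensor_ideal_def by blast
  note l = bilin_left[OF bilin_concat]
  have "y \<otimes>\<^sub>t t \<in> fs.span ?G"
    using y(1)
  proof (induction rule: fs.span_induct_alt)
    case base
    show ?case by (simp add: lin_zero[OF l] fs.span_zero)
  next
    case (step c g z)
    then obtain p r q where "g = p \<otimes>\<^sub>t r \<otimes>\<^sub>t q" "p \<in> tensor_algebra V" "r \<in> S" "q \<in> tensor_algebra V"
      by blast
    then have "g \<otimes>\<^sub>t t \<in> ?G"
      using assms(2) concat_algebra by (fastforce simp: concat_assoc)
    then show ?case
      using step(2) by (simp add: lin_add[OF l] lin_scale[OF l] fs.span_add fs.span_scale fs.span_base)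
  qed
  then show ?thesis
    using x y(2) assms(2) tensor_eq_concat_right concat_algebra unfolding tensor_ideal_def by blast
qed

text \<open>\<open>S\<close> need not contain whole congruence classes, so \<open>r\<close> is only
  asked to be congruent to an element of \<open>S\<close>.\<close>

lemma tensor_ideal_concat_left:
  assumes "p \<in> tensor_algebra V" "r \<in> tensor_algebra V" "tensor_eq s V r r'" "r' \<in> S"
  shows "p \<otimes>\<^sub>t r \<in> tensor_ideal s V S"
proof -
  have "pure_tensor [] \<in> tensor_algebra V"
    by (simp add: tensor_algebra_def pure_tensor_def)
  then have "p \<otimes>\<^sub>t r' \<otimes>\<^sub>t pure_tensor [] \<in> fs.span {p \<otimes>\<^sub>t r \<otimes>\<^sub>t q | p r q. p \<in> tensor_algebra V \<and> r \<in> S \<and> q \<in> tensor_algebra V}"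
    using assms by (intro fs.span_base) blast
  then have "p \<otimes>\<^sub>t r' \<in> fs.span {p \<otimes>\<^sub>t r \<otimes>\<^sub>t q | p r q. p \<in> tensor_algebra V \<and> r \<in> S \<and> q \<in> tensor_algebra V}"
    by simp
  then show ?thesis
    unfolding tensor_ideal_def using assms concat_algebra tensor_eq_concat_left by blast
qed

definition tensor_part :: "nat \<Rightarrow> ('a, 'k::field) tensor \<Rightarrow> ('a, 'k) tensor" where
  "tensor_part n = linear_ext fscale (\<lambda>w. if length w = n then pure_tensor w else 0)"

lemma lookup_tensor_part:
  "Poly_Mapping.lookup (tensor_part n x) w = (if length w = n then Poly_Mapping.lookup x w else 0)"
proof -
  have "tensor_part n x = restrict_keys {w. length w = n} x"
    unfolding tensor_part_def
    by (rule fs.lin_eqI[OF fs.lin_linear_ext_arg])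
      (auto intro!: linI poly_mapping_eqI simp: lookup_add pure_tensor_def lookup_single when_def)
  then show ?thesis by simp
qed

lemma tensor_part_power: "x \<in> tensor_algebra V \<Longrightarrow> tensor_part n x \<in> tensor_power V n"
  by (auto simp: in_tensor_power_iff tensor_algebra_def in_keys_iff lookup_tensor_part split: if_splits)

lemma tensor_part_id: "x \<in> tensor_power V n \<Longrightarrow> tensor_part n x = x"
  by (rule poly_mapping_eqI) (auto simp: in_tensor_power_iff in_keys_iff lookup_tensor_part)

lemma tensor_part_decomposition: "x = (\<Sum>n\<in>length ` Poly_Mapping.keys x. tensor_part n x)"
  by (rule poly_mapping_eqI) (auto simp: lookup_sum' lookup_tensor_part in_keys_iff)

lemma tensor_part_respects:
  assumes "tensor_eq s V x y" shows "tensor_eq s V (tensor_part n x) (tensor_part n y)"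
  unfolding tensor_eq_def tensor_part_def
  by (rule fs.linear_ext_respects_aux[OF fs.subspace_span _ _ assms])
    (use relation_add relation_scale fs.span_zero in \<open>auto simp del: append_Cons append_Nil\<close>)

text \<open>Since \<open>S\<close> sits in degree two, the degree two part of
  \<open>p \<otimes> r \<otimes> q\<close> comes from the empty words in \<open>p\<close> and
  \<open>q\<close> alone and is a scalar multiple of \<open>r\<close>.\<close>

lemma tensor_part_ideal:
  fixes S :: "('a::ab_group_add, 'k::field) tensor set"
  assumes S: "fs.subspace S" "S \<subseteq> tensor_power V 2" and x: "x \<in> tensor_power V 2" "x \<in> tensor_ideal s V S"
  shows "\<exists>r\<in>S. tensor_eq s V x r"
proof -
  let ?G = "{p \<otimes>\<^sub>t r \<otimes>\<^sub>t q | p r q. p \<in> tensor_algebra V \<and> r \<in> S \<and> q \<in> tensor_algebra V}"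
  let ?g = "\<lambda>w :: 'a list. if length w = 2 then pure_tensor w else (0 :: ('a, 'k) tensor)"
  obtain y where y: "y \<in> fs.span ?G" "tensor_eq s V x y"
    using x(2) unfolding tensor_ideal_def by blast
  have gen: "tensor_part 2 (p \<otimes>\<^sub>t r \<otimes>\<^sub>t q) \<in> S" if r: "r \<in> S" for p r q
  proof -
    \<comment> \<open>A nonempty prefix or suffix makes every word longer than two, so that the
      cut-off gives zero.\<close>
    have inner: "linear_ext fscale (\<lambda>v. ?g (u @ v @ w)) r \<in> S" for u w
    proof (cases "u = [] \<and> w = []")
      case True
      have "tensor_part 2 r = r"
        using r S(2) by (intro tensor_part_id) blast
      then show ?thesis using True r by (simp add: tensor_part_def cong: if_cong)
    next
      case False
      then have "length u + length w > 0" by auto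
      then have "linear_ext fscale (\<lambda>v. ?g (u @ v @ w)) r = linear_ext fscale (\<lambda>v. 0) r"
        using r S(2) by (intro fs.linear_ext_cong) (auto simp: in_tensor_power_iff)
      then show ?thesis by (simp add: linear_ext_def fs.subspace_0[OF S(1)])
    qed
    have "linear_ext fscale (\<lambda>u. linear_ext fscale (\<lambda>w. linear_ext fscale (\<lambda>v. ?g (u @ v @ w)) r) q) p \<in> S"
      by (rule fs.linear_ext_in_subspace[OF S(1)], rule fs.linear_ext_in_subspace[OF S(1)], rule inner)
    then show ?thesis
      by (simp add: tensor_part_def concat_eq fs.linear_ext_linear_ext fs.linear_ext_swap[of _ q r])
  qed
  have "tensor_part 2 y \<in> S"
    using y(1)
  proof (induction rule: fs.span_induct_alt)
    case base
    show ?case by (simp add: tensor_part_def fs.subspace_0[OF S(1)])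
  next
    case (step c g z)
    then have "tensor_part 2 g \<in> S" using gen by blast
    then show ?case
      using step(2) unfolding tensor_part_def
      by (simp add: fs.linear_ext_add fs.linear_ext_fscale fs.subspace_add[OF S(1)] fs.subspace_scale[OF S(1)])
  qed
  then show ?thesis
    using tensor_part_respects[OF y(2), of 2] tensor_part_id[OF x(1)] by auto
qed

section \<open>The canonical homomorphism from the tensor algebra\<close>

context assoc_algebra
begin

lemma lin_canonical_hom: "lin fscale scale (canonical_hom scale mult unit)"
  unfolding canonical_hom_def[abs_def] by (rule lin_linear_ext_arg)

lemma canonical_hom_pure [simp]: "canonical_hom scale mult unit (pure_tensor w) = foldr mult w unit"
  by (simp add: canonical_hom_def)

lemma foldr_mult_append: "foldr mult (u @ w) unit = mult (foldr mult u unit) (foldr mult w unit)"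
  by (induction u) (simp_all add: mult_unit_left mult_assoc)

lemma canonical_hom_concat:
  "canonical_hom scale mult unit (x \<otimes>\<^sub>t y) = mult (canonical_hom scale mult unit x) (canonical_hom scale mult unit y)"
  unfolding canonical_hom_def tensor_concat_def linear_ext_bilinear_ext foldr_mult_append
    lin_linear_ext[OF bilin_left[OF bilin_mult]] lin_linear_ext[OF bilin_right[OF bilin_mult]]
  by (rule linear_ext_swap)

lemma canonical_hom_respects:
  assumes "tensor_eq scale V x y"
  shows "canonical_hom scale mult unit x = canonical_hom scale mult unit y"
proof -
  have "canonical_hom scale mult unit x - canonical_hom scale mult unit y \<in> {0}"
    unfolding canonical_hom_def
    by (rule linear_ext_respects_aux[OF subspace_single_0 _ _ assms])
      (simp_all add: foldr_mult_append mult_add_left mult_add_right mult_scale_left mult_scale_right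
        del: foldr_append)
  then show ?thesis by simp
qed

lemma tensor_ideal_in_kernel:
  assumes "\<And>r. r \<in> S \<Longrightarrow> canonical_hom scale mult unit r = 0" "x \<in> tensor_ideal scale V S"
  shows "canonical_hom scale mult unit x = 0"
proof -
  let ?G = "{p \<otimes>\<^sub>t r \<otimes>\<^sub>t q | p r q. p \<in> tensor_algebra V \<and> r \<in> S \<and> q \<in> tensor_algebra V}"
  obtain y where y: "y \<in> fs.span ?G" "tensor_eq scale V x y"
    using assms(2) unfolding tensor_ideal_def by blast
  have "canonical_hom scale mult unit y = 0"
    using y(1)
  proof (induction rule: fs.span_induct_alt)
    case (step c g z)
    then show ?case
      by (auto simp: lin_add[OF lin_canonical_hom] lin_scale[OF lin_canonical_hom] canonical_hom_concat assms(1))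
  qed (simp add: lin_zero[OF lin_canonical_hom])
  then show ?thesis using canonical_hom_respects[OF y(2)] by simp
qed

end

lemma tensor_eq_sum:
  "(\<And>i. i \<in> I \<Longrightarrow> tensor_eq s V (f i) (g i)) \<Longrightarrow> tensor_eq s V (sum f I) (sum g I)"
  unfolding tensor_eq_def sum_subtractf[symmetric] by (rule fs.span_sum)

lemma (in vector_space) tensor_eq_linear_combination:
  assumes V: "subspace V" "\<And>b. v b \<in> V"
  shows "tensor_eq scale V (pure_tensor [linear_ext scale v k]) (linear_ext fscale (\<lambda>b. pure_tensor [v b]) k)"
proof -
  have "tensor_eq scale V (pure_tensor [\<Sum>b\<in>I. scale (f b) (v b)]) (\<Sum>b\<in>I. fscale (f b) (pure_tensor [v b]))"
    if "finite I" for I and f :: "'c \<Rightarrow> 'a"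
    using that
  proof (induction I)
    case empty
    show ?case
      \<comment> \<open>The letter 0 is a nonzero formal combination; the scaling relation with
        scalar 0 makes it congruent to 0.\<close>
      using relation_scale[of "[]" V "[]" 0 scale 0] subspace_0[OF V(1)] by (simp add: tensor_eq_def)
  next
    case (insert b I)
    let ?a = "scale (f b) (v b)" and ?t = "\<Sum>b\<in>I. scale (f b) (v b)"
    have in_V: "?a \<in> V" "?t \<in> V"
      using V by (auto intro: subspace_scale subspace_sum)
    have "tensor_eq scale V (pure_tensor [?a + ?t]) (pure_tensor [?a] + pure_tensor [?t])"
      using relation_add[of "[]" V "[]" ?a ?t scale] in_V by (simp add: tensor_eq_def algebra_simps)
    moreover have "tensor_eq scale V (pure_tensor [?a]) (fscale (f b) (pure_tensor [v b]))"
      using relation_scale[of "[]" V "[]" "v b" scale "f b"] V(2) by (simp add: tensor_eq_def)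
    ultimately show ?case
      using insert tensor_eq_add tensor_eq_trans by (fastforce simp del: append_Nil)
  qed
  then show ?thesis by (simp add: linear_ext_def)
qed

context connected_graded_algebra
begin

lemma foldr_mult_degree: "set w \<subseteq> A 1 \<Longrightarrow> foldr mult w unit \<in> A (length w)"
proof (induction w)
  case Nil
  then show ?case using unit_degree[of 1] by simp
next
  case (Cons a w)
  then show ?case using graded_mult[of a 1 "foldr mult w unit" "length w"] by simp
qed

lemma canonical_hom_degree: "x \<in> tensor_power (A 1) n \<Longrightarrow> canonical_hom scale mult unit x \<in> A n"
  unfolding canonical_hom_def
  by (rule linear_ext_in_subspace[OF graded_subspace]) (use foldr_mult_degree in \<open>fastforce simp: in_tensor_power_iff\<close>)

lemma hcomp_canonical_hom:
  assumes "x \<in> tensor_algebra (A 1)"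
  shows "hcomp (canonical_hom scale mult unit x) n = canonical_hom scale mult unit (tensor_part n x)"
proof (rule lin_eqI[OF lin_comp[OF lin_canonical_hom lin_hcomp] lin_comp[OF _ lin_canonical_hom]])
  show "lin fscale fscale (tensor_part n)"
    unfolding tensor_part_def by (rule fs.lin_linear_ext_arg)
  fix w assume "w \<in> Poly_Mapping.keys x"
  then have "set w \<subseteq> A 1" using assms by (auto simp: tensor_algebra_def)
  from hcomp_homogeneous[OF foldr_mult_degree[OF this]]
  show "hcomp (canonical_hom scale mult unit (Poly_Mapping.single w 1)) n =
      canonical_hom scale mult unit (tensor_part n (Poly_Mapping.single w 1))"
    by (simp add: tensor_part_def lin_zero[OF lin_canonical_hom] flip: pure_tensor_def)
qed

end

section \<open>Generators and relations read off from a resolution\<close>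

context linear_free_resolution
begin

lemma augmentation_generator:
  obtains w0 where "w0 \<in> free_module (B 0)" "et (free_tensor scale unit w0) = 1"
proof -
  obtain x where x: "x \<in> free_module (B 0)" "et x = 1"
    using exact_k et_eq by (metis UNIV_I imageE)
  have 0: "fcomp 0 (fcomp 0 x) = fcomp 0 x"
    by (rule poly_mapping_eqI) (simp add: hcomp_homogeneous[OF hcomp(1)])
  let ?w = "Poly_Mapping.map augmentation (fcomp 0 x)"
  show ?thesis
  proof (rule that)
    show "?w \<in> free_module (B 0)"
      using fcomp_free_module[OF x(1), of 0] by (auto simp: free_module_iff lookup_map lin_zero[OF lin_augmentation])
    show "et (free_tensor scale unit ?w) = 1"
      using et_fcomp_0[OF x(1)] x(2) degree_zero_tensor[OF 0] by simp
  qed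
qed

text \<open>Identifying \<open>P\<^sub>0\<close> with \<open>A\<close>, the differential \<open>P\<^sub>1 \<rightarrow> P\<^sub>0\<close> sends the generator \<open>b\<close> to \<open>v b \<in> A\<^sub>1\<close>.\<close>

lemma degree_one_generators:
  "\<exists>v w0. (\<forall>b. v b \<in> A 1) \<and> (\<forall>a. free_tensor scale a w0 = 0 \<longrightarrow> a = 0) \<and>
    w0 \<in> free_module (B 0) \<and> et (free_tensor scale unit w0) = 1 \<and>
    (\<forall>b. dt 0 (free_tensor scale unit (Poly_Mapping.single b 1)) = free_tensor scale (v b) w0)"
proof -
  obtain w0 where w0: "w0 \<in> free_module (B 0)" "et (free_tensor scale unit w0) = 1"
    by (rule augmentation_generator)
  have "w0 \<noteq> 0"
    using w0(2) by (auto simp: lin_zero[OF bilin_right[OF bilin_free_tensor]] lin_zero[OF lin_et])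
  then obtain b0 where b0: "Poly_Mapping.lookup w0 b0 \<noteq> 0"
    by (metis poly_mapping_eqI lookup_zero)
  have inj: "a = 0" if "free_tensor scale a w0 = 0" for a
    using arg_cong[OF that, of "\<lambda>x. Poly_Mapping.lookup x b0"] b0 by simp
  \<comment> \<open>The generators of \<open>P_0\<close> form a line: subtracting the multiple of
    \<open>w0\<close> with the same augmentation leaves a vector killed by \<open>et\<close>, hence
    zero.\<close>
  have span: "w = fscale (et (free_tensor scale unit w)) w0" if "w \<in> free_module (B 0)" for w
  proof -
    let ?z = "w - fscale (et (free_tensor scale unit w)) w0"
    have "?z \<in> free_module (B 0)"
      using that w0(1) by (auto simp: free_module_iff lookup_minus)
    moreover have "et (free_tensor scale unit ?z) = 0"
      by (simp add: lin_diff[OF bilin_right[OF bilin_free_tensor]] lin_scale[OF bilin_right[OF bilin_free_tensor]]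
          lin_diff[OF lin_et] lin_scale[OF lin_et] w0(2))
    ultimately show ?thesis using et_generators_inj[of ?z] by simp
  qed
  have "\<exists>a. x = free_tensor scale a w0" if x: "x \<in> free_module (B 0)" for x
  proof
    let ?s = "\<lambda>b. Poly_Mapping.single b (1 :: 'k)"
    have s: "?s b \<in> free_module (B 0)" if "b \<in> Poly_Mapping.keys x" for b
      using that x by (auto simp: free_module_def)
    have "x = (\<Sum>b\<in>Poly_Mapping.keys x. free_tensor scale (Poly_Mapping.lookup x b) (?s b))"
      by (rule free_decomposition)
    also have "\<dots> = (\<Sum>b\<in>Poly_Mapping.keys x. free_tensor scale (scale (et (free_tensor scale unit (?s b))) (Poly_Mapping.lookup x b)) w0)"
    proof (rule sum.cong[OF refl])
      fix b assume "b \<in> Poly_Mapping.keys x"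
      from span[OF s[OF this]]
      show "free_tensor scale (Poly_Mapping.lookup x b) (?s b) =
          free_tensor scale (scale (et (free_tensor scale unit (?s b))) (Poly_Mapping.lookup x b)) w0"
        by (metis lin_scale[OF bilin_right[OF bilin_free_tensor]] lin_scale[OF bilin_left[OF bilin_free_tensor]])
    qed
    finally show "x = free_tensor scale (\<Sum>b\<in>Poly_Mapping.keys x. scale (et (free_tensor scale unit (?s b))) (Poly_Mapping.lookup x b)) w0"
      by (simp add: lin_sum[OF bilin_left[OF bilin_free_tensor]])
  qed
  then have "\<forall>b. \<exists>a. dt 0 (free_tensor scale unit (Poly_Mapping.single b 1)) = free_tensor scale a w0"
    using dt_in by blast
  then obtain v where v: "\<And>b. dt 0 (free_tensor scale unit (Poly_Mapping.single b 1)) = free_tensor scale (v b) w0"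
    by metis
  have "v b \<in> A 1" for b
  proof -
    \<comment> \<open>The coordinate at \<open>b0\<close> is a nonzero multiple of
      \<open>v b\<close>, so the degree of \<open>v b\<close> can be read there.\<close>
    have "scale (Poly_Mapping.lookup w0 b0) (v b) \<in> A 1"
      using dt_generator_degree[of 0 "Poly_Mapping.single b 1" b0] by (simp add: v)
    from subspace_scale[OF graded_subspace this, of "inverse (Poly_Mapping.lookup w0 b0)"]
    show ?thesis using b0 by simp
  qed
  then show ?thesis using inj w0 v by blast
qed

text \<open>The kernel is compared with \<open>S\<close> up to \<open>tensor_eq\<close>, because
  \<open>S\<close> consists of representatives.\<close>

theorem quadratic_presentation_of_degree_two_kernel:
  assumes S: "fs.subspace S" "S \<subseteq> tensor_power (A 1) 2"
    and ker2: "\<And>x. x \<in> tensor_power (A 1) 2 \<Longrightarrow>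
      canonical_hom scale mult unit x = 0 \<longleftrightarrow> (\<exists>r\<in>S. tensor_eq scale (A 1) x r)"
  shows "quadratic_presentation scale mult unit (A 1) S"
proof -
  let ?c = "canonical_hom scale mult unit"
  let ?I = "tensor_ideal scale (A 1) S"
  obtain v w0 where v: "\<And>b. v b \<in> A 1" and w0: "\<And>a. free_tensor scale a w0 = 0 \<Longrightarrow> a = 0"
    "w0 \<in> free_module (B 0)" "et (free_tensor scale unit w0) = 1"
    and dv: "\<And>b. dt 0 (free_tensor scale unit (Poly_Mapping.single b 1)) = free_tensor scale (v b) w0"
    using degree_one_generators by blast
  note c0 = lin_zero[OF lin_canonical_hom]
  \<comment> \<open>Under the identification of \<open>P_0\<close> with \<open>A\<close> through
    \<open>w0\<close>, \<open>free_ext M\<close> is the differential out of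
    \<open>P_1\<close>.\<close>
  define M where "M a w = mult a (linear_ext scale v w)" for a w
  have bilin_M: "bilin scale fscale scale M"
    unfolding M_def
    by (intro bilinI bilin_left[OF bilin_mult] lin_comp[OF lin_linear_ext_arg bilin_right[OF bilin_mult]])
  have M1 [simp]: "M a (Poly_Mapping.single b 1) = mult a (v b)" for a b
    by (simp add: M_def)
  note lin_M = lin_free_ext[OF vector_space_axioms bilin_M]
  have d0: "dt 0 x = free_tensor scale (free_ext M x) w0" for x
    by (rule free_lin_eqI[OF lin_dt lin_comp[OF lin_M bilin_left[OF bilin_free_tensor]]])
      (subst dt_tensor, simp add: dv free_smult_tensor free_ext_tensor[OF vector_space_axioms bilin_M])
  have d0_eq_0: "dt 0 x = 0 \<longleftrightarrow> free_ext M x = 0" for x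
    using w0(1) lin_zero[OF bilin_left[OF bilin_free_tensor]] by (auto simp: d0)
  \<comment> \<open>Elements of positive degree die under the augmentation, so exactness at
    \<open>P_0\<close> writes them through the \<open>v b\<close>. Component \<open>n\<close> of the
    preimage suffices, since the differential raises coefficient degree by one.\<close>
  have gen: "\<exists>z\<in>free_module (B 1). (\<forall>b. Poly_Mapping.lookup z b \<in> A n) \<and> a = free_ext M z" if a: "a \<in> A (Suc n)" for a n
  proof -
    have "et (free_tensor scale a w0) = 0"
      using et_smult[of a "free_tensor scale unit w0"] augmentation_eq_0[OF a] by (simp add: free_smult_tensor mult_unit_right)
    moreover have "free_tensor scale a w0 \<in> free_module (B 0)"
      using w0(2) by (simp add: free_module_iff)
    ultimately obtain z where z: "z \<in> free_module (B 1)" "free_tensor scale a w0 = dt 0 z"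
      using dt_exact_0 by blast
    have "free_tensor scale (free_ext M (fcomp n z)) w0 = fcomp (Suc n) (dt 0 z)"
      using fcomp_Suc_dt(1)[of z 0 n] z(1) by (simp add: d0)
    also have "\<dots> = free_tensor scale a w0"
      using fcomp_tensor[OF a, of "Suc n" w0] by (simp flip: z(2))
    finally have "free_tensor scale (free_ext M (fcomp n z) - a) w0 = 0"
      by (simp add: lin_diff[OF bilin_left[OF bilin_free_tensor]])
    then have "a = free_ext M (fcomp n z)" using w0(1) by force
    then show ?thesis
      using fcomp_free_module[OF z(1)] hcomp(1) by (intro bexI[of _ "fcomp n z"]) auto
  qed
  have vpow: "pure_tensor [v b] \<in> tensor_power (A 1) 1" for b
    using v by (simp add: pure_tensor_power)
  have onto: "\<exists>p\<in>tensor_power (A 1) n. ?c p = a" if "a \<in> A n" for a n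
    using that
  proof (induction n arbitrary: a)
    case 0
    then obtain k where "a = scale k unit" using connected(1) by auto
    moreover have "fscale k (pure_tensor []) \<in> tensor_power (A 1) 0"
      by (intro fs.subspace_scale[OF subspace_tensor_power] pure_tensor_power) auto
    ultimately show ?case
      by (intro bexI[of _ "fscale k (pure_tensor [])"]) (simp_all add: lin_scale[OF lin_canonical_hom])
  next
    case (Suc n)
    obtain z where z: "\<forall>b. Poly_Mapping.lookup z b \<in> A n" "a = free_ext M z"
      using gen[OF Suc.prems] by blast
    have "\<forall>b. \<exists>p\<in>tensor_power (A 1) n. ?c p = Poly_Mapping.lookup z b"
      using z(1) Suc.IH by blast
    then obtain p where p: "\<And>b. p b \<in> tensor_power (A 1) n" "\<And>b. ?c (p b) = Poly_Mapping.lookup z b"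
      by metis
    let ?p = "\<Sum>b\<in>Poly_Mapping.keys z. p b \<otimes>\<^sub>t pure_tensor [v b]"
    have "?p \<in> tensor_power (A 1) (Suc n)"
      using concat_power[OF p(1) vpow] by (intro fs.subspace_sum[OF subspace_tensor_power]) simp
    moreover have "?c ?p = a"
      by (simp add: lin_sum[OF lin_canonical_hom] canonical_hom_concat p(2) z(2) free_ext_def mult_unit_right)
    ultimately show ?case by blast
  qed
  have surj: "?c ` tensor_algebra (A 1) = UNIV"
  proof -
    have "\<exists>x\<in>tensor_algebra (A 1). a = ?c x" for a
    proof -
      have "\<forall>i. \<exists>p\<in>tensor_power (A 1) i. ?c p = hcomp a i"
        using onto hcomp(1) by blast
      then obtain p where p: "\<And>i. p i \<in> tensor_power (A 1) i" "\<And>i. ?c (p i) = hcomp a i"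
        by metis
      have "a = ?c (\<Sum>i | hcomp a i \<noteq> 0. p i)"
        by (simp add: lin_sum[OF lin_canonical_hom] p(2) flip: hcomp(3))
      moreover have "(\<Sum>i | hcomp a i \<noteq> 0. p i) \<in> tensor_algebra (A 1)"
        using p(1) tensor_power_subset by (intro fs.subspace_sum[OF subspace_tensor_algebra]) blast
      ultimately show ?thesis by blast
    qed
    then show ?thesis by blast
  qed
  \<comment> \<open>The lift of \<open>M\<close> to the tensor algebra, with concatenation in place
    of the product; the canonical map carries \<open>free_ext N\<close> to
    \<open>free_ext M\<close>.\<close>
  define N where "N p w = p \<otimes>\<^sub>t linear_ext fscale (\<lambda>b. pure_tensor [v b]) w"
    for p :: "('a, 'k) tensor" and w :: "'b \<Rightarrow>\<^sub>0 'k"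
  have bilin_N: "bilin fscale fscale fscale N"
    unfolding N_def
    by (intro bilinI bilin_left[OF bilin_concat] lin_comp[OF fs.lin_linear_ext_arg bilin_right[OF bilin_concat]])
  have N1 [simp]: "N p (Poly_Mapping.single b 1) = p \<otimes>\<^sub>t pure_tensor [v b]" for p b
    by (simp add: N_def)
  note lin_N = fs.lin_free_ext[OF fs.vector_space_axioms bilin_N]
  have c_N: "?c (free_ext N X) = free_ext M (Poly_Mapping.map ?c X)" for X
    by (subst free_ext_superset[OF bilin_M finite_keys[of X]])
      (auto simp: free_ext_def lin_sum[OF lin_canonical_hom] canonical_hom_concat mult_unit_right lookup_map c0 in_keys_iff)
  \<comment> \<open>The last letter of each word is rewritten through the \<open>v b\<close>, which
    leaves coefficients of one degree less.\<close>
  have N_part: "\<exists>X\<in>free_module (B 1). (\<forall>b. Poly_Mapping.lookup X b \<in> tensor_power (A 1) n) \<and> tensor_eq scale (A 1) x (free_ext N X)"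
    if x: "x \<in> tensor_power (A 1) (Suc n)" for x n
  proof -
    have word: "\<exists>X\<in>free_module (B 1). (\<forall>b. Poly_Mapping.lookup X b \<in> tensor_power (A 1) n) \<and>
        tensor_eq scale (A 1) (pure_tensor w) (free_ext N X)" if w: "w \<in> Poly_Mapping.keys x" for w
    proof -
      have "set w \<subseteq> A 1" "length w = Suc n"
        using w x unfolding in_tensor_power_iff by blast+
      then obtain u a where u: "w = u @ [a]" "set u \<subseteq> A 1" "length u = n" "a \<in> A 1"
        by (cases w rule: rev_cases) auto
      obtain z where z: "z \<in> free_module (B 1)" "\<forall>b. Poly_Mapping.lookup z b \<in> A 0" "a = free_ext M z"
        using gen[of a 0] u(4) by auto
      let ?k = "Poly_Mapping.map augmentation z"
      \<comment> \<open>Coefficients of degree zero are scalars, so \<open>a\<close> is a linear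
        combination of the \<open>v b\<close>.\<close>
      have "fcomp 0 z = z"
        using z(2) by (simp add: fcomp_homogeneous[of z 0])
      then have "a = M unit ?k"
        using z(3) degree_zero_tensor[of z] free_ext_tensor[OF vector_space_axioms bilin_M] by metis
      then have a: "a = linear_ext scale v ?k"
        by (simp add: M_def mult_unit_left)
      let ?X = "free_tensor fscale (pure_tensor u) ?k"
      have u1: "pure_tensor u \<in> tensor_power (A 1) n"
        using u(2,3) by (simp add: pure_tensor_power)
      have "tensor_eq scale (A 1) (pure_tensor u \<otimes>\<^sub>t pure_tensor [a]) (N (pure_tensor u) ?k)"
        unfolding N_def a using u1 tensor_power_subset v
        by (intro tensor_eq_concat_left tensor_eq_linear_combination graded_subspace) blast+
      then have "tensor_eq scale (A 1) (pure_tensor w) (free_ext N ?X)"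
        by (simp add: concat_pure u(1) fs.free_ext_tensor[OF fs.vector_space_axioms bilin_N])
      moreover have "?X \<in> free_module (B 1)"
        using z(1) by (auto simp: free_module_iff lookup_map lin_zero[OF lin_augmentation])
      moreover have "Poly_Mapping.lookup ?X b \<in> tensor_power (A 1) n" for b
        unfolding fs.lookup_free_tensor by (rule fs.subspace_scale[OF subspace_tensor_power u1])
      ultimately show ?thesis by blast
    qed
    define X where "X w = (SOME X. X \<in> free_module (B 1) \<and> (\<forall>b. Poly_Mapping.lookup X b \<in> tensor_power (A 1) n) \<and>
        tensor_eq scale (A 1) (pure_tensor w) (free_ext N X))" for w
    have X: "X w \<in> free_module (B 1)" "Poly_Mapping.lookup (X w) b \<in> tensor_power (A 1) n"
        "tensor_eq scale (A 1) (pure_tensor w) (free_ext N (X w))" if "w \<in> Poly_Mapping.keys x" for w b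
      using someI_ex[OF word[OF that, unfolded Bex_def]] unfolding X_def by blast+
    let ?X = "\<Sum>w\<in>Poly_Mapping.keys x. free_scale fscale (Poly_Mapping.lookup x w) (X w)"
    have "tensor_eq scale (A 1) (linear_ext fscale pure_tensor x) (free_ext N ?X)"
      unfolding linear_ext_def lin_sum[OF lin_N] lin_scale[OF lin_N]
      by (intro tensor_eq_sum tensor_eq_scale X(3))
    moreover have "?X \<in> free_module (B 1)"
      using X(1) by (simp add: free_module_iff lookup_sum')
    moreover have "Poly_Mapping.lookup ?X b \<in> tensor_power (A 1) n" for b
      using X(2) by (auto simp: lookup_sum' intro!: fs.subspace_sum[OF subspace_tensor_power] fs.subspace_scale[OF subspace_tensor_power])
    ultimately show ?thesis by auto
  qed
  have N_ideal: "free_ext N X \<in> ?I" if "\<And>b. Poly_Mapping.lookup X b \<in> ?I" for X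
    unfolding free_ext_def N1 using vpow tensor_power_subset that
    by (intro fs.subspace_sum[OF subspace_tensor_ideal] tensor_ideal_concat_right) blast+
  \<comment> \<open>A generator of \<open>P_2\<close> maps to a vector with entries in
    \<open>A 1\<close>. Reading the entries as letters gives \<open>U\<close>, and as consecutive
    differentials compose to zero, \<open>free_ext N U\<close> is a degree two element of the
    kernel.\<close>
  have relation: "\<exists>U. (\<forall>b. Poly_Mapping.lookup U b \<in> tensor_power (A 1) 1) \<and>
      Poly_Mapping.map ?c U = dt 1 (free_tensor scale unit (Poly_Mapping.single j 1)) \<and>
      (\<exists>r\<in>S. tensor_eq scale (A 1) (free_ext N U) r) \<and> free_ext N U \<in> tensor_power (A 1) 2" for j
  proof -
    let ?u = "dt 1 (free_tensor scale unit (Poly_Mapping.single j 1))"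
    \<comment> \<open>As the letter 0 is not the zero combination, a zero entry is sent to 0
      explicitly; \<open>lookup_map\<close> needs this.\<close>
    define U :: "'b \<Rightarrow>\<^sub>0 ('a, 'k) tensor" where "U = Poly_Mapping.map (\<lambda>a. if a = 0 then 0 else pure_tensor [a]) ?u"
    have U: "Poly_Mapping.lookup U b = (if Poly_Mapping.lookup ?u b = 0 then 0 else pure_tensor [Poly_Mapping.lookup ?u b])" for b
      by (simp add: U_def lookup_map)
    have U1: "Poly_Mapping.lookup U b \<in> tensor_power (A 1) 1" for b
      using dt_generator_degree[of 1 "Poly_Mapping.single j 1" b] pure_tensor_power[of "[Poly_Mapping.lookup ?u b]" "A 1" 1]
      by (auto simp: U fs.subspace_0[OF subspace_tensor_power] simp del: One_nat_def)
    have cU: "Poly_Mapping.map ?c U = ?u"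
      by (rule poly_mapping_eqI) (simp add: lookup_map c0 U mult_unit_right)
    have "dt 0 ?u = 0"
      using dt_dt[of 0] by simp
    then have "?c (free_ext N U) = 0"
      by (simp add: c_N cU d0_eq_0)
    moreover have N2: "free_ext N U \<in> tensor_power (A 1) 2"
      unfolding free_ext_def N1 using concat_power[OF U1 vpow]
      by (intro fs.subspace_sum[OF subspace_tensor_power]) (simp add: numeral_2_eq_2)
    ultimately show ?thesis using U1 cU ker2 by blast
  qed
  define U where "U j = (SOME U. (\<forall>b. Poly_Mapping.lookup U b \<in> tensor_power (A 1) 1) \<and>
      Poly_Mapping.map ?c U = dt 1 (free_tensor scale unit (Poly_Mapping.single j 1)) \<and>
      (\<exists>r\<in>S. tensor_eq scale (A 1) (free_ext N U) r) \<and> free_ext N U \<in> tensor_power (A 1) 2)" for j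
  have U: "Poly_Mapping.lookup (U j) b \<in> tensor_power (A 1) 1"
      "Poly_Mapping.map ?c (U j) = dt 1 (free_tensor scale unit (Poly_Mapping.single j 1))"
      "\<exists>r\<in>S. tensor_eq scale (A 1) (free_ext N (U j)) r" "free_ext N (U j) \<in> tensor_power (A 1) 2" for j b
    using someI_ex[OF relation[of j]] unfolding U_def by blast+
  \<comment> \<open>Splitting off the last letters of \<open>x\<close> turns the images of the
    coefficients into a cycle in \<open>P_1\<close>. By exactness it comes from \<open>P_2\<close>,
    that is, from quadratic relations; correcting by these leaves kernel elements of lower
    degree.\<close>
  have ker_homogeneous: "x \<in> ?I" if "x \<in> tensor_power (A 1) n" "?c x = 0" for x n
    using that
  proof (induction n arbitrary: x)
    case 0
    have "x = fscale (Poly_Mapping.lookup x []) (pure_tensor [])"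
    proof (rule poly_mapping_eqI)
      fix w
      have "Poly_Mapping.lookup x w = 0" if "w \<noteq> []"
        using 0(1) that unfolding in_tensor_power_iff by (metis in_keys_iff length_0_conv)
      then show "Poly_Mapping.lookup x w = Poly_Mapping.lookup (fscale (Poly_Mapping.lookup x []) (pure_tensor [])) w"
        by (simp add: pure_tensor_def lookup_single when_def)
    qed
    then obtain k where k: "x = fscale k (pure_tensor [])" by blast
    then have "k = 0"
      using 0(2) connected(2) by (simp add: lin_scale[OF lin_canonical_hom])
    then show ?case using k fs.subspace_0[OF subspace_tensor_ideal] by simp
  next
    case (Suc n)
    have xT: "x \<in> tensor_algebra (A 1)" using Suc.prems(1) tensor_power_subset by blast
    obtain X where X: "X \<in> free_module (B 1)" "\<And>b. Poly_Mapping.lookup X b \<in> tensor_power (A 1) n"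
      "tensor_eq scale (A 1) x (free_ext N X)"
      using N_part[OF Suc.prems(1)] by blast
    let ?y = "Poly_Mapping.map ?c X"
    have y: "?y \<in> free_module (B 1)" using X(1) by (simp add: free_module_iff lookup_map c0)
    have deg: "Poly_Mapping.lookup ?y b \<in> A n" for b
      using canonical_hom_degree[OF X(2)] by (simp add: lookup_map c0)
    have "free_ext M ?y = 0"
      using Suc.prems(2) canonical_hom_respects[OF X(3)] by (simp add: c_N)
    then have "dt 0 ?y = 0" by (simp add: d0_eq_0)
    then obtain z0 where z0: "z0 \<in> free_module (B 2)" "?y = dt 1 z0"
      using dt_exact_Suc[of ?y 0] y by (auto simp: numeral_2_eq_2)
    have "free_ext N X \<in> ?I"
    proof (cases n)
      \<comment> \<open>Here the coefficients have degree zero, where boundaries vanish, so all of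
        them already lie in the kernel.\<close>
      case 0
      have "?y = fcomp 0 ?y" using deg 0 by (simp add: fcomp_homogeneous[of ?y 0])
      also have "\<dots> = 0"
        using fcomp_Suc_dt(2)[of z0 1] z0 by (simp add: numeral_2_eq_2)
      finally have "?c (Poly_Mapping.lookup X b) = 0" for b
        using lookup_map[of ?c X b, OF c0] by simp
      then show ?thesis using Suc.IH X(2) by (intro N_ideal) blast
    next
      case (Suc m)
      \<comment> \<open>The cycle has coefficient degree \<open>n = Suc m\<close> and the
        differential adds one, so only the part of \<open>z0\<close> in degree \<open>m\<close>
        matters.\<close>
      define z where "z = fcomp m z0"
      have yz: "?y = dt 1 z"
      proof -
        have "?y = fcomp (Suc m) ?y" using deg Suc by (simp add: fcomp_homogeneous[of ?y n])
        then show ?thesis using fcomp_Suc_dt(1)[of z0 1 m] z0 by (simp add: z_def numeral_2_eq_2)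
      qed
      have "\<forall>j. \<exists>p\<in>tensor_power (A 1) m. ?c p = Poly_Mapping.lookup z j"
        using onto hcomp(1) by (simp add: z_def)
      then obtain p where p: "\<And>j. p j \<in> tensor_power (A 1) m" "\<And>j. ?c (p j) = Poly_Mapping.lookup z j"
        by metis
      txt \<open>Subtracting the multiples \<open>p j \<otimes>\<^sub>t free_ext N (U j)\<close> of quadratic relations moves all coefficients
        of \<open>X\<close> into the kernel.\<close>
      define PU where "PU j = Poly_Mapping.map (\<lambda>t. p j \<otimes>\<^sub>t t) (U j)" for j
      have PU: "Poly_Mapping.lookup (PU j) b = p j \<otimes>\<^sub>t Poly_Mapping.lookup (U j) b" for j b
        unfolding PU_def by (rule lookup_map) (rule lin_zero[OF bilin_right[OF bilin_concat]])
      have N_PU: "free_ext N (PU j) = p j \<otimes>\<^sub>t free_ext N (U j)" for j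
        by (subst fs.free_ext_superset[OF bilin_N finite_keys[of "U j"]])
          (auto simp: PU free_ext_def concat_assoc lin_sum[OF bilin_right[OF bilin_concat]] in_keys_iff
            lin_zero[OF bilin_right[OF bilin_concat]])
      let ?P = "\<Sum>j\<in>Poly_Mapping.keys z. PU j"
      have "Poly_Mapping.lookup (X - ?P) b \<in> ?I" for b
      proof (rule Suc.IH)
        have pU: "p j \<otimes>\<^sub>t Poly_Mapping.lookup (U j) b \<in> tensor_power (A 1) n" for j
          using concat_power[OF p(1) U(1)] Suc by simp
        show "Poly_Mapping.lookup (X - ?P) b \<in> tensor_power (A 1) n"
          unfolding lookup_minus lookup_sum' PU
          by (intro fs.subspace_diff[OF subspace_tensor_power] fs.subspace_sum[OF subspace_tensor_power] X(2) pU)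
        have "dt 1 z = dt 1 (\<Sum>j\<in>Poly_Mapping.keys z. free_tensor scale (Poly_Mapping.lookup z j) (Poly_Mapping.single j 1))"
          by (simp flip: free_decomposition)
        also have "\<dots> = (\<Sum>j\<in>Poly_Mapping.keys z. free_smult mult (Poly_Mapping.lookup z j) (Poly_Mapping.map ?c (U j)))"
          by (simp only: lin_sum[OF lin_dt] dt_tensor[of _ "Poly_Mapping.lookup _ _"] U(2))
        finally have "Poly_Mapping.lookup ?y b = (\<Sum>j\<in>Poly_Mapping.keys z. mult (?c (p j)) (?c (Poly_Mapping.lookup (U j) b)))"
          unfolding yz by (simp add: lookup_sum' lookup_map c0 p(2))
        then show "?c (Poly_Mapping.lookup (X - ?P) b) = 0"
          by (simp add: lookup_minus lookup_sum' PU lin_diff[OF lin_canonical_hom] lin_sum[OF lin_canonical_hom]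
              canonical_hom_concat lookup_map c0)
      qed
      then have "free_ext N (X - ?P) \<in> ?I" by (rule N_ideal)
      moreover have "free_ext N (PU j) \<in> ?I" for j
      proof -
        obtain r where "r \<in> S" "tensor_eq scale (A 1) (free_ext N (U j)) r" using U(3) by blast
        then show ?thesis
          unfolding N_PU using p(1) U(4) tensor_power_subset by (intro tensor_ideal_concat_left) blast+
      qed
      then have "free_ext N ?P \<in> ?I"
        unfolding lin_sum[OF lin_N] by (intro fs.subspace_sum[OF subspace_tensor_ideal])
      ultimately have "free_ext N (X - ?P) + free_ext N ?P \<in> ?I"
        by (rule fs.subspace_add[OF subspace_tensor_ideal])
      then show ?thesis by (simp flip: lin_add[OF lin_N])
    qed
    then show ?case using tensor_ideal_eq[OF xT X(3)] by blast
  qed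
  have "{x \<in> tensor_algebra (A 1). ?c x = 0} = ?I"
  proof
    \<comment> \<open>The canonical map respects degrees, so each homogeneous part of a kernel
      element is in the kernel.\<close>
    have "tensor_part n x \<in> ?I" if "x \<in> tensor_algebra (A 1)" "?c x = 0" for x n
      using ker_homogeneous[OF tensor_part_power[OF that(1)]] hcomp_canonical_hom[OF that(1), of n] that(2) by simp
    then have "(\<Sum>n\<in>length ` Poly_Mapping.keys x. tensor_part n x) \<in> ?I" if "x \<in> tensor_algebra (A 1)" "?c x = 0" for x
      using that by (intro fs.subspace_sum[OF subspace_tensor_ideal]) blast
    then show "{x \<in> tensor_algebra (A 1). ?c x = 0} \<subseteq> ?I"
      unfolding tensor_part_decomposition[symmetric] by blast
    have "?c r = 0" if "r \<in> S" for r
      using ker2[of r] S(2) that tensor_eq_refl by blast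
    moreover have "?I \<subseteq> tensor_algebra (A 1)"
      by (auto simp: tensor_ideal_def)
    ultimately show "?I \<subseteq> {x \<in> tensor_algebra (A 1). ?c x = 0}"
      using tensor_ideal_in_kernel by blast
  qed
  then show ?thesis
    unfolding quadratic_presentation_def using S surj by blast
qed

end

section \<open>The twisted relations\<close>

lemma componentwise_eq:
  "tensor_componentwise f x y = linear_ext fscale (\<lambda>u. linear_ext fscale (\<lambda>v. pure_tensor (map2 f u v)) y) x"
  by (simp add: tensor_componentwise_def bilinear_ext_eq pure_tensor_def)

lemma lin_componentwise_right: "lin fscale fscale (tensor_componentwise f x)"
  unfolding componentwise_eq[abs_def] by (intro fs.lin_linear_ext_fun fs.lin_linear_ext_arg)

context module_algebra
begin

text \<open>An equality of formal combinations and not merely a congruence: \<open>act_multH\<close>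
  applies letter by letter, and \<open>map2\<close> truncates both sides alike.\<close>

lemma componentwise_act_mult:
  "tensor_componentwise act x (tensor_componentwise act y z) = tensor_componentwise act (tensor_componentwise multH x y) z"
proof -
  have "map2 act (map2 multH u v) w = map2 act u (map2 act v w)" for u v w
  proof (induction u arbitrary: v w)
    case (Cons h u)
    then show ?case by (cases v; cases w) (simp_all add: act_multH)
  qed simp
  then show ?thesis
    by (simp add: componentwise_eq fs.linear_ext_linear_ext)
qed

lemma componentwise_act_unit:
  assumes "x \<in> tensor_power V 2"
  shows "tensor_componentwise act (pure_tensor [unitH, unitH]) x = x"
proof -
  have "map2 act [unitH, unitH] w = w" if "w \<in> Poly_Mapping.keys x" for w
    by (subst (1 2) conjunct1[OF tensor_power_2D[OF assms that]]) (simp add: act_unitH)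
  then have "tensor_componentwise act (pure_tensor [unitH, unitH]) x = linear_ext fscale pure_tensor x"
    unfolding componentwise_eq fs.linear_ext_pure by (intro fs.linear_ext_cong) simp
  then show ?thesis by simp
qed

text \<open>A pair \<open>[g, h]\<close> acts letter by letter, so a relation in one slot goes to a
  relation in the same slot. Stability of \<open>V\<close> keeps the other letter in
  \<open>V\<close>.\<close>

lemma componentwise_act_respects_right:
  assumes t: "t \<in> tensor_power UNIV 2" and act: "\<And>h a. a \<in> V \<Longrightarrow> act h a \<in> V"
    and eq: "tensor_eq scale V x y" "x \<in> tensor_power V 2" "y \<in> tensor_power V 2"
  shows "tensor_eq scale V (tensor_componentwise act t x) (tensor_componentwise act t y)"
proof -
  let ?N = "fs.span (multilinear_relations scale V)"
  have t2: "u = [u ! 0, u ! 1]" if "u \<in> Poly_Mapping.keys t" for u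
    using tensor_power_2D[OF t that] by blast
  have "linear_ext fscale (\<lambda>w. linear_ext fscale (\<lambda>u. pure_tensor (map2 act u w)) t) x -
      linear_ext fscale (\<lambda>w. linear_ext fscale (\<lambda>u. pure_tensor (map2 act u w)) t) y \<in> ?N"
  proof (rule fs.linear_ext_respects[OF fs.subspace_span _ _ eq];
      unfold linear_ext_fun_diff3 linear_ext_fun_diff_scale;
      rule fs.linear_ext_in_subspace[OF fs.subspace_span])
    fix u w a b v assume *: "set u \<subseteq> V" "set w \<subseteq> V" "a \<in> V" "b \<in> V" "length u + length w + 1 = 2" "v \<in> Poly_Mapping.keys t"
    obtain g h where v: "v = [g, h]" using t2[OF *(6)] by blast
    show "pure_tensor (map2 act v (u @ [a + b] @ w)) - pure_tensor (map2 act v (u @ [a] @ w)) -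
        pure_tensor (map2 act v (u @ [b] @ w)) \<in> ?N"
      using *(5)
    proof (rule length2E)
      fix c assume "u = []" "w = [c]"
      then show ?thesis
        using relation_add[of "[]" V "[act h c]" "act g a" "act g b" scale] * act by (simp add: v act_add_right)
    next
      fix c assume "u = [c]" "w = []"
      then show ?thesis
        using relation_add[of "[act g c]" V "[]" "act h a" "act h b" scale] * act by (simp add: v act_add_right)
    qed
  next
    fix u w a c v assume *: "set u \<subseteq> V" "set w \<subseteq> V" "a \<in> V" "length u + length w + 1 = 2" "v \<in> Poly_Mapping.keys t"
    obtain g h where v: "v = [g, h]" using t2[OF *(5)] by blast
    show "pure_tensor (map2 act v (u @ [scale c a] @ w)) - fscale c (pure_tensor (map2 act v (u @ [a] @ w))) \<in> ?N"
      using *(4)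
    proof (rule length2E)
      fix b assume "u = []" "w = [b]"
      then show ?thesis
        using relation_scale[of "[]" V "[act h b]" "act g a" scale c] * act by (simp add: v act_scale_right)
    next
      fix b assume "u = [b]" "w = []"
      then show ?thesis
        using relation_scale[of "[act g b]" V "[]" "act h a" scale c] * act by (simp add: v act_scale_right)
    qed
  qed
  then show ?thesis
    unfolding tensor_eq_def componentwise_eq fs.linear_ext_swap[of _ _ t] .
qed

text \<open>Linearity of \<open>act\<close> in its first argument turns each relation between words
  in \<open>H\<close> into one between words in \<open>V\<close>.\<close>

lemma componentwise_act_respects_left:
  assumes x: "x \<in> tensor_power V 2" and act: "\<And>h a. a \<in> V \<Longrightarrow> act h a \<in> V"
    and eq: "tensor_eq scaleH UNIV s t" "s \<in> tensor_power UNIV 2" "t \<in> tensor_power UNIV 2"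
  shows "tensor_eq scale V (tensor_componentwise act s x) (tensor_componentwise act t x)"
proof -
  let ?N = "fs.span (multilinear_relations scale V)"
  have x2: "v = [v ! 0, v ! 1] \<and> v ! 0 \<in> V \<and> v ! 1 \<in> V" if "v \<in> Poly_Mapping.keys x" for v
    by (rule tensor_power_2D[OF x that])
  show ?thesis
    unfolding tensor_eq_def componentwise_eq
  proof (rule fs.linear_ext_respects[OF fs.subspace_span _ _ eq];
      unfold linear_ext_fun_diff3 linear_ext_fun_diff_scale;
      rule fs.linear_ext_in_subspace[OF fs.subspace_span])
    fix u w :: "'h list" and a b v assume *: "length u + length w + 1 = (2 :: nat)" "v \<in> Poly_Mapping.keys x"
    obtain p q where v: "v = [p, q]" "p \<in> V" "q \<in> V" using x2[OF *(2)] by blast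
    show "pure_tensor (map2 act (u @ [a + b] @ w) v) - pure_tensor (map2 act (u @ [a] @ w) v) -
        pure_tensor (map2 act (u @ [b] @ w) v) \<in> ?N"
      using *(1)
    proof (rule length2E)
      fix c assume "u = []" "w = [c]"
      then show ?thesis
        using relation_add[of "[]" V "[act c q]" "act a p" "act b p" scale] v act by (simp add: act_add_left)
    next
      fix c assume "u = [c]" "w = []"
      then show ?thesis
        using relation_add[of "[act c p]" V "[]" "act a q" "act b q" scale] v act by (simp add: act_add_left)
    qed
  next
    fix u w :: "'h list" and a c v assume *: "length u + length w + 1 = (2 :: nat)" "v \<in> Poly_Mapping.keys x"
    obtain p q where v: "v = [p, q]" "p \<in> V" "q \<in> V" using x2[OF *(2)] by blast
    show "pure_tensor (map2 act (u @ [scaleH c a] @ w) v) - fscale c (pure_tensor (map2 act (u @ [a] @ w) v)) \<in> ?N"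
      using *(1)
    proof (rule length2E)
      fix b assume "u = []" "w = [b]"
      then show ?thesis
        using relation_scale[of "[]" V "[act b q]" "act a p" scale c] v act by (simp add: act_scale_left)
    next
      fix b assume "u = [b]" "w = []"
      then show ?thesis
        using relation_scale[of "[act b p]" V "[]" "act a q" scale c] v act by (simp add: act_scale_left)
    qed
  qed
qed

end

context cocycle_twist
begin

text \<open>A word of length two involves a single twisted product, as multiplying by the final unit
  is trivial, and that product is \<open>mult\<close> after the action of
  \<open>\<nu>\<close>.\<close>

lemma twisted_canonical_hom_degree_two:
  assumes "x \<in> tensor_power (A 1) 2"
  shows "canonical_hom scale tmult unit x = canonical_hom scale mult unit (tensor_componentwise act \<nu> x)"
proof -
  interpret T: assoc_algebra scale tmult unit by (rule assoc_algebra_twist)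
  have w: "foldr tmult w unit = twist scale mult act act \<nu> (w ! 0) (w ! 1)" if "w \<in> Poly_Mapping.keys x" for w
    by (subst conjunct1[OF tensor_power_2D[OF assms that]]) (simp add: T.mult_unit_right, simp add: tmult_eq)
  have "foldr mult (map2 act u w) unit = mult (act (u ! 0) (w ! 0)) (act (u ! 1) (w ! 1))"
    if "u \<in> Poly_Mapping.keys \<nu>" "w \<in> Poly_Mapping.keys x" for u w
    by (subst conjunct1[OF tensor_power_2D[OF \<nu>2 that(1)]], subst conjunct1[OF tensor_power_2D[OF assms that(2)]])
      (simp add: A.mult_unit_right)
  then have "canonical_hom scale mult unit (tensor_componentwise act \<nu> x) =
      linear_ext scale (\<lambda>u. linear_ext scale (\<lambda>w. mult (act (u ! 0) (w ! 0)) (act (u ! 1) (w ! 1))) x) \<nu>"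
    unfolding canonical_hom_def tensor_componentwise_def A.linear_ext_bilinear_ext
    by (intro A.linear_ext_cong) simp
  also have "\<dots> = linear_ext scale (\<lambda>w. twist scale mult act act \<nu> (w ! 0) (w ! 1)) x"
    unfolding twist_def by (rule A.linear_ext_swap)
  also have "\<dots> = canonical_hom scale tmult unit x"
    unfolding canonical_hom_def by (intro A.linear_ext_cong) (simp add: w)
  finally show ?thesis ..
qed

lemma act_degree_one: "a \<in> A 1 \<Longrightarrow> act h a \<in> A 1"
  by (rule act_degree)

lemma componentwise_act_inverse:
  assumes "z \<in> tensor_power (A 1) 2" "s \<in> tensor_power UNIV 2" "t \<in> tensor_power UNIV 2"
    "tensor_eq scaleH UNIV (tensor_componentwise multH s t) (pure_tensor [unitH, unitH])"
  shows "tensor_eq scale (A 1) (tensor_componentwise act s (tensor_componentwise act t z)) z"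
  using componentwise_act_respects_left[OF assms(1) act_degree_one assms(4)
      tensor_componentwise_power[OF assms(2,3) UNIV_I] pure_tensor_2_power]
  by (simp add: componentwise_act_mult componentwise_act_unit[OF assms(1)])

lemma twisted_degree_two_kernel:
  assumes R: "quadratic_presentation scale mult unit (A 1) R" and x: "x \<in> tensor_power (A 1) 2"
  shows "canonical_hom scale tmult unit x = 0 \<longleftrightarrow>
    (\<exists>r\<in>{tensor_componentwise act \<mu> r | r. r \<in> R}. tensor_eq scale (A 1) x r)"
proof -
  have R2: "R \<subseteq> tensor_power (A 1) 2" "fs.subspace R"
    and ker: "{x \<in> tensor_algebra (A 1). canonical_hom scale mult unit x = 0} = tensor_ideal scale (A 1) R"
    using R unfolding quadratic_presentation_def by auto
  have pow: "tensor_componentwise act t z \<in> tensor_power (A 1) 2"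
    if "t \<in> tensor_power UNIV 2" "z \<in> tensor_power (A 1) 2" for t z
    by (rule tensor_componentwise_power[OF that]) (rule act_degree_one)
  have cong: "tensor_eq scale (A 1) (tensor_componentwise act t y) (tensor_componentwise act t z)"
    if "tensor_eq scale (A 1) y z" "y \<in> tensor_power (A 1) 2" "z \<in> tensor_power (A 1) 2" "t \<in> tensor_power UNIV 2" for t y z
    using componentwise_act_respects_right[OF that(4) act_degree_one that(1-3)] .
  note \<nu>x = pow[OF \<nu>2 x]
  have "canonical_hom scale tmult unit x = 0 \<longleftrightarrow> tensor_componentwise act \<nu> x \<in> tensor_ideal scale (A 1) R"
    using \<nu>x tensor_power_subset unfolding twisted_canonical_hom_degree_two[OF x] ker[symmetric] by blast
  \<comment> \<open>In degree two the ideal generated by \<open>R\<close> is \<open>R\<close> up to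
    congruence.\<close>
  also have "\<dots> \<longleftrightarrow> (\<exists>r\<in>R. tensor_eq scale (A 1) (tensor_componentwise act \<nu> x) r)"
  proof
    assume "tensor_componentwise act \<nu> x \<in> tensor_ideal scale (A 1) R"
    then show "\<exists>r\<in>R. tensor_eq scale (A 1) (tensor_componentwise act \<nu> x) r"
      by (rule tensor_part_ideal[OF R2(2,1) \<nu>x])
  next
    assume "\<exists>r\<in>R. tensor_eq scale (A 1) (tensor_componentwise act \<nu> x) r"
    then obtain r where r: "r \<in> R" "tensor_eq scale (A 1) (tensor_componentwise act \<nu> x) r" by blast
    have "pure_tensor [] \<otimes>\<^sub>t tensor_componentwise act \<nu> x \<in> tensor_ideal scale (A 1) R"
      by (rule tensor_ideal_concat_left[OF _ subsetD[OF tensor_power_subset \<nu>x] r(2) r(1)])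
        (simp add: tensor_algebra_def pure_tensor_def)
    then show "tensor_componentwise act \<nu> x \<in> tensor_ideal scale (A 1) R"
      by (simp add: concat_eq)
  qed
  \<comment> \<open>\<open>\<mu>\<close> and \<open>\<nu>\<close> act as inverse maps only up to
    \<open>tensor_eq\<close>, so the action is moved across by transitivity, for the same
    \<open>r\<close>.\<close>
  also have "\<dots> \<longleftrightarrow> (\<exists>r\<in>R. tensor_eq scale (A 1) x (tensor_componentwise act \<mu> r))"
  proof (intro bex_cong refl iffI)
    fix r assume "r \<in> R"
    then have r: "r \<in> tensor_power (A 1) 2" using R2(1) by blast
    show "tensor_eq scale (A 1) x (tensor_componentwise act \<mu> r)"
      if "tensor_eq scale (A 1) (tensor_componentwise act \<nu> x) r"
      using tensor_eq_trans[OF tensor_eq_sym[OF componentwise_act_inverse[OF x \<mu>2 \<nu>2 \<mu>\<nu>]] cong[OF that \<nu>x r \<mu>2]] .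
    show "tensor_eq scale (A 1) (tensor_componentwise act \<nu> x) r"
      if "tensor_eq scale (A 1) x (tensor_componentwise act \<mu> r)"
      using tensor_eq_trans[OF cong[OF that x pow[OF \<mu>2 r] \<nu>2] componentwise_act_inverse[OF r \<nu>2 \<mu>2 \<nu>\<mu>]] .
  qed
  finally show ?thesis by blast
qed

end

theorem theorem3p1:
  fixes scaleH :: "'k::field \<Rightarrow> 'h::ab_group_add \<Rightarrow> 'h"
    and multH :: "'h \<Rightarrow> 'h \<Rightarrow> 'h" and unitH :: 'h
    and coprod :: "'h \<Rightarrow> ('h, 'k) tensor" and counit :: "'h \<Rightarrow> 'k" and antipode :: "'h \<Rightarrow> 'h"
    and scale :: "'k \<Rightarrow> 'a::ab_group_add \<Rightarrow> 'a"
    and mult :: "'a \<Rightarrow> 'a \<Rightarrow> 'a" and unit :: 'a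
    and A :: "nat \<Rightarrow> 'a set" and R :: "('a, 'k) tensor set"
    and act :: "'h \<Rightarrow> 'a \<Rightarrow> 'a" and \<mu> :: "('h, 'k) tensor"
  assumes "hopf_algebra scaleH multH unitH coprod counit antipode"
    and "koszul_algebra scale mult unit A"
    and "quadratic_presentation scale mult unit (A 1) R"
    and "module_algebra scaleH multH unitH coprod counit antipode scale mult unit act"
    and "\<And>h a i. a \<in> A i \<Longrightarrow> act h a \<in> A i"
    and "hopf_algebra.two_cocycle scaleH multH unitH coprod \<mu>"
    and "hopf_algebra.counital scaleH unitH counit \<mu>"
  shows "koszul_algebra scale (twisted_mult scaleH multH unitH scale mult act \<mu>) unit A \<and>
         quadratic_presentation scale (twisted_mult scaleH multH unitH scale mult act \<mu>) unit (A 1)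
           {tensor_componentwise act \<mu> r | r. r \<in> R}"
proof -
  obtain B :: "nat \<Rightarrow> nat set" and d e where "linear_free_resolution scale mult unit A B d e"
    and graded: "connected_graded_algebra scale mult unit A"
    and fin: "connected_graded_algebra.locally_finite_dim scale A"
    using assms(2) unfolding koszul_algebra_def by blast
  then interpret twisted_resolution scaleH multH unitH coprod counit antipode scale mult unit act A \<mu> B d e
    by (intro twisted_resolution.intro cocycle_twist.intro cocycle_twist_axioms.intro assms)
  obtain d' e' where "linear_free_resolution scale tmult unit A B d' e'"
    using twisted_resolution by blast
  then interpret T: linear_free_resolution scale tmult unit A B d' e' .
  \<comment> \<open>Local finiteness speaks only of the scalars and the grading, and the resolution
    keeps its bases \<open>B\<close>.\<close>
  have "koszul_algebra scale tmult unit A"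
    unfolding koszul_algebra_def
    using T.connected_graded_algebra_axioms T.linear_free_resolution_axioms fin by blast
  moreover have "quadratic_presentation scale tmult unit (A 1) {tensor_componentwise act \<mu> r | r. r \<in> R}"
  proof (rule T.quadratic_presentation_of_degree_two_kernel)
    have R: "R \<subseteq> tensor_power (A 1) 2" "fs.subspace R"
      using assms(3) unfolding quadratic_presentation_def by auto
    let ?m = "tensor_componentwise act \<mu>"
    note l = lin_componentwise_right[of act \<mu>]
    have m2: "?m r \<in> tensor_power (A 1) 2" if "r \<in> R" for r
      by (rule tensor_componentwise_power[OF \<mu>2 subsetD[OF R(1) that]]) (rule act_degree_one)
    then show "{?m r | r. r \<in> R} \<subseteq> tensor_power (A 1) 2"
      by blast
    show "fs.subspace {?m r | r. r \<in> R}"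
    proof (rule fs.subspaceI)
      show "0 \<in> {?m r | r. r \<in> R}"
        using fs.subspace_0[OF R(2)] by (intro CollectI exI[of _ 0] conjI lin_zero[OF l, symmetric])
    next
      fix x y assume "x \<in> {?m r | r. r \<in> R}" "y \<in> {?m r | r. r \<in> R}"
      then obtain r r' where r: "x = ?m r" "r \<in> R" "y = ?m r'" "r' \<in> R" by blast
      have "r + r' \<in> R" by (rule fs.subspace_add[OF R(2) r(2,4)])
      then show "x + y \<in> {?m r | r. r \<in> R}"
        unfolding r(1,3) lin_add[OF l, symmetric] by blast
    next
      fix c x assume "x \<in> {?m r | r. r \<in> R}"
      then obtain r where r: "x = ?m r" "r \<in> R" by blast
      have "fscale c r \<in> R" by (rule fs.subspace_scale[OF R(2) r(2)])
      then show "fscale c x \<in> {?m r | r. r \<in> R}"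
        unfolding r(1) lin_scale[OF l, symmetric] by blast
    qed
    show "canonical_hom scale tmult unit x = 0 \<longleftrightarrow> (\<exists>r\<in>{?m r | r. r \<in> R}. tensor_eq scale (A 1) x r)"
      if "x \<in> tensor_power (A 1) 2" for x
      by (rule twisted_degree_two_kernel[OF assms(3) that])
  qed
  ultimately show ?thesis ..
qed

end
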